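(* Let $\mathcal{K}:H^1_0(\Omega)\to H^{-1}(\Omega)$ be any bounded linear operator. Then the following statements (i)–(ii) hold: (i) There exists a constant $C_{\rm rel}'>0$ such that $$|G(u)-G(u_H)|\le C_{\rm rel}'\,\big[\eta_H(u_H)^2+\zeta_H(z_H[u_H])^2\big]\quad\text{for all }\mathcal{T}_H\in\mathbb{T}.$$ (ii) For all $0<\theta\le1$ and $1<C_{\rm mark}\le\infty$, Algorithm B leads to convergence $$|G(u)-G(u_\ell)|\le C_{\rm rel}'\,\big[\eta_\ell(u_\ell)^2+\zeta_\ell(z_\ell[u_\ell])^2\big]\longrightarrow0\quad\text{as }\ell\to\infty.$$ The constant $C_{\rm rel}'$ depends only on the constants from (A1)–(A3), the bilinear form $a(\cdot,\cdot)$, and the boundedness of $\mathcal{K}$.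
   Context: **Model problem.** $\Omega\subset\mathbb{R}^d$, $d\ge2$, is a bounded Lipschitz domain; $f\in L^2(\Omega)$, $\boldsymbol{f}\in[L^2(\Omega)]^d$; $\boldsymbol{A},\boldsymbol{b},c\in L^\infty(\Omega)$ with $\boldsymbol{A}(x)\in\mathbb{R}^{d\times d}$ symmetric and uniformly positive definite, $\boldsymbol{b}(x)\in\mathbb{R}^d$, $c(x)\in\mathbb{R}$. Set $a(u,v):=\int_\Omega \boldsymbol{A}\nabla u\cdot\nabla v\,dx+\int_\Omega \boldsymbol{b}\cdot\nabla u\,v\,dx+\int_\Omega cuv\,dx$, assumed continuous and elliptic on $H^1_0(\Omega)$ (i.e., $a(v,v)\ge C_{\rm ell}\|v\|_{H^1(\Omega)}^2$ with $C_{\rm ell}>0$), and $F(v):=\int_\Omega fv\,dx-\int_\Omega\boldsymbol{f}\cdot\nabla v\,dx$. The energy norm is $|\!|\!|v|\!|\!|^2:=\int_\Omega\boldsymbol{A}\nabla v\cdot\nabla v\,dx$, an equivalent norm on $H^1_0(\Omega)$. For a bounded linear operator $\mathcal{K}:H^1_0(\Omega)\to H^{-1}(\Omega):=H^1_0(\Omega)'$, set $b(v,w):=\langle\mathcal{K}v,w\rangle_{H^{-1}\times H^1_0}$ and $G(v):=b(v,v)$. The primal solution $u\in H^1_0(\Omega)$ solves $a(u,v)=F(v)$ for all $v\in H^1_0(\Omega)$. For $w\in H^1_0(\Omega)$, the dual solution $z[w]\in H^1_0(\Omega)$ solves $a(v,z[w])=b(v,w)+b(w,v)$ for all $v\in H^1_0(\Omega)$.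 **Discretization.** For a conforming triangulation $\mathcal{T}_H$ of $\Omega$ into compact simplices and a fixed polynomial degree $p\ge1$, $\mathcal{X}_H:=\{v_H\in H^1_0(\Omega): v_H|_T\text{ is a polynomial of degree}\le p\text{ for all }T\in\mathcal{T}_H\}$. The discrete solutions $u_H,z_H[w]\in\mathcal{X}_H$ solve $a(u_H,v_H)=F(v_H)$ and $a(v_H,z_H[w])=b(v_H,w)+b(w,v_H)$ for all $v_H\in\mathcal{X}_H$. Quantities with index $h$, $\ell$, etc. are associated in the same way with $\mathcal{T}_h$, $\mathcal{T}_\ell$, etc. **Mesh refinement.** $\mathcal{T}_0$ is a fixed initial conforming triangulation. A fixed deterministic refinement strategy (e.g., newest vertex bisection) is given: for a triangulation $\mathcal{T}_H$ and marked elements $\mathcal{M}_H\subseteq\mathcal{T}_H$, $\mathtt{refine}(\mathcal{T}_H,\mathcal{M}_H)$ is the coarsest triangulation $\mathcal{T}_h$ in which all $T\in\mathcal{M}_H$ have been refined, i.e., $\mathcal{M}_H\subseteq\mathcal{T}_H\setminus\mathcal{T}_h$. Write $\mathcal{T}_h\in\mathbb{T}(\mathcal{T}_H)$ if $\mathcal{T}_h$ is obtained from $\mathcal{T}_H$ by finitely many refinement steps, and $\mathbb{T}:=\mathbb{T}(\mathcal{T}_0)$. If $\mathcal{T}_h\in\mathbb{T}(\mathcal{T}_H)$, then $\mathcal{X}_H\subseteq\mathcal{X}_h$. Assumptions: (a) $\#(\mathcal{T}_H\setminus\mathcal{T}_h)+\#\mathcal{T}_H\le\#\mathcal{T}_h$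 for all $\mathcal{T}_H\in\mathbb{T}$, $\mathcal{T}_h\in\mathbb{T}(\mathcal{T}_H)$; (b) if $\mathcal{T}_{j+1}=\mathtt{refine}(\mathcal{T}_j,\mathcal{M}_j)$ for all $j$, then $\#\mathcal{T}_\ell-\#\mathcal{T}_0\le C_{\rm mesh}\sum_{j=0}^{\ell-1}\#\mathcal{M}_j$ for all $\ell\in\mathbb{N}$, with $C_{\rm mesh}>0$ depending only on $\mathcal{T}_0$; (c) all $\mathcal{T}_H,\mathcal{T}_h\in\mathbb{T}$ have a common refinement $\mathcal{T}_H\oplus\mathcal{T}_h\in\mathbb{T}(\mathcal{T}_H)\cap\mathbb{T}(\mathcal{T}_h)$ with $\#(\mathcal{T}_H\oplus\mathcal{T}_h)\le\#\mathcal{T}_H+\#\mathcal{T}_h-\#\mathcal{T}_0$. **Error estimators.** For $\mathcal{T}_H\in\mathbb{T}$, $v_H\in\mathcal{X}_H$, $T\in\mathcal{T}_H$, refinement indicators $\eta_H(T,v_H)\ge0$ and $\zeta_H(T,v_H)\ge0$ are given. For $\mathcal{U}_H\subseteq\mathcal{T}_H$, $\eta_H(\mathcal{U}_H,v_H):=\big(\sum_{T\in\mathcal{U}_H}\eta_H(T,v_H)^2\big)^{1/2}$, $\eta_H(v_H):=\eta_H(\mathcal{T}_H,v_H)$, and analogously for $\zeta_H$. There are constants $C_{\rm stab},C_{\rm rel},C_{\rm drel}>0$ and $0<q_{\rm red}<1$ such that for all $\mathcal{T}_H\in\mathbb{T}$ and $\mathcal{T}_h\in\mathbb{T}(\mathcal{T}_H)$: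 (A1) stability: for all $v_h\in\mathcal{X}_h$, $v_H\in\mathcal{X}_H$, $\mathcal{U}_H\subseteq\mathcal{T}_h\cap\mathcal{T}_H$: $|\eta_h(\mathcal{U}_H,v_h)-\eta_H(\mathcal{U}_H,v_H)|+|\zeta_h(\mathcal{U}_H,v_h)-\zeta_H(\mathcal{U}_H,v_H)|\le C_{\rm stab}|\!|\!|v_h-v_H|\!|\!|$. (A2) reduction: for all $v_H\in\mathcal{X}_H$: $\eta_h(\mathcal{T}_h\setminus\mathcal{T}_H,v_H)\le q_{\rm red}\,\eta_H(\mathcal{T}_H\setminus\mathcal{T}_h,v_H)$ and $\zeta_h(\mathcal{T}_h\setminus\mathcal{T}_H,v_H)\le q_{\rm red}\,\zeta_H(\mathcal{T}_H\setminus\mathcal{T}_h,v_H)$. (A3) reliability: for all $w\in H^1_0(\Omega)$: $|\!|\!|u-u_H|\!|\!|\le C_{\rm rel}\,\eta_H(u_H)$ and $|\!|\!|z[w]-z_H[w]|\!|\!|\le C_{\rm rel}\,\zeta_H(z_H[w])$. (A4) discrete reliability: for all $w\in H^1_0(\Omega)$: $|\!|\!|u_h-u_H|\!|\!|\le C_{\rm drel}\,\eta_H(\mathcal{T}_H\setminus\mathcal{T}_h,u_H)$ and $|\!|\!|z_h[w]-z_H[w]|\!|\!|\le C_{\rm drel}\,\zeta_H(\mathcal{T}_H\setminus\mathcal{T}_h,z_H[w])$. **Algorithm B.** Input: $0<\theta\le1$, $C_{\rm mark}\ge1$, $\mathcal{T}_0$. For $\ell=0,1,2,\dots$: (i) compute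 $u_\ell,z_\ell[u_\ell]\in\mathcal{X}_\ell$; (ii) compute $\eta_\ell(T,u_\ell)$, $\zeta_\ell(T,z_\ell[u_\ell])$ for all $T\in\mathcal{T}_\ell$; (iii) determine a set $\mathcal{M}_\ell\subseteq\mathcal{T}_\ell$ of, up to the multiplicative constant $C_{\rm mark}$, minimal cardinality such that $\theta[\eta_\ell(u_\ell)^2+\zeta_\ell(z_\ell[u_\ell])^2]\le\eta_\ell(\mathcal{M}_\ell,u_\ell)^2+\zeta_\ell(\mathcal{M}_\ell,z_\ell[u_\ell])^2$; (iv) set $\mathcal{T}_{\ell+1}:=\mathtt{refine}(\mathcal{T}_\ell,\mathcal{M}_\ell)$. The choice $C_{\rm mark}=\infty$ means that no cardinality restriction is imposed in (iii). *)

theory Defs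
  imports "HOL-Analysis.Analysis"
begin

section \<open>Lebesgue and Sobolev spaces\<close>

text \<open>
  Elements of the function spaces are functions on the whole space, of which only the values on
  the domain matter; two functions that agree almost everywhere on the domain are at distance zero
  but are not identified.
\<close>

definition L2_space :: "(real^'d) set \<Rightarrow> (real^'d \<Rightarrow> 'b::euclidean_space) set" where
  "L2_space \<Omega> = {v \<in> borel_measurable (lebesgue_on \<Omega>).
                   integrable (lebesgue_on \<Omega>) (\<lambda>x. (norm (v x))\<^sup>2)}"

definition Linf_space :: "(real^'d) set \<Rightarrow> (real^'d \<Rightarrow> 'b::euclidean_space) set" where
  "Linf_space \<Omega> = {v \<in> borel_measurable (lebesgue_on \<Omega>).
                     \<exists>C. AE x\<in>\<Omega> in lebesgue. norm (v x) \<le> C}"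

definition grad :: "(real^'d \<Rightarrow> real) \<Rightarrow> real^'d \<Rightarrow> real^'d" where
  "grad \<phi> x = (\<chi> i. frechet_derivative \<phi> (at x) (axis i 1))"

primrec Ck :: "nat \<Rightarrow> (real^'d \<Rightarrow> real) \<Rightarrow> bool" where
  "Ck 0 \<phi> \<longleftrightarrow> continuous_on UNIV \<phi>"
| "Ck (Suc k) \<phi> \<longleftrightarrow> (\<forall>x. \<phi> differentiable (at x)) \<and> (\<forall>i. Ck k (\<lambda>x. grad \<phi> x $ i))"

definition test_functions :: "(real^'d) set \<Rightarrow> (real^'d \<Rightarrow> real) set" where
  "test_functions \<Omega> = {\<phi>. (\<forall>k. Ck k \<phi>) \<and> compact (closure {x. \<phi> x \<noteq> 0}) \<and>
                           closure {x. \<phi> x \<noteq> 0} \<subseteq> \<Omega>}"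

definition weak_gradient ::
    "(real^'d) set \<Rightarrow> (real^'d \<Rightarrow> real) \<Rightarrow> (real^'d \<Rightarrow> real^'d) \<Rightarrow> bool" where
  "weak_gradient \<Omega> v g \<longleftrightarrow>
     (\<forall>\<phi>\<in>test_functions \<Omega>.
        (LINT x|lebesgue_on \<Omega>. v x *\<^sub>R grad \<phi> x) = - (LINT x|lebesgue_on \<Omega>. \<phi> x *\<^sub>R g x))"

definition H1_space :: "(real^'d) set \<Rightarrow> (real^'d \<Rightarrow> real) set" where
  "H1_space \<Omega> = {v \<in> L2_space \<Omega>. \<exists>g\<in>L2_space \<Omega>. weak_gradient \<Omega> v g}"

definition wgrad :: "(real^'d) set \<Rightarrow> (real^'d \<Rightarrow> real) \<Rightarrow> real^'d \<Rightarrow> real^'d" where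
  "wgrad \<Omega> v = (SOME g. g \<in> L2_space \<Omega> \<and> weak_gradient \<Omega> v g)"

definition H1_norm :: "(real^'d) set \<Rightarrow> (real^'d \<Rightarrow> real) \<Rightarrow> real" where
  "H1_norm \<Omega> v = sqrt ((LINT x|lebesgue_on \<Omega>. (v x)\<^sup>2) +
                        (LINT x|lebesgue_on \<Omega>. (norm (wgrad \<Omega> v x))\<^sup>2))"

definition H10 :: "(real^'d) set \<Rightarrow> (real^'d \<Rightarrow> real) set" where
  "H10 \<Omega> = {v \<in> H1_space \<Omega>. \<forall>\<epsilon>>0. \<exists>\<phi>\<in>test_functions \<Omega>. H1_norm \<Omega> (\<lambda>x. v x - \<phi> x) < \<epsilon>}"

definition Hminus1 :: "(real^'d) set \<Rightarrow> ((real^'d \<Rightarrow> real) \<Rightarrow> real) set" where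
  "Hminus1 \<Omega> = {\<Phi>.
     (\<forall>v\<in>H10 \<Omega>. \<forall>w\<in>H10 \<Omega>. \<forall>s t. \<Phi> (\<lambda>x. s * v x + t * w x) = s * \<Phi> v + t * \<Phi> w) \<and>
     (\<exists>C. \<forall>v\<in>H10 \<Omega>. \<bar>\<Phi> v\<bar> \<le> C * H1_norm \<Omega> v)}"

definition Hminus1_norm :: "(real^'d) set \<Rightarrow> ((real^'d \<Rightarrow> real) \<Rightarrow> real) \<Rightarrow> real" where
  "Hminus1_norm \<Omega> \<Phi> = (SUP v\<in>{v \<in> H10 \<Omega>. H1_norm \<Omega> v \<le> 1}. \<bar>\<Phi> v\<bar>)"

text \<open>
  For an operator \<open>K\<close> from \<open>H10 \<Omega>\<close> to its dual, \<open>K v w\<close> is the duality pairing of \<open>K v\<close> with \<open>w\<close>.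
\<close>

definition bounded_linear_operator ::
    "(real^'d) set \<Rightarrow> ((real^'d \<Rightarrow> real) \<Rightarrow> (real^'d \<Rightarrow> real) \<Rightarrow> real) \<Rightarrow> bool" where
  "bounded_linear_operator \<Omega> K \<longleftrightarrow>
     (\<forall>v\<in>H10 \<Omega>. K v \<in> Hminus1 \<Omega>) \<and>
     (\<forall>v\<in>H10 \<Omega>. \<forall>v'\<in>H10 \<Omega>. \<forall>s t. \<forall>w\<in>H10 \<Omega>.
        K (\<lambda>x. s * v x + t * v' x) w = s * K v w + t * K v' w) \<and>
     (\<exists>C. \<forall>v\<in>H10 \<Omega>. Hminus1_norm \<Omega> (K v) \<le> C * H1_norm \<Omega> v)"

definition operator_norm ::
    "(real^'d) set \<Rightarrow> ((real^'d \<Rightarrow> real) \<Rightarrow> (real^'d \<Rightarrow> real) \<Rightarrow> real) \<Rightarrow> real" where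
  "operator_norm \<Omega> K = (SUP v\<in>{v \<in> H10 \<Omega>. H1_norm \<Omega> v \<le> 1}. Hminus1_norm \<Omega> (K v))"

definition goal_functional ::
    "((real^'d \<Rightarrow> real) \<Rightarrow> (real^'d \<Rightarrow> real) \<Rightarrow> real) \<Rightarrow> (real^'d \<Rightarrow> real) \<Rightarrow> real" where
  "goal_functional K v = K v v"


section \<open>Model problem\<close>

text \<open>
  Near each boundary point the domain lies strictly above the graph of a Lipschitz function over
  the hyperplane orthogonal to some unit vector \<open>\<nu>\<close>.
\<close>

definition bounded_lipschitz_domain :: "(real^'d) set \<Rightarrow> bool" where
  "bounded_lipschitz_domain \<Omega> \<longleftrightarrow>
     \<Omega> \<noteq> {} \<and> open \<Omega> \<and> connected \<Omega> \<and> bounded \<Omega> \<and>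
     (\<forall>x\<in>frontier \<Omega>. \<exists>r>0. \<exists>\<nu> \<gamma> L. norm \<nu> = 1 \<and> L-lipschitz_on {y. y \<bullet> \<nu> = 0} \<gamma> \<and>
        \<Omega> \<inter> ball x r = {y \<in> ball x r. \<gamma> (y - (y \<bullet> \<nu>) *\<^sub>R \<nu>) < y \<bullet> \<nu>})"

definition bilinear_form ::
    "(real^'d) set \<Rightarrow> (real^'d \<Rightarrow> real^'d^'d) \<Rightarrow> (real^'d \<Rightarrow> real^'d) \<Rightarrow> (real^'d \<Rightarrow> real) \<Rightarrow>
     (real^'d \<Rightarrow> real) \<Rightarrow> (real^'d \<Rightarrow> real) \<Rightarrow> real" where
  "bilinear_form \<Omega> A b c v w =
     (LINT x|lebesgue_on \<Omega>. (A x *v wgrad \<Omega> v x) \<bullet> wgrad \<Omega> w x) +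
     (LINT x|lebesgue_on \<Omega>. (b x \<bullet> wgrad \<Omega> v x) * w x) +
     (LINT x|lebesgue_on \<Omega>. c x * v x * w x)"

definition load ::
    "(real^'d) set \<Rightarrow> (real^'d \<Rightarrow> real) \<Rightarrow> (real^'d \<Rightarrow> real^'d) \<Rightarrow> (real^'d \<Rightarrow> real) \<Rightarrow> real" where
  "load \<Omega> f g v =
     (LINT x|lebesgue_on \<Omega>. f x * v x) - (LINT x|lebesgue_on \<Omega>. g x \<bullet> wgrad \<Omega> v x)"

definition energy_norm ::
    "(real^'d) set \<Rightarrow> (real^'d \<Rightarrow> real^'d^'d) \<Rightarrow> (real^'d \<Rightarrow> real) \<Rightarrow> real" where
  "energy_norm \<Omega> A v = sqrt (LINT x|lebesgue_on \<Omega>. (A x *v wgrad \<Omega> v x) \<bullet> wgrad \<Omega> v x)"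

definition admissible_coefficients ::
    "(real^'d) set \<Rightarrow> (real^'d \<Rightarrow> real^'d^'d) \<Rightarrow> (real^'d \<Rightarrow> real^'d) \<Rightarrow> (real^'d \<Rightarrow> real) \<Rightarrow> bool"
  where
  "admissible_coefficients \<Omega> A b c \<longleftrightarrow>
     A \<in> Linf_space \<Omega> \<and> b \<in> Linf_space \<Omega> \<and> c \<in> Linf_space \<Omega> \<and>
     (AE x\<in>\<Omega> in lebesgue. transpose (A x) = A x) \<and>
     (\<exists>\<alpha>>0. AE x\<in>\<Omega> in lebesgue. \<forall>\<xi>. \<alpha> * (norm \<xi>)\<^sup>2 \<le> (A x *v \<xi>) \<bullet> \<xi>) \<and>
     (\<exists>C. \<forall>v\<in>H10 \<Omega>. \<forall>w\<in>H10 \<Omega>. \<bar>bilinear_form \<Omega> A b c v w\<bar> \<le> C * H1_norm \<Omega> v * H1_norm \<Omega> w) \<and>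
     (\<exists>C>0. \<forall>v\<in>H10 \<Omega>. C * (H1_norm \<Omega> v)\<^sup>2 \<le> bilinear_form \<Omega> A b c v v)"

text \<open>
  The space \<open>V\<close> is \<open>H10 \<Omega>\<close> for the exact solutions and a finite element space for the discrete ones.
\<close>

definition primal_solution ::
    "(real^'d) set \<Rightarrow> (real^'d \<Rightarrow> real^'d^'d) \<Rightarrow> (real^'d \<Rightarrow> real^'d) \<Rightarrow> (real^'d \<Rightarrow> real) \<Rightarrow>
     (real^'d \<Rightarrow> real) \<Rightarrow> (real^'d \<Rightarrow> real^'d) \<Rightarrow> (real^'d \<Rightarrow> real) set \<Rightarrow>
     (real^'d \<Rightarrow> real) \<Rightarrow> bool" where
  "primal_solution \<Omega> A b c f g V u \<longleftrightarrow>
     u \<in> V \<and> (\<forall>v\<in>V. bilinear_form \<Omega> A b c u v = load \<Omega> f g v)"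

definition dual_solution ::
    "(real^'d) set \<Rightarrow> (real^'d \<Rightarrow> real^'d^'d) \<Rightarrow> (real^'d \<Rightarrow> real^'d) \<Rightarrow> (real^'d \<Rightarrow> real) \<Rightarrow>
     ((real^'d \<Rightarrow> real) \<Rightarrow> (real^'d \<Rightarrow> real) \<Rightarrow> real) \<Rightarrow> (real^'d \<Rightarrow> real) set \<Rightarrow>
     (real^'d \<Rightarrow> real) \<Rightarrow> (real^'d \<Rightarrow> real) \<Rightarrow> bool" where
  "dual_solution \<Omega> A b c K V w z \<longleftrightarrow>
     z \<in> V \<and> (\<forall>v\<in>V. bilinear_form \<Omega> A b c v z = K v w + K w v)"


section \<open>Triangulations and refinement\<close>

type_synonym 'd mesh = "(real^'d) set set"

definition triangulation_of :: "(real^'d) set \<Rightarrow> 'd mesh \<Rightarrow> bool" where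
  "triangulation_of \<Omega> \<T> \<longleftrightarrow>
     triangulation \<T> \<and> (\<forall>T\<in>\<T>. int CARD('d) simplex T) \<and> \<Union>\<T> = closure \<Omega>"

definition polynomial_of_degree_le :: "nat \<Rightarrow> (real^'d \<Rightarrow> real) \<Rightarrow> bool" where
  "polynomial_of_degree_le p q \<longleftrightarrow>
     (\<exists>a :: ('d \<Rightarrow> nat) \<Rightarrow> real.
        q = (\<lambda>x. \<Sum>\<alpha> | (\<Sum>i\<in>UNIV. \<alpha> i) \<le> p. a \<alpha> * (\<Prod>i\<in>UNIV. x $ i ^ \<alpha> i)))"

definition fe_space :: "(real^'d) set \<Rightarrow> nat \<Rightarrow> 'd mesh \<Rightarrow> (real^'d \<Rightarrow> real) set" where
  "fe_space \<Omega> p \<T> =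
     {v \<in> H10 \<Omega>. \<forall>T\<in>\<T>. \<exists>q. polynomial_of_degree_le p q \<and> (AE x\<in>T in lebesgue. v x = q x)}"

definition finer :: "'d mesh \<Rightarrow> 'd mesh \<Rightarrow> bool" where
  "finer \<S> \<T> \<longleftrightarrow> (\<forall>S\<in>\<S>. \<exists>T\<in>\<T>. S \<subseteq> T)"

lemma fe_space_nested: "finer \<S> \<T> \<Longrightarrow> fe_space \<Omega> p \<T> \<subseteq> fe_space \<Omega> p \<S>"
  by (fastforce simp: fe_space_def finer_def elim!: AE_mp)

inductive_set refinements :: "('d mesh \<Rightarrow> 'd mesh \<Rightarrow> 'd mesh) \<Rightarrow> 'd mesh \<Rightarrow> 'd mesh set"
  for refine :: "'d mesh \<Rightarrow> 'd mesh \<Rightarrow> 'd mesh" and \<T> :: "'d mesh" where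
  refl: "\<T> \<in> refinements refine \<T>"
| step: "\<S> \<in> refinements refine \<T> \<Longrightarrow> \<M> \<subseteq> \<S> \<Longrightarrow> refine \<S> \<M> \<in> refinements refine \<T>"

definition refinement_strategy ::
    "(real^'d) set \<Rightarrow> ('d mesh \<Rightarrow> 'd mesh \<Rightarrow> 'd mesh) \<Rightarrow> 'd mesh \<Rightarrow> bool" where
  "refinement_strategy \<Omega> refine \<T>0 \<longleftrightarrow>
     triangulation_of \<Omega> \<T>0 \<and>
     (\<forall>\<T>\<in>refinements refine \<T>0. \<forall>\<M>\<subseteq>\<T>.
        triangulation_of \<Omega> (refine \<T> \<M>) \<and> finer (refine \<T> \<M>) \<T> \<and> \<M> \<subseteq> \<T> - refine \<T> \<M> \<and>
        (\<forall>\<S>\<in>refinements refine \<T>. \<M> \<subseteq> \<T> - \<S> \<longrightarrow> finer \<S> (refine \<T> \<M>)))"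

definition mesh_assumptions :: "('d mesh \<Rightarrow> 'd mesh \<Rightarrow> 'd mesh) \<Rightarrow> 'd mesh \<Rightarrow> bool" where
  "mesh_assumptions refine \<T>0 \<longleftrightarrow>
     (\<forall>\<T>\<in>refinements refine \<T>0. \<forall>\<S>\<in>refinements refine \<T>. card (\<T> - \<S>) + card \<T> \<le> card \<S>) \<and>
     (\<exists>Cmesh>0. \<forall>\<T> \<M>. \<T> 0 = \<T>0 \<and> (\<forall>j. \<M> j \<subseteq> \<T> j \<and> \<T> (Suc j) = refine (\<T> j) (\<M> j)) \<longrightarrow>
        (\<forall>l. real (card (\<T> l)) - real (card \<T>0) \<le> Cmesh * (\<Sum>j<l. real (card (\<M> j))))) \<and>
     (\<forall>\<T>\<in>refinements refine \<T>0. \<forall>\<S>\<in>refinements refine \<T>0.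
        \<exists>\<R>\<in>refinements refine \<T> \<inter> refinements refine \<S>.
          card \<R> + card \<T>0 \<le> card \<T> + card \<S>)"


section \<open>Error estimators\<close>

text \<open>The indicator \<open>\<eta> \<T> T v\<close> depends on the mesh, on the element and on the discrete function.\<close>

type_synonym 'd indicator = "'d mesh \<Rightarrow> (real^'d) set \<Rightarrow> (real^'d \<Rightarrow> real) \<Rightarrow> real"

definition estimator_on :: "'d indicator \<Rightarrow> 'd mesh \<Rightarrow> 'd mesh \<Rightarrow> (real^'d \<Rightarrow> real) \<Rightarrow> real" where
  "estimator_on \<eta> \<T> \<U> v = sqrt (\<Sum>T\<in>\<U>. (\<eta> \<T> T v)\<^sup>2)"

abbreviation estimator :: "'d indicator \<Rightarrow> 'd mesh \<Rightarrow> (real^'d \<Rightarrow> real) \<Rightarrow> real" where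
  "estimator \<eta> \<T> v \<equiv> estimator_on \<eta> \<T> \<T> v"

definition nonneg_indicator ::
    "(real^'d) set \<Rightarrow> nat \<Rightarrow> ('d mesh \<Rightarrow> 'd mesh \<Rightarrow> 'd mesh) \<Rightarrow> 'd mesh \<Rightarrow> 'd indicator \<Rightarrow> bool" where
  "nonneg_indicator \<Omega> p refine \<T>0 \<eta> \<longleftrightarrow>
     (\<forall>\<T>\<in>refinements refine \<T>0. \<forall>T\<in>\<T>. \<forall>v\<in>fe_space \<Omega> p \<T>. 0 \<le> \<eta> \<T> T v)"

definition stability ::
    "(real^'d) set \<Rightarrow> (real^'d \<Rightarrow> real^'d^'d) \<Rightarrow> nat \<Rightarrow> ('d mesh \<Rightarrow> 'd mesh \<Rightarrow> 'd mesh) \<Rightarrow> 'd mesh \<Rightarrow>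
     'd indicator \<Rightarrow> 'd indicator \<Rightarrow> real \<Rightarrow> bool" where
  "stability \<Omega> A p refine \<T>0 \<eta> \<zeta> Cstab \<longleftrightarrow>
     (\<forall>\<T>\<in>refinements refine \<T>0. \<forall>\<S>\<in>refinements refine \<T>.
      \<forall>v\<in>fe_space \<Omega> p \<S>. \<forall>w\<in>fe_space \<Omega> p \<T>. \<forall>\<U>\<subseteq>\<S> \<inter> \<T>.
        \<bar>estimator_on \<eta> \<S> \<U> v - estimator_on \<eta> \<T> \<U> w\<bar> +
        \<bar>estimator_on \<zeta> \<S> \<U> v - estimator_on \<zeta> \<T> \<U> w\<bar>
          \<le> Cstab * energy_norm \<Omega> A (\<lambda>x. v x - w x))"

definition reduction ::
    "(real^'d) set \<Rightarrow> nat \<Rightarrow> ('d mesh \<Rightarrow> 'd mesh \<Rightarrow> 'd mesh) \<Rightarrow> 'd mesh \<Rightarrow>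
     'd indicator \<Rightarrow> 'd indicator \<Rightarrow> real \<Rightarrow> bool" where
  "reduction \<Omega> p refine \<T>0 \<eta> \<zeta> qred \<longleftrightarrow>
     (\<forall>\<T>\<in>refinements refine \<T>0. \<forall>\<S>\<in>refinements refine \<T>. \<forall>v\<in>fe_space \<Omega> p \<T>.
        estimator_on \<eta> \<S> (\<S> - \<T>) v \<le> qred * estimator_on \<eta> \<T> (\<T> - \<S>) v \<and>
        estimator_on \<zeta> \<S> (\<S> - \<T>) v \<le> qred * estimator_on \<zeta> \<T> (\<T> - \<S>) v)"

definition reliability ::
    "(real^'d) set \<Rightarrow> (real^'d \<Rightarrow> real^'d^'d) \<Rightarrow> ('d mesh \<Rightarrow> 'd mesh \<Rightarrow> 'd mesh) \<Rightarrow> 'd mesh \<Rightarrow>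
     'd indicator \<Rightarrow> 'd indicator \<Rightarrow> (real^'d \<Rightarrow> real) \<Rightarrow> ('d mesh \<Rightarrow> real^'d \<Rightarrow> real) \<Rightarrow>
     ((real^'d \<Rightarrow> real) \<Rightarrow> real^'d \<Rightarrow> real) \<Rightarrow>
     ('d mesh \<Rightarrow> (real^'d \<Rightarrow> real) \<Rightarrow> real^'d \<Rightarrow> real) \<Rightarrow> real \<Rightarrow> bool" where
  "reliability \<Omega> A refine \<T>0 \<eta> \<zeta> u uh z zh Crel \<longleftrightarrow>
     (\<forall>\<T>\<in>refinements refine \<T>0. \<forall>w\<in>H10 \<Omega>.
        energy_norm \<Omega> A (\<lambda>x. u x - uh \<T> x) \<le> Crel * estimator \<eta> \<T> (uh \<T>) \<and>
        energy_norm \<Omega> A (\<lambda>x. z w x - zh \<T> w x) \<le> Crel * estimator \<zeta> \<T> (zh \<T> w))"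

definition discrete_reliability ::
    "(real^'d) set \<Rightarrow> (real^'d \<Rightarrow> real^'d^'d) \<Rightarrow> ('d mesh \<Rightarrow> 'd mesh \<Rightarrow> 'd mesh) \<Rightarrow> 'd mesh \<Rightarrow>
     'd indicator \<Rightarrow> 'd indicator \<Rightarrow> ('d mesh \<Rightarrow> real^'d \<Rightarrow> real) \<Rightarrow>
     ('d mesh \<Rightarrow> (real^'d \<Rightarrow> real) \<Rightarrow> real^'d \<Rightarrow> real) \<Rightarrow> real \<Rightarrow> bool" where
  "discrete_reliability \<Omega> A refine \<T>0 \<eta> \<zeta> uh zh Cdrel \<longleftrightarrow>
     (\<forall>\<T>\<in>refinements refine \<T>0. \<forall>\<S>\<in>refinements refine \<T>. \<forall>w\<in>H10 \<Omega>.
        energy_norm \<Omega> A (\<lambda>x. uh \<S> x - uh \<T> x) \<le> Cdrel * estimator_on \<eta> \<T> (\<T> - \<S>) (uh \<T>) \<and>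
        energy_norm \<Omega> A (\<lambda>x. zh \<S> w x - zh \<T> w x)
          \<le> Cdrel * estimator_on \<zeta> \<T> (\<T> - \<S>) (zh \<T> w))"


section \<open>The adaptive algorithm\<close>

definition marking_criterion ::
    "'d indicator \<Rightarrow> 'd indicator \<Rightarrow> real \<Rightarrow> 'd mesh \<Rightarrow> (real^'d \<Rightarrow> real) \<Rightarrow> (real^'d \<Rightarrow> real) \<Rightarrow>
     'd mesh \<Rightarrow> bool" where
  "marking_criterion \<eta> \<zeta> \<theta> \<T> v w \<M> \<longleftrightarrow>
     \<theta> * ((estimator \<eta> \<T> v)\<^sup>2 + (estimator \<zeta> \<T> w)\<^sup>2)
       \<le> (estimator_on \<eta> \<T> \<M> v)\<^sup>2 + (estimator_on \<zeta> \<T> \<M> w)\<^sup>2"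

text \<open>
  The case \<open>Cmark = \<infinity>\<close> has to be separated, because \<open>\<infinity> * 0 = 0\<close> in the extended reals.
\<close>

definition algorithm_B ::
    "('d mesh \<Rightarrow> 'd mesh \<Rightarrow> 'd mesh) \<Rightarrow> 'd mesh \<Rightarrow> 'd indicator \<Rightarrow> 'd indicator \<Rightarrow>
     ('d mesh \<Rightarrow> real^'d \<Rightarrow> real) \<Rightarrow> ('d mesh \<Rightarrow> (real^'d \<Rightarrow> real) \<Rightarrow> real^'d \<Rightarrow> real) \<Rightarrow>
     real \<Rightarrow> ereal \<Rightarrow> (nat \<Rightarrow> 'd mesh) \<Rightarrow> (nat \<Rightarrow> 'd mesh) \<Rightarrow> bool" where
  "algorithm_B refine \<T>0 \<eta> \<zeta> uh zh \<theta> Cmark \<T> \<M> \<longleftrightarrow>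
     \<T> 0 = \<T>0 \<and>
     (\<forall>l. \<M> l \<subseteq> \<T> l \<and>
          marking_criterion \<eta> \<zeta> \<theta> (\<T> l) (uh (\<T> l)) (zh (\<T> l) (uh (\<T> l))) (\<M> l) \<and>
          (Cmark \<noteq> \<infinity> \<longrightarrow>
             (\<forall>\<N>\<subseteq>\<T> l. marking_criterion \<eta> \<zeta> \<theta> (\<T> l) (uh (\<T> l)) (zh (\<T> l) (uh (\<T> l))) \<N> \<longrightarrow>
                ereal (real (card (\<M> l))) \<le> Cmark * ereal (real (card \<N>)))) \<and>
          \<T> (Suc l) = refine (\<T> l) (\<M> l))"

end

theory Submission
  imports Defs
begin

text \<open>
  With \<open>e = u - u\<^sub>H\<close>, bilinearity and Galerkin orthogonality give
  \<open>G(u) - G(u\<^sub>H) = b(e, u\<^sub>H) + b(u\<^sub>H, e) + b(e, e) = a(e, z[u\<^sub>H] - z\<^sub>H[u\<^sub>H]) + b(e, e)\<close>, so continuity of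
  \<open>a\<close> and \<open>b\<close>, Friedrichs' inequality and reliability bound the goal error by the estimators.

  Convergence follows from the estimator reduction \<open>s (l + 1) \<le> k s l + e l\<close> with \<open>k < 1\<close> for
  \<open>s l = (\<eta>\<^sup>2 + \<zeta>\<^sup>2)\<^sup>1\<^sup>/\<^sup>2\<close>, where \<open>e l\<close> is a multiple of the energy norms of the increments of \<open>u\<^sub>l\<close> and
  \<open>z\<^sub>l[u\<^sub>l]\<close>. These tend to zero: Galerkin solutions in nested spaces form a Cauchy sequence, and
  \<open>z\<^sub>l[w]\<close> depends on \<open>w\<close> in a Lipschitz manner, uniformly in \<open>l\<close>.

  The weak gradient is a choice among functions that agree almost everywhere, so that linearity of
  \<open>v \<mapsto> wgrad \<Omega> v\<close> (up to null sets) rests on the fundamental lemma of the calculus of variations.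
\<close>

text \<open>The goal functional is quadratic, and the dual problem represents its derivative at the
  discrete solution; what remains is \<open>b(e, e)\<close>. Both parts are products of two errors,
  hence the squares of the estimators.

  The constant has to be found before the operator, the data, the meshes and the estimators are
  given: the operator may influence it only through a bound \<open>CK\<close> of its norm. This
  explains the universally quantified data in \<open>goal_error_estimate\<close>.

  In the reduction the mesh changes first, with the discrete functions kept: common elements retain
  their indicators, refined ones lose a factor, and marked elements are among the refined. Only then
  are the functions exchanged, by the triangle inequality in the plane; this gives
  \<open>k\<^sup>2 = 1 - (1 - q\<^sup>2) * \<theta>\<close> with no Young parameter.

  Nothing forces the meshes to become fine everywhere, so the discrete spaces need not exhaust
  \<open>H10 \<Omega>\<close>. The increments therefore have to vanish without the discrete
  solutions being known to approach \<open>u\<close>, and for the dual ones the right-hand side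
  moves with the level as well.\<close>

section \<open>Smooth bump functions\<close>

text \<open>
  The factors \<open>1 / t ^ m\<close> make this family closed under differentiation up to linear combinations.
\<close>

definition flat_exp :: "nat \<Rightarrow> real \<Rightarrow> real" where
  "flat_exp m t = (if t \<le> 0 then 0 else exp (- (1 / t)) / t ^ m)"

lemma flat_exp_nonneg: "0 \<le> flat_exp m t"
  by (simp add: flat_exp_def)

lemma flat_exp_0_le_1: "flat_exp 0 t \<le> 1"
  by (simp add: flat_exp_def)

text \<open>All terms of the exponential series are nonnegative here, so a single one is at most the
  sum.\<close>

lemma power_div_fact_le_exp:
  fixes x :: real assumes "0 \<le> x" shows "x ^ n / fact n \<le> exp x"
proof -
  have "(\<Sum>k\<in>{n}. x ^ k /\<^sub>R fact k) \<le> (\<Sum>k. x ^ k /\<^sub>R fact k)"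
    using assms by (intro sum_le_suminf summable_exp_generic) auto
  then show ?thesis by (simp add: exp_def divide_inverse mult.commute)
qed

text \<open>The term of index \<open>m + 2\<close> in the series of \<open>exp (1/t)\<close> beats
  the factor \<open>1 / t ^ m\<close> with two powers of \<open>t\<close> to spare: one for the
  division in a difference quotient at 0, the other to make it vanish.\<close>

lemma flat_exp_le_square: "flat_exp m t \<le> fact (m + 2) * t\<^sup>2"
proof (cases "t \<le> 0")
  case False
  then have t: "t > 0" by simp
  have "(1/t) ^ (m+2) / fact (m+2) \<le> exp (1/t)"
    using t by (intro power_div_fact_le_exp) simp
  then have "1 \<le> exp (1/t) * (fact (m+2) * t ^ (m+2))"
    using t by (simp add: divide_le_eq power_one_over del: fact_Suc power_Suc)
      (simp add: field_simps del: fact_Suc power_Suc)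
  then have "exp (-(1/t)) \<le> fact (m+2) * t ^ (m+2)"
    by (simp add: exp_minus field_simps)
  then show ?thesis using t by (simp add: flat_exp_def field_simps power_add power2_eq_square)
qed (simp add: flat_exp_def)

lemma flat_exp_deriv:
  "(flat_exp m has_real_derivative (flat_exp (m + 2) t - real m * flat_exp (m + 1) t)) (at t)"
proof -
  consider "t < 0" | "t = 0" | "t > 0" by linarith
  then show ?thesis
  proof cases
    case 1
    have "((\<lambda>_. 0) has_real_derivative 0) (at t)" by simp
    moreover have "flat_exp (m + 2) t - real m * flat_exp (m + 1) t = 0"
      using 1 by (simp add: flat_exp_def)
    ultimately have "((\<lambda>_. 0) has_real_derivative
        flat_exp (m + 2) t - real m * flat_exp (m + 1) t) (at t)" by simp
    then show ?thesis
      by (rule has_field_derivative_transform_within_open[where S = "{..<0}"])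
        (use 1 in \<open>auto simp: flat_exp_def\<close>)
  next
    case 2
    \<comment> \<open>At the junction the quotient consists of the value at \<open>h\<close> alone,
      and the square bound leaves a factor of size \<open>\<bar>h\<bar>\<close>.\<close>
    have "((\<lambda>h. flat_exp m h / h) \<longlongrightarrow> 0) (at 0)"
    proof (rule Lim_null_comparison)
      show "eventually (\<lambda>h. norm (flat_exp m h / h) \<le> fact (m+2) * \<bar>h\<bar>) (at 0)"
      proof (intro always_eventually allI)
        fix h :: real
        show "norm (flat_exp m h / h) \<le> fact (m+2) * \<bar>h\<bar>"
          using flat_exp_le_square[of m h] flat_exp_nonneg[of m h]
          by (cases "h = 0") (auto simp: abs_mult[symmetric] divide_le_eq power2_eq_square mult.assoc simp del: fact_Suc)
      qed
      show "((\<lambda>h::real. fact (m+2) * \<bar>h\<bar>) \<longlongrightarrow> 0) (at 0)"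
        by (auto intro!: tendsto_eq_intros)
    qed
    then show ?thesis using 2 by (simp add: DERIV_def flat_exp_def)
  next
    case 3
    \<comment> \<open>For \<open>m = 0\<close> the truncated exponent \<open>m - 1\<close> does no
      harm, since it is multiplied by \<open>real m\<close>.\<close>
    have "((\<lambda>s. exp (- (1 / s)) / s ^ m) has_real_derivative
       (exp (- (1 / t)) * (1 / t\<^sup>2) * t ^ m - exp (- (1 / t)) * (real m * t ^ (m - 1))) / (t ^ m * t ^ m))
       (at t)"
      using 3 by (auto intro!: derivative_eq_intros simp: power2_eq_square)
    moreover have "(exp (- (1 / t)) * (1 / t\<^sup>2) * t ^ m - exp (- (1 / t)) * (real m * t ^ (m - 1))) / (t ^ m * t ^ m)
      = flat_exp (m + 2) t - real m * flat_exp (m + 1) t"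
      using 3 by (cases m) (simp_all add: flat_exp_def field_simps power2_eq_square)
    ultimately have "((\<lambda>s. exp (- (1 / s)) / s ^ m) has_real_derivative
       (flat_exp (m + 2) t - real m * flat_exp (m + 1) t)) (at t)" by simp
    then show ?thesis
      by (rule has_field_derivative_transform_within_open[where S = "{0<..}"])
        (use 3 in \<open>auto simp: flat_exp_def\<close>)
  qed
qed

text \<open>For positive \<open>t\<close> the argument \<open>real n * t\<close> grows without
  bound, and the exponential tends to 1; otherwise every term is 0. Products of such sequences
  approximate indicators of boxes.\<close>

lemma flat_exp_tendsto_indicator:
  "(\<lambda>n. flat_exp 0 (real n * t)) \<longlonglongrightarrow> indicator {0<..} t"
proof (cases "t > 0")
  case True
  have "(\<lambda>n. exp (- (1 / t * (1 / real n)))) \<longlonglongrightarrow> exp (- (1 / t * 0))"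
    by (intro tendsto_intros lim_1_over_n)
  then have "(\<lambda>n. exp (- (1 / (real n * t)))) \<longlonglongrightarrow> 1"
    by (simp add: field_simps)
  moreover have "eventually (\<lambda>n. exp (- (1 / (real n * t))) = flat_exp 0 (real n * t)) sequentially"
    using eventually_gt_at_top[of 0] by eventually_elim (use True in \<open>auto simp: flat_exp_def mult_le_0_iff\<close>)
  ultimately show ?thesis using True by (auto intro: Lim_transform_eventually)
qed (auto simp: flat_exp_def mult_le_0_iff not_less)

section \<open>Differentiability classes and their closure properties\<close>

lemma grad_component: "(\<phi> has_derivative D) (at x) \<Longrightarrow> grad \<phi> x $ i = D (axis i 1)"
  by (simp add: grad_def frechet_derivative_at[symmetric])

lemma Ck_Suc_has_derivative: 
  "Ck (Suc k) \<phi> \<Longrightarrow> (\<phi> has_derivative frechet_derivative \<phi> (at x)) (at x)"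
  by (simp add: frechet_derivative_works[symmetric])

text \<open>Derivatives may be supplied as explicit linear maps, which spares computing with
  \<open>frechet_derivative\<close>.\<close>

lemma Ck_SucI:
  assumes "\<And>x. (\<phi> has_derivative D x) (at x)" and "\<And>i. Ck k (\<lambda>x. D x (axis i 1))"
  shows "Ck (Suc k) \<phi>"
  using assms grad_component[OF assms(1)] by (auto simp: differentiable_def)

text \<open>Needed for products: each term of the product rule pairs a partial derivative of one
  factor with the other factor itself, which must then count as one class lower.\<close>

lemma Ck_SucD: "Ck (Suc k) \<phi> \<Longrightarrow> Ck k \<phi>"
proof (induction k arbitrary: \<phi>)
  case 0
  then show ?case by (auto simp: continuous_on_eq_continuous_at differentiable_imp_continuous_within)
next
  case (Suc k)
  then show ?case using Ck.simps(2) by blast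
qed

lemma Ck_const: "Ck k (\<lambda>x. c)"
proof (induction k arbitrary: c)
  case (Suc k)
  show ?case by (rule Ck_SucI[where D="\<lambda>x h. 0"]) (auto simp: Suc)
qed simp

lemma Ck_component: "Ck k (\<lambda>x. x $ i)"
proof (cases k)
  case (Suc k)
  have "((\<lambda>x. x $ i) has_derivative (\<lambda>h. h $ i)) (at x)" for x :: "real^'a"
    by (rule bounded_linear_imp_has_derivative) (rule bounded_linear_vec_nth)
  then show ?thesis unfolding Suc by (rule Ck_SucI) (simp add: Ck_const)
qed (auto intro!: continuous_intros)

lemma Ck_add: "Ck k \<phi> \<Longrightarrow> Ck k \<psi> \<Longrightarrow> Ck k (\<lambda>x. \<phi> x + \<psi> x)"
proof (induction k arbitrary: \<phi> \<psi>)
  case (Suc k)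
  show ?case
  proof (rule Ck_SucI)
    show "((\<lambda>x. \<phi> x + \<psi> x) has_derivative
        (\<lambda>h. frechet_derivative \<phi> (at x) h + frechet_derivative \<psi> (at x) h)) (at x)" for x
      by (intro has_derivative_add Ck_Suc_has_derivative) (use Suc.prems in auto)
    show "Ck k (\<lambda>x. frechet_derivative \<phi> (at x) (axis i 1) + frechet_derivative \<psi> (at x) (axis i 1))" for i
      using Suc.prems by (intro Suc.IH) (auto simp: grad_def)
  qed
qed (auto intro!: continuous_intros)

lemma Ck_mult: "Ck k \<phi> \<Longrightarrow> Ck k \<psi> \<Longrightarrow> Ck k (\<lambda>x. \<phi> x * \<psi> x)"
proof (induction k arbitrary: \<phi> \<psi>)
  case (Suc k)
  show ?case
  proof (rule Ck_SucI)
    show "((\<lambda>x. \<phi> x * \<psi> x) has_derivative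
        (\<lambda>h. \<phi> x * frechet_derivative \<psi> (at x) h + frechet_derivative \<phi> (at x) h * \<psi> x)) (at x)" for x
      by (intro has_derivative_mult Ck_Suc_has_derivative) (use Suc.prems in auto)
    show "Ck k (\<lambda>x. \<phi> x * frechet_derivative \<psi> (at x) (axis i 1) + frechet_derivative \<phi> (at x) (axis i 1) * \<psi> x)" for i
      using Suc.prems Ck_SucD[OF Suc.prems(1)] Ck_SucD[OF Suc.prems(2)]
      by (intro Ck_add Suc.IH) (auto simp: grad_def)
  qed
qed (auto intro!: continuous_intros)

lemma Ck_prod: "(\<And>i. i \<in> I \<Longrightarrow> Ck k (\<phi> i)) \<Longrightarrow> Ck k (\<lambda>x. \<Prod>i\<in>I. \<phi> i x)"
  by (induction I rule: infinite_finite_induct) (auto intro: Ck_const Ck_mult)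

text \<open>The claim covers all \<open>m\<close> at once because differentiation raises the index
  by one and by two. The affine argument serves both faces of a box, with slope
  \<open>real n\<close> at the lower and \<open>- real n\<close> at the upper one.\<close>

lemma Ck_flat_exp: "Ck k (\<lambda>x. flat_exp m (s * x $ i + t))"
proof (induction k arbitrary: m)
  case 0
  have "continuous_on UNIV (flat_exp m)"
    by (intro DERIV_continuous_on) (rule flat_exp_deriv)
  moreover have "continuous_on UNIV (\<lambda>x::real^'a. s * x $ i + t)"
    by (intro continuous_on_add continuous_on_mult_left continuous_on_component continuous_on_id
        continuous_on_const)
  ultimately show ?case
    unfolding Ck.simps by (rule continuous_on_compose2) simp
next
  case (Suc k)
  show ?case
  proof (rule Ck_SucI)
    let ?d = "\<lambda>r. flat_exp (m + 2) r - real m * flat_exp (m + 1) r"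
    show "((\<lambda>x. flat_exp m (s * x $ i + t)) has_derivative
        (\<lambda>h. (s * h $ i) * ?d (s * x $ i + t))) (at x)" for x :: "real^'a"
    proof -
      have "((\<lambda>x. s * x $ i + t) has_derivative (\<lambda>h. s * h $ i)) (at x)"
        using has_derivative_add[OF bounded_linear_imp_has_derivative[OF
              bounded_linear_const_mult[OF bounded_linear_vec_nth]] has_derivative_const] by simp
      from DERIV_compose_FDERIV[OF flat_exp_deriv this] show ?thesis .
    qed
    show "Ck k (\<lambda>x. (s * axis j 1 $ i) * ?d (s * x $ i + t))" for j
    proof -
      have "Ck k (\<lambda>x. (s * axis j 1 $ i) * (flat_exp (m + 2) (s * x $ i + t) + 
           (- real m) * flat_exp (m + 1) (s * x $ i + t)))"
        by (intro Ck_mult Ck_add Ck_const Suc)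
      then show ?thesis by simp
    qed
  qed
qed

text \<open>A smooth substitute for the indicator of the open box. Larger \<open>n\<close> make its
  flanks steeper, so dominated convergence can take the place of convolution with
  mollifiers.\<close>

definition box_bump :: "real^'d \<Rightarrow> real^'d \<Rightarrow> nat \<Rightarrow> real^'d \<Rightarrow> real" where
  "box_bump a b n x =
     (\<Prod>i\<in>UNIV. flat_exp 0 (real n * (x $ i - a $ i)) * flat_exp 0 (real n * (b $ i - x $ i)))"

lemma Ck_box_bump: "Ck k (box_bump a b n)"
proof -
  have "Ck k (\<lambda>x. \<Prod>i\<in>UNIV. flat_exp 0 (real n * x $ i + (- real n * a $ i)) *
                         flat_exp 0 ((- real n) * x $ i + real n * b $ i))"
    by (intro Ck_prod Ck_mult Ck_flat_exp)
  then show ?thesis by (simp add: box_bump_def[abs_def] algebra_simps)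
qed

lemma box_bump_bounds: "0 \<le> box_bump a b n x" "box_bump a b n x \<le> 1"
  unfolding box_bump_def
  by (auto intro!: prod_nonneg prod_le_1 mult_le_one mult_nonneg_nonneg flat_exp_nonneg flat_exp_0_le_1)

lemma box_bump_eq_0: "x \<notin> box a b \<Longrightarrow> box_bump a b n x = 0"
  by (force simp: box_bump_def mem_box_cart flat_exp_def mult_le_0_iff not_less)

lemma box_bump_tendsto: "(\<lambda>n. box_bump a b n x) \<longlonglongrightarrow> indicator (box a b) x"
proof -
  have "(\<lambda>n. box_bump a b n x) \<longlonglongrightarrow>
     (\<Prod>i\<in>UNIV. indicator {0<..} (x $ i - a $ i) * indicator {0<..} (b $ i - x $ i))"
    unfolding box_bump_def by (intro tendsto_prod tendsto_mult flat_exp_tendsto_indicator)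
  also have "(\<Prod>i\<in>UNIV. indicator {0<..} (x $ i - a $ i) * indicator {0<..} (b $ i - x $ i)) =
      (indicator (box a b) x :: real)"
    by (auto simp: indicator_def mem_box_cart split: if_splits)
  finally show ?thesis .
qed

text \<open>The closed box has to lie in the domain because the closure of the support may reach the
  faces.\<close>

lemma box_bump_test_function: 
  assumes "cbox a b \<subseteq> \<Omega>" shows "box_bump a b n \<in> test_functions \<Omega>"
proof -
  have "{x. box_bump a b n x \<noteq> 0} \<subseteq> cbox a b"
    using box_bump_eq_0 box_subset_cbox by blast
  then have *: "closure {x. box_bump a b n x \<noteq> 0} \<subseteq> cbox a b"
    by (rule closure_minimal) (rule closed_cbox)
  then have "bounded (closure {x. box_bump a b n x \<noteq> 0})"
    using bounded_cbox bounded_subset by blast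
  with * assms show ?thesis
    by (auto simp: test_functions_def Ck_box_bump compact_eq_bounded_closed)
qed

section \<open>The fundamental lemma of the calculus of variations\<close>

text \<open>Boxes are closed under intersection and generate the Borel sets, while the sets over
  which \<open>G\<close> integrates to zero form a Dynkin system; \<open>tot\<close> is what admits
  complements. Then \<open>G\<close> and 0 are densities of the same signed measure.\<close>

lemma AE_0_if_box_integrals_0:
  fixes G :: "'a::euclidean_space \<Rightarrow> real"
  assumes G: "integrable lebesgue G" and tot: "integral\<^sup>L lebesgue G = 0"
    and box: "\<And>a b. (LINT x:box a b|lebesgue. G x) = 0"
  shows "AE x in lebesgue. G x = 0"
proof (rule density_unique_real[OF G])
  show "integrable lebesgue (\<lambda>x::'a. 0::real)" by simp
  have setint: "set_integrable lebesgue S G" if "S \<in> sets lebesgue" for S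
    using integrable_mult_indicator[OF that G] by (simp add: set_integrable_def)
  have borel: "(LINT x:S|lebesgue. G x) = 0" if "S \<in> sets borel" for S
  proof -
    have "Int_stable (range (\<lambda>(a, b). box a b :: 'a set))"
      by (auto simp: Int_stable_def box_Int_box)
    moreover have "(range (\<lambda>(a, b). box a b :: 'a set)) \<subseteq> Pow UNIV"
      by auto
    moreover have "S \<in> sigma_sets UNIV (range (\<lambda>(a, b). box a b))"
       using that unfolding borel_eq_box by simp
    ultimately show ?thesis
    proof (induction rule: sigma_sets_induct_disjoint)
      case (basic A) then show ?case using box by auto
    next
      case empty show ?case by (simp add: set_lebesgue_integral_def)
    next
      case (compl A)
      have A: "A \<in> sets borel" using compl.hyps unfolding borel_eq_box by simp
      then have A': "A \<in> sets lebesgue" by simp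
      have "(LINT x:A \<union> (UNIV - A)|lebesgue. G x) = 
         (LINT x:A|lebesgue. G x) + (LINT x:(UNIV - A)|lebesgue. G x)"
        using A' by (intro set_integral_Un setint) auto
      moreover have "A \<union> (UNIV - A) = UNIV" by auto
      ultimately show ?case using compl.IH tot by (simp add: set_lebesgue_integral_def)
    next
      case (union f)
      have A: "range f \<subseteq> sets borel" using union.hyps(2) unfolding borel_eq_box by simp
      then have A': "f i \<in> sets lebesgue" for i by (simp add: range_subsetD)
      have "(LINT x:(\<Union>i. f i)|lebesgue. G x) = (\<Sum>i. (LINT x:f i|lebesgue. G x))"
        using A' union.hyps(1) 
        by (intro lebesgue_integral_countable_add setint) (auto simp: disjoint_family_on_def)
      then show ?case using union.IH by simp
    qed
  qed
  fix S :: "'a set" assume "S \<in> sets lebesgue"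
  \<comment> \<open>A Lebesgue measurable set is a Borel set up to a null set, which no integral
    sees.\<close>
  then obtain B N N' where S: "S = B \<union> N" "N \<subseteq> N'" "N' \<in> null_sets lborel" "B \<in> sets lborel"
    by (rule sets_completionE)
  have N': "N' \<in> null_sets lebesgue" using S(3) by (simp add: null_sets_completionI)
  have "(LINT x:S|lebesgue. G x) = (LINT x:B|lebesgue. G x)"
    unfolding set_lebesgue_integral_def
  proof (rule integral_cong_AE)
    show "(\<lambda>x. indicat_real S x *\<^sub>R G x) \<in> borel_measurable lebesgue"
      using setint[OF \<open>S \<in> sets lebesgue\<close>]
        by (simp add: set_integrable_def borel_measurable_integrable)
    show "(\<lambda>x. indicat_real B x *\<^sub>R G x) \<in> borel_measurable lebesgue"
      using setint[of B] S(4) by (simp add: set_integrable_def borel_measurable_integrable)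
    show "AE x in lebesgue. indicat_real S x *\<^sub>R G x = indicat_real B x *\<^sub>R G x"
      using AE_not_in[OF N'] by eventually_elim (use S in \<open>auto simp: indicator_def\<close>)
  qed
  then show "(LINT x:S|lebesgue. G x) = (LINT x:S|lebesgue. 0)"
    using borel[of B] S(4) by simp
qed

lemma Ck_continuous_on: "Ck k \<phi> \<Longrightarrow> continuous_on S \<phi>"
proof (induction k)
  case 0 then show ?case using continuous_on_subset by auto
next
  case (Suc k) then show ?case using Ck_SucD by blast
qed

lemma Ck_measurable: "Ck k \<phi> \<Longrightarrow> \<phi> \<in> borel_measurable borel"
  using Ck_continuous_on[of k \<phi> UNIV] by (rule borel_measurable_continuous_onI)

text \<open>The bumps lie between 0 and 1 and tend pointwise to the indicator of the open box, so
  dominated convergence with majorant \<open>\<bar>g x\<bar>\<close> carries the vanishing integrals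
  over.\<close>

lemma box_integral_0_if_test_integrals_0:
  fixes g :: "real^'d \<Rightarrow> real"
  assumes g: "integrable lebesgue g" and sub: "cbox a b \<subseteq> \<Omega>"
    and test: "\<And>\<phi>. \<phi> \<in> test_functions \<Omega> \<Longrightarrow> (LINT x|lebesgue. \<phi> x * g x) = 0"
  shows "(LINT x:box a b|lebesgue. g x) = 0"
proof -
  have [measurable]: "g \<in> borel_measurable lebesgue" using g by auto
  have [measurable]: "box_bump a b n \<in> borel_measurable lebesgue" for n
    by (rule measurable_completion) (simp add: Ck_measurable[OF Ck_box_bump])
  have "(\<lambda>n. LINT x|lebesgue. box_bump a b n x * g x) \<longlonglongrightarrow> (LINT x|lebesgue. indicator (box a b) x * g x)"
  proof (rule integral_dominated_convergence[where w = "\<lambda>x. \<bar>g x\<bar>"])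
    show "AE x in lebesgue. (\<lambda>n. box_bump a b n x * g x) \<longlonglongrightarrow> indicator (box a b) x * g x"
      by (intro AE_I2 tendsto_mult box_bump_tendsto tendsto_const)
    show "AE x in lebesgue. norm (box_bump a b n x * g x) \<le> \<bar>g x\<bar>" for n
      using box_bump_bounds[of a b n] by (auto simp: abs_mult intro!: AE_I2 mult_left_le_one_le)
    show "(\<lambda>x. indicator (box a b) x * g x) \<in> borel_measurable lebesgue"
      by (intro borel_measurable_times borel_measurable_indicator) auto
  qed (use g in auto)
  then show ?thesis
    using test[OF box_bump_test_function[OF sub]]
      by (simp add: set_lebesgue_integral_def LIMSEQ_const_iff)
qed

text \<open>A box that leaves the domain gives no test function. The argument therefore runs on
  closed boxes inside \<open>\<Omega>\<close>, countably many of which cover it.\<close>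

lemma fundamental_lemma_of_calculus_of_variations:
  fixes g :: "real^'d \<Rightarrow> real"
  assumes "open \<Omega>" and g: "integrable (lebesgue_on \<Omega>) g"
    and test: "\<And>\<phi>. \<phi> \<in> test_functions \<Omega> \<Longrightarrow> (LINT x|lebesgue_on \<Omega>. \<phi> x * g x) = 0"
  shows "AE x in lebesgue_on \<Omega>. g x = 0"
proof -
  define G where "G = (\<lambda>x. indicator \<Omega> x * g x)"
  have \<Omega>[measurable]: "\<Omega> \<in> sets lebesgue" using assms(1) by simp
  have G: "integrable lebesgue G"
    using g unfolding G_def by (subst (asm) integrable_restrict_space) auto
  have testG: "(LINT x|lebesgue. \<phi> x * G x) = 0" if "\<phi> \<in> test_functions \<Omega>" for \<phi>
    using test[OF that] unfolding G_def by (subst (asm) integral_restrict_space)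
      (auto simp: ac_simps)
  have *: "AE x in lebesgue. x \<in> cbox a b \<longrightarrow> G x = 0" if sub: "cbox a b \<subseteq> \<Omega>" for a b
  proof -
    \<comment> \<open>After the cut-off an arbitrary box matters only through its intersection with
      \<open>box a b\<close>, which is again a box and, if nonempty, has its closure inside the
      domain.\<close>
    define H where "H = (\<lambda>x. indicator (box a b) x * G x)"
    have H: "integrable lebesgue H"
      unfolding H_def using integrable_mult_indicator[OF _ G, of "box a b"] by simp
    have boxH: "(LINT x:box c d|lebesgue. H x) = 0" for c d
    proof -
      obtain l r where lr: "box c d \<inter> box a b = box l r" using box_Int_box by blast
      have "(LINT x:box l r|lebesgue. G x) = 0"
      proof (cases "box l r = {}")
        case False
        then have "cbox l r = closure (box l r)" by simp
        also have "\<dots> \<subseteq> cbox a b" by (rule closure_minimal) (use lr box_subset_cbox in auto)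
        finally show ?thesis
          using box_integral_0_if_test_integrals_0[OF G _ testG] sub by blast
      qed (simp add: set_lebesgue_integral_def)
      then show ?thesis unfolding set_lebesgue_integral_def H_def lr[symmetric]
        by (simp add: indicator_inter_arith ac_simps)
    qed
    have "integral\<^sup>L lebesgue H = 0"
      using box_integral_0_if_test_integrals_0[OF G sub testG]
      by (simp add: H_def set_lebesgue_integral_def)
    from AE_0_if_box_integrals_0[OF H this boxH] have "AE x in lebesgue. H x = 0" .
    \<comment> \<open>The cut-off forgets the faces of the closed box; they form a null set.\<close>
    moreover have "AE x in lebesgue. x \<notin> cbox a b - box a b"
      using negligible_frontier_interval by (intro AE_not_in) (simp add: negligible_iff_null_sets)
    ultimately show ?thesis
      by eventually_elim (auto simp: H_def indicator_def)
  qed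
  obtain \<D> where \<D>: "countable \<D>" "\<D> \<subseteq> Pow \<Omega>" "\<And>X. X \<in> \<D> \<Longrightarrow> \<exists>a b. X = cbox a b" "\<Union>\<D> = \<Omega>"
    using open_countable_Union_open_cbox[OF assms(1)] by metis
  have "AE x in lebesgue. \<forall>X\<in>\<D>. x \<in> X \<longrightarrow> G x = 0"
    unfolding AE_ball_countable[OF \<D>(1)] using * \<D>(2,3) by blast
  then have "AE x in lebesgue. x \<in> \<Omega> \<longrightarrow> g x = 0"
    by eventually_elim (use \<D>(4) in \<open>auto simp: G_def indicator_def split: if_splits\<close>)
  then show ?thesis by (subst AE_restrict_space_iff) auto
qed

section \<open>Integration by parts\<close>

lemma Ck_partial_deriv:
  assumes "Ck (Suc k) f"
  shows "((\<lambda>s. f (x + s *\<^sub>R axis i 1)) has_real_derivative grad f (x + s *\<^sub>R axis i 1) $ i) (at s)"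
proof -
  let ?y = "x + s *\<^sub>R axis i 1"
  have f: "(f has_derivative frechet_derivative f (at ?y)) (at ?y)"
    using assms by (rule Ck_Suc_has_derivative)
  have "((\<lambda>s. x + s *\<^sub>R axis i 1) has_derivative (\<lambda>h. h *\<^sub>R axis i 1)) (at s)"
    by (auto intro!: derivative_eq_intros)
  from has_derivative_compose[OF this f]
  have "((\<lambda>s. f (x + s *\<^sub>R axis i 1)) has_derivative
     (\<lambda>h. frechet_derivative f (at ?y) (h *\<^sub>R axis i 1))) (at s)" .
  moreover have "(\<lambda>h. frechet_derivative f (at ?y) (h *\<^sub>R axis i 1)) = (*) (grad f ?y $ i)"
    using linear_scale[OF has_derivative_linear[OF f]] by (auto simp: grad_def mult.commute)
  ultimately show ?thesis by (simp add: has_field_derivative_def)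
qed

text \<open>Closedness of \<open>S\<close> makes its complement a neighbourhood of \<open>x\<close>
  on which the function is identically zero.\<close>

lemma grad_eq_0_outside:
  assumes "closed S" "\<And>x. x \<notin> S \<Longrightarrow> f x = 0" "x \<notin> S"
  shows "grad f x = 0"
proof -
  have "((\<lambda>_. 0::real) has_derivative (\<lambda>_. 0)) (at x)" by simp
  then have "(f has_derivative (\<lambda>_. 0)) (at x)"
    by (rule has_derivative_transform_within_open[where s = "- S"]) (use assms in auto)
  from grad_component[OF this] show ?thesis by (simp add: vec_eq_iff)
qed

lemma compactly_supported_bounded:
  fixes f :: "'a::euclidean_space \<Rightarrow> real"
  assumes "continuous_on UNIV f" "compact S" "\<And>x. x \<notin> S \<Longrightarrow> f x = 0"
  obtains M where "\<And>x. \<bar>f x\<bar> \<le> M" "0 \<le> M"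
proof -
  have "bounded (f ` S)"
    using assms(2) continuous_on_subset[OF assms(1)]
      by (intro compact_imp_bounded compact_continuous_image) auto
  then obtain M where "\<And>y. y \<in> f ` S \<Longrightarrow> norm y \<le> M" by (auto simp: bounded_iff)
  then have "\<bar>f x\<bar> \<le> max M 0" for x using assms(3)[of x] by (cases "x \<in> S") fastforce+
  then show ?thesis using that by fastforce
qed

lemma compactly_supported_integrable:
  fixes f :: "'a::euclidean_space \<Rightarrow> real"
  assumes "continuous_on UNIV f" "compact S" "\<And>x. x \<notin> S \<Longrightarrow> f x = 0"
  shows "integrable lborel f"
proof -
  have "set_integrable lborel S f"
    using assms(2) continuous_on_subset[OF assms(1)]
      by (intro borel_integrable_compact[unfolded set_integrable_def[symmetric]]) auto
  moreover have "(\<lambda>x. indicator S x *\<^sub>R f x) = f" using assms(3) by (fastforce simp: indicator_def)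
  ultimately show ?thesis by (simp add: set_integrable_def)
qed

lemma integral_lborel_translation:
  fixes f :: "'a::euclidean_space \<Rightarrow> real"
  assumes "f \<in> borel_measurable borel"
  shows "(LINT x|lborel. f (x + c)) = (LINT x|lborel. f x)"
proof -
  have "(LINT x|lborel. f x) = (LINT x|distr lborel borel ((+) c). f x)"
    by (simp add: lborel_distr_plus)
  also have "\<dots> = (LINT x|lborel. f (c + x))" using assms by (intro integral_distr) auto
  finally show ?thesis by (simp add: add.commute)
qed

text \<open>
  The difference quotients of \<open>f\<close> have integral zero by translation invariance, and they converge
  to the partial derivative with a common integrable bound.
\<close>

lemma integral_partial_derivative_0:
  fixes f :: "real^'d \<Rightarrow> real"
  assumes f: "Ck (Suc 0) f" and S: "compact S" and supp: "\<And>x. x \<notin> S \<Longrightarrow> f x = 0"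
  shows "(LINT x|lborel. grad f x $ i) = 0"
proof -
  let ?e = "axis i 1 :: real^'d"
  define t where "t = (\<lambda>n. 1 / real (Suc n))"
  define q where "q = (\<lambda>n x. (f (x + t n *\<^sub>R ?e) - f x) / t n)"
  have cf: "continuous_on UNIV f" using f by (rule Ck_continuous_on)
  have cg: "continuous_on UNIV (\<lambda>x. grad f x $ i)" using f by simp
  have [measurable]: "f \<in> borel_measurable borel" using f by (rule Ck_measurable)
  have [measurable]: "(\<lambda>x. grad f x $ i) \<in> borel_measurable borel"
    using cg by (rule borel_measurable_continuous_onI)
  have g0: "grad f x $ i = 0" if "x \<notin> S" for x
    using grad_eq_0_outside[OF compact_imp_closed[OF S] supp that] by simp
  obtain M where M: "\<And>x. \<bar>grad f x $ i\<bar> \<le> M" "0 \<le> M"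
    using compactly_supported_bounded[OF cg S g0] by blast
  obtain R where R: "S \<subseteq> cball 0 R"
    using bounded_subset_ballD[OF compact_imp_bounded[OF S], of 0] ball_subset_cball by blast
  have t: "0 < t n" "t n \<le> 1" for n by (auto simp: t_def)
  have tlim: "t \<longlonglongrightarrow> 0" using LIMSEQ_inverse_real_of_nat by (simp add: t_def inverse_eq_divide)
  have intf: "integrable lborel f" by (rule compactly_supported_integrable[OF cf S supp])
  have intf': "integrable lborel (\<lambda>x. f (x + c))" for c
  proof (rule compactly_supported_integrable)
    show "continuous_on UNIV (\<lambda>x. f (x + c))"
      by (rule continuous_on_compose2[OF cf])
        (auto intro!: continuous_on_add continuous_on_id continuous_on_const)
    show "compact ((\<lambda>x. x - c) ` S)" using S compact_translation_subtract by blast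
    show "f (x + c) = 0" if "x \<notin> (\<lambda>x. x - c) ` S" for x
      using that by (intro supp) (force simp: image_iff)
  qed
  have q0: "(LINT x|lborel. q n x) = 0" for n
  proof -
    have "(LINT x|lborel. q n x) = ((LINT x|lborel. f (x + t n *\<^sub>R ?e)) - (LINT x|lborel. f x)) / t n"
      unfolding q_def using intf intf' by simp
    then show ?thesis by (simp add: integral_lborel_translation)
  qed
  have "(\<lambda>n. LINT x|lborel. q n x) \<longlonglongrightarrow> (LINT x|lborel. grad f x $ i)"
  \<comment> \<open>The increments \<open>t n\<close> are at most 1, so all difference quotients
    vanish outside one ball whose radius exceeds \<open>R\<close> by 1.\<close>
  proof (rule integral_dominated_convergence[where w = "\<lambda>x. M * indicator (cball 0 (R + 1)) x"])
    show "integrable lborel (\<lambda>x::real^'d. M * indicator (cball 0 (R + 1)) x)"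
      by (intro integrable_mult_right integrable_real_indicator) (use emeasure_bounded_finite[of "cball (0::real^'d) (R + 1)"] in auto)
    show "AE x in lborel. (\<lambda>n. q n x) \<longlonglongrightarrow> grad f x $ i"
    proof (rule AE_I2)
      fix x
      have "((\<lambda>h. (f (x + h *\<^sub>R ?e) - f x) / h) \<longlongrightarrow> grad f x $ i) (at 0)"
        using Ck_partial_deriv[OF f, of x i 0] by (simp add: DERIV_def)
      moreover have "filterlim t (at 0) sequentially"
        using tlim less_imp_neq[OF t(1), symmetric] by (simp add: filterlim_at)
      ultimately show "(\<lambda>n. q n x) \<longlonglongrightarrow> grad f x $ i"
        unfolding q_def by (rule filterlim_compose)
    qed
    show "AE x in lborel. norm (q n x) \<le> M * indicator (cball 0 (R + 1)) x" for n
    proof (rule AE_I2)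
      fix x
      show "norm (q n x) \<le> M * indicator (cball 0 (R + 1)) x"
      proof (cases "x \<in> cball 0 (R + 1)")
        case True
        \<comment> \<open>The mean value theorem turns the quotient into a value of the partial
          derivative, so \<open>M\<close> bounds it uniformly in \<open>n\<close>.\<close>
        have "\<exists>s>0. s < t n \<and> f (x + t n *\<^sub>R ?e) - f (x + 0 *\<^sub>R ?e) = (t n - 0) * grad f (x + s *\<^sub>R ?e) $ i"
          by (rule MVT2[OF t(1)]) (rule Ck_partial_deriv[OF f])
        then obtain s where "f (x + t n *\<^sub>R ?e) - f x = t n * grad f (x + s *\<^sub>R ?e) $ i" by auto
        then have "q n x = grad f (x + s *\<^sub>R ?e) $ i" using t(1)[of n] by (simp add: q_def)
        then show ?thesis using M(1) True by simp
      next
        case False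
        have "norm x \<le> norm (x + t n *\<^sub>R ?e) + norm (t n *\<^sub>R ?e)"
          using norm_triangle_ineq4[of "x + t n *\<^sub>R ?e" "t n *\<^sub>R ?e"] by simp
        then have "x + t n *\<^sub>R ?e \<notin> S" "x \<notin> S"
          using R False t[of n] by (auto dest!: subsetD simp: subset_iff)
        then show ?thesis using supp M(2) by (simp add: q_def)
      qed
    qed
  qed (auto simp: q_def)
  then show ?thesis by (simp add: q0 LIMSEQ_const_iff)
qed

lemma grad_mult:
  assumes "Ck (Suc k) \<phi>" "Ck (Suc k) \<psi>"
  shows "grad (\<lambda>x. \<phi> x * \<psi> x) x = \<phi> x *\<^sub>R grad \<psi> x + \<psi> x *\<^sub>R grad \<phi> x"
proof -
  have "((\<lambda>x. \<phi> x * \<psi> x) has_derivative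
        (\<lambda>h. \<phi> x * frechet_derivative \<psi> (at x) h + frechet_derivative \<phi> (at x) h * \<psi> x)) (at x)"
    by (intro has_derivative_mult Ck_Suc_has_derivative[OF assms(1)] Ck_Suc_has_derivative[OF assms(2)])
  from grad_component[OF this] show ?thesis by (simp add: vec_eq_iff) (simp add: grad_def)
qed

lemma test_function_Ck: "\<phi> \<in> test_functions \<Omega> \<Longrightarrow> Ck k \<phi>"
  by (simp add: test_functions_def)

lemma test_function_support:
  assumes "\<phi> \<in> test_functions \<Omega>"
  obtains S where "compact S" "S \<subseteq> \<Omega>" "\<And>x. x \<notin> S \<Longrightarrow> \<phi> x = 0" "\<And>x. x \<notin> S \<Longrightarrow> grad \<phi> x = 0"
proof
  let ?S = "closure {x. \<phi> x \<noteq> 0}"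
  show "compact ?S" "?S \<subseteq> \<Omega>" using assms by (auto simp: test_functions_def)
  show *: "\<phi> x = 0" if "x \<notin> ?S" for x using that closure_subset[of "{x. \<phi> x \<noteq> 0}"] by blast
  show "grad \<phi> x = 0" if "x \<notin> ?S" for x
    using grad_eq_0_outside[OF closed_closure * that] .
qed

lemma test_functions_comb:
  assumes "\<phi> \<in> test_functions \<Omega>" "\<psi> \<in> test_functions \<Omega>"
  shows "(\<lambda>x. s * \<phi> x + t * \<psi> x) \<in> test_functions \<Omega>"
proof -
  obtain S T where S: "compact S" "S \<subseteq> \<Omega>" "\<And>x. x \<notin> S \<Longrightarrow> \<phi> x = 0"
    and T: "compact T" "T \<subseteq> \<Omega>" "\<And>x. x \<notin> T \<Longrightarrow> \<psi> x = 0"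
    using assms by (meson test_function_support)
  have ST: "compact (S \<union> T)" using S T by auto
  have "{x. s * \<phi> x + t * \<psi> x \<noteq> 0} \<subseteq> S \<union> T" using S(3) T(3) by force
  then have *: "closure {x. s * \<phi> x + t * \<psi> x \<noteq> 0} \<subseteq> S \<union> T"
    by (rule closure_minimal) (rule compact_imp_closed[OF ST])
  moreover have "compact (closure {x. s * \<phi> x + t * \<psi> x \<noteq> 0})"
    using * ST by (meson bounded_subset closed_closure compact_eq_bounded_closed)
  moreover have "Ck k (\<lambda>x. s * \<phi> x + t * \<psi> x)" for k
    using assms by (intro Ck_add Ck_mult Ck_const) (auto simp: test_function_Ck)
  ultimately show ?thesis using S(2) T(2) by (auto simp: test_functions_def)
qed

text \<open>Translation invariance is used for \<open>lborel\<close>, whereas the function spaces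
  live on \<open>lebesgue_on \<Omega>\<close>; integrands that vanish off the domain pass between
  the two.\<close>

lemma integral_lebesgue_on_supported:
  fixes f :: "'a::euclidean_space \<Rightarrow> real"
  assumes "\<Omega> \<in> sets lebesgue" "f \<in> borel_measurable borel" "\<And>x. x \<notin> \<Omega> \<Longrightarrow> f x = 0"
  shows "(LINT x|lebesgue_on \<Omega>. f x) = (LINT x|lborel. f x)"
proof -
  have "(\<lambda>x. indicator \<Omega> x *\<^sub>R f x) = f" using assms(3) by (fastforce simp: indicator_def)
  then have "(LINT x|lebesgue_on \<Omega>. f x) = (LINT x|lebesgue. f x)"
    using assms(1) by (subst integral_restrict_space) auto
  then show ?thesis using assms(2) by (simp add: integral_completion)
qed

section \<open>Galerkin approximation in semi-inner product spaces\<close>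

definition function_subspace :: "('a \<Rightarrow> real) set \<Rightarrow> bool" where
  "function_subspace V \<longleftrightarrow> (\<forall>v\<in>V. \<forall>w\<in>V. \<forall>s t. (\<lambda>x. s * v x + t * w x) \<in> V)"

definition bilinear_on :: "('a \<Rightarrow> real) set \<Rightarrow> (('a \<Rightarrow> real) \<Rightarrow> ('a \<Rightarrow> real) \<Rightarrow> real) \<Rightarrow> bool" where
  "bilinear_on V B \<longleftrightarrow> (\<forall>u\<in>V. \<forall>v\<in>V. \<forall>w\<in>V. \<forall>s t.
     B (\<lambda>x. s * u x + t * v x) w = s * B u w + t * B v w \<and>
     B w (\<lambda>x. s * u x + t * v x) = s * B w u + t * B w v)"

lemma function_subspaceD:
  "function_subspace V \<Longrightarrow> v \<in> V \<Longrightarrow> w \<in> V \<Longrightarrow> (\<lambda>x. s * v x + t * w x) \<in> V"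
  by (simp add: function_subspace_def)

lemma function_subspace_diff:
  "function_subspace V \<Longrightarrow> v \<in> V \<Longrightarrow> w \<in> V \<Longrightarrow> (\<lambda>x. v x - w x) \<in> V"
  using function_subspaceD[of V v w 1 "-1"] by simp

lemma bilinear_on_diff:
  assumes "bilinear_on V B" "u \<in> V" "v \<in> V" "w \<in> V"
  shows "B (\<lambda>x. u x - v x) w = B u w - B v w" "B w (\<lambda>x. u x - v x) = B w u - B w v"
proof -
  have "B (\<lambda>x. 1 * u x + (-1) * v x) w = 1 * B u w + (-1) * B v w"
    "B w (\<lambda>x. 1 * u x + (-1) * v x) = 1 * B w u + (-1) * B w v"
    using assms unfolding bilinear_on_def by blast+
  then show "B (\<lambda>x. u x - v x) w = B u w - B v w" "B w (\<lambda>x. u x - v x) = B w u - B w v"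
    by simp_all
qed

text \<open>Definiteness is left out, since functions that agree almost everywhere are at distance
  zero without being equal. The carrier \<open>V\<close> is explicit because the spaces are sets of
  functions.\<close>

locale semi_inner_product =
  fixes V :: "('a \<Rightarrow> real) set" and B :: "('a \<Rightarrow> real) \<Rightarrow> ('a \<Rightarrow> real) \<Rightarrow> real"
  assumes subspace: "function_subspace V" and bilinear: "bilinear_on V B"
    and sym: "v \<in> V \<Longrightarrow> w \<in> V \<Longrightarrow> B v w = B w v"
    and nonneg: "v \<in> V \<Longrightarrow> 0 \<le> B v v"
begin

definition snorm :: "('a \<Rightarrow> real) \<Rightarrow> real" where "snorm v = sqrt (B v v)"

lemma snorm_nonneg: "v \<in> V \<Longrightarrow> 0 \<le> snorm v"
  by (simp add: snorm_def nonneg)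

lemma snorm_square: "v \<in> V \<Longrightarrow> (snorm v)\<^sup>2 = B v v"
  by (simp add: snorm_def nonneg)

lemmas closed = function_subspaceD[OF subspace] function_subspace_diff[OF subspace]

lemma B_comb:
  assumes "v \<in> V" "w \<in> V"
  shows "B (\<lambda>x. s * v x + t * w x) (\<lambda>x. s * v x + t * w x) =
    s\<^sup>2 * B v v + 2 * s * t * B v w + t\<^sup>2 * B w w"
proof -
  have 1: "B (\<lambda>x. s * v x + t * w x) y = s * B v y + t * B w y" if "y \<in> V" for y
    using bilinear assms that unfolding bilinear_on_def by blast
  have 2: "B y (\<lambda>x. s * v x + t * w x) = s * B y v + t * B y w" if "y \<in> V" for y
    using bilinear assms that unfolding bilinear_on_def by blast
  show ?thesis
    using assms closed(1)[OF assms, of s t] sym[OF assms]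
    by (simp add: 1 2 algebra_simps power2_eq_square)
qed

lemma Cauchy_Schwarz:
  assumes "v \<in> V" "w \<in> V"
  shows "\<bar>B v w\<bar> \<le> snorm v * snorm w"
proof -
  have *: "0 \<le> s\<^sup>2 * B v v + 2 * s * t * B v w + t\<^sup>2 * B w w" for s t
    using B_comb[OF assms] nonneg[OF closed(1)[OF assms]] by metis
  have "(B v w)\<^sup>2 \<le> B v v * B w w"
  proof (cases "B w w = 0")
    case True
    have "B v w = 0"
    proof (rule ccontr)
      assume "B v w \<noteq> 0"
      \<comment> \<open>For \<open>B w w = 0\<close> the expression is affine in \<open>t\<close>,
        and this \<open>t\<close> makes its value -1.\<close>
      then show False using *[of 1 "- (B v v + 1) / (2 * B v w)"] True by (simp add: field_simps)
    qed
    then show ?thesis using True by simp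
  next
    case False
    then have "B w w > 0" using nonneg[OF assms(2)] by simp
    \<comment> \<open>The choice is the minimiser of the quadratic form, scaled by
      \<open>B w w\<close> to avoid a division.\<close>
    moreover have "0 \<le> B w w * (B v v * B w w - (B v w)\<^sup>2)"
      using *[of "B w w" "- B v w"] by (simp add: algebra_simps power2_eq_square)
    ultimately show ?thesis by (simp add: zero_le_mult_iff)
  qed
  then have "sqrt ((B v w)\<^sup>2) \<le> sqrt (B v v * B w w)" by (rule real_sqrt_le_mono)
  then show ?thesis by (simp add: snorm_def real_sqrt_mult)
qed

lemma snorm_comb_le:
  assumes "v \<in> V" "w \<in> V"
  shows "snorm (\<lambda>x. s * v x + t * w x) \<le> \<bar>s\<bar> * snorm v + \<bar>t\<bar> * snorm w"
proof (rule power2_le_imp_le)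
  have "s * t * B v w \<le> \<bar>s * t\<bar> * \<bar>B v w\<bar>" by (metis abs_ge_self abs_mult)
  also have "\<dots> \<le> \<bar>s * t\<bar> * (snorm v * snorm w)" by (intro mult_left_mono Cauchy_Schwarz assms) simp
  finally have "s * t * B v w \<le> \<bar>s\<bar> * \<bar>t\<bar> * (snorm v * snorm w)" by (simp add: abs_mult)
  then show "(snorm (\<lambda>x. s * v x + t * w x))\<^sup>2 \<le> (\<bar>s\<bar> * snorm v + \<bar>t\<bar> * snorm w)\<^sup>2"
    using assms by (simp add: snorm_square closed B_comb power2_sum power_mult_distrib ac_simps)
  show "0 \<le> \<bar>s\<bar> * snorm v + \<bar>t\<bar> * snorm w"
    using assms by (simp add: snorm_nonneg)
qed

lemma snorm_scale: "v \<in> V \<Longrightarrow> snorm (\<lambda>x. s * v x) = \<bar>s\<bar> * snorm v"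
  using B_comb[of v v s 0] by (simp add: snorm_def real_sqrt_mult)

definition sdist :: "('a \<Rightarrow> real) \<Rightarrow> ('a \<Rightarrow> real) \<Rightarrow> real" where
  "sdist v w = snorm (\<lambda>x. v x - w x)"

lemma sdist_nonneg: "v \<in> V \<Longrightarrow> w \<in> V \<Longrightarrow> 0 \<le> sdist v w"
  by (simp add: sdist_def snorm_nonneg closed)

lemma sdist_commute: "v \<in> V \<Longrightarrow> w \<in> V \<Longrightarrow> sdist v w = sdist w v"
  using snorm_scale[OF closed(2), of v w "-1"] by (simp add: sdist_def)

lemma sdist_triangle:
  assumes "u \<in> V" "v \<in> V" "w \<in> V"
  shows "sdist u w \<le> sdist u v + sdist v w"
  using snorm_comb_le[OF closed(2)[OF assms(1,2)] closed(2)[OF assms(2,3)], of 1 1]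
  by (simp add: sdist_def)

text \<open>The parallelogram identity, with the midpoint instead of the sum because convex sets
  contain midpoints.\<close>

lemma sdist_square_midpoint:
  assumes "v \<in> V" "w \<in> V"
  shows "(sdist v w)\<^sup>2 = 2 * (snorm v)\<^sup>2 + 2 * (snorm w)\<^sup>2 - 4 * (snorm (\<lambda>x. 1/2 * v x + 1/2 * w x))\<^sup>2"
  using B_comb[OF assms, of 1 "-1"] B_comb[OF assms, of "1/2" "1/2"]
    snorm_square[OF closed(1)[OF assms, of "1/2" "1/2"]] snorm_square[OF closed(2)[OF assms]]
  by (simp add: sdist_def snorm_square[OF assms(1)] snorm_square[OF assms(2)] power_divide)

end

text \<open>The form \<open>a\<close> is not assumed symmetric, and the dual problem is the instance
  with its arguments exchanged. The spaces are merely nested: their union may stay away from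
  \<open>u\<close>, so that being Cauchy is all one can claim about \<open>uh\<close>.\<close>

locale galerkin = semi_inner_product V B
  for V :: "('a \<Rightarrow> real) set" and B +
  fixes a :: "('a \<Rightarrow> real) \<Rightarrow> ('a \<Rightarrow> real) \<Rightarrow> real" and C c :: real
    and X :: "nat \<Rightarrow> ('a \<Rightarrow> real) set" and u :: "'a \<Rightarrow> real" and uh :: "nat \<Rightarrow> 'a \<Rightarrow> real"
  assumes a_bilinear: "bilinear_on V a"
    and bounded: "v \<in> V \<Longrightarrow> w \<in> V \<Longrightarrow> \<bar>a v w\<bar> \<le> C * snorm v * snorm w"
    and elliptic: "v \<in> V \<Longrightarrow> c * (snorm v)\<^sup>2 \<le> a v v" and c_pos: "0 < c" and C_nonneg: "0 \<le> C"
    and X_sub: "X n \<subseteq> V" and X_subspace: "function_subspace (X n)" and X_Suc: "X n \<subseteq> X (Suc n)"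
    and u: "u \<in> V" and uh: "uh n \<in> X n"
    and orth: "v \<in> X n \<Longrightarrow> a (uh n) v = a u v"
begin

lemma X_mono: "m \<le> n \<Longrightarrow> X m \<subseteq> X n"
  using X_Suc by (rule lift_Suc_mono_le)

lemma in_V: "v \<in> X n \<Longrightarrow> v \<in> V" using X_sub by blast

lemma square_le_imp: 
  assumes "0 \<le> s" "0 \<le> r" "c * s\<^sup>2 \<le> C * s * r" shows "s \<le> C / c * r"
proof (cases "s = 0")
  case False
  then have "c * s \<le> C * r" using assms(1,3) by (simp add: power2_eq_square)
  then show ?thesis using c_pos by (simp add: field_simps)
qed (use assms c_pos C_nonneg in simp)

lemma uh_bounded: "snorm (uh n) \<le> C / c * snorm u"
proof (rule square_le_imp)
  have "c * (snorm (uh n))\<^sup>2 \<le> a (uh n) (uh n)" using elliptic in_V[OF uh] by blast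
  also have "\<dots> = a u (uh n)" using orth uh by blast
  also have "\<dots> \<le> C * snorm u * snorm (uh n)" using bounded[OF u in_V[OF uh]] by (meson abs_le_D1)
  finally show "c * (snorm (uh n))\<^sup>2 \<le> C * snorm (uh n) * snorm u" by (simp add: ac_simps)
qed (use snorm_nonneg u in_V[OF uh] in auto)

text \<open>If \<open>x\<close> and \<open>u\<close> cannot be told apart by testing with
  \<open>X n\<close>, then \<open>uh n\<close> is the Galerkin approximation of \<open>x\<close>
  too, and quasi-optimality holds relative to \<open>x\<close>. In \<open>uh_Cauchy\<close> this
  \<open>x\<close> is an element of some later space.\<close>

lemma Cea:
  assumes x: "x \<in> V" "\<And>v. v \<in> X n \<Longrightarrow> a x v = a u v" and w: "w \<in> X n"
  shows "sdist (uh n) x \<le> C / c * sdist w x"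
proof (rule square_le_imp)
  let ?e = "\<lambda>y. uh n y - x y" and ?d = "\<lambda>y. w y - x y" and ?f = "\<lambda>y. uh n y - w y"
  have V: "uh n \<in> V" "w \<in> V" "?e \<in> V" "?d \<in> V"
    using in_V[OF uh] in_V[OF w] x(1) by (simp_all add: closed(2))
  \<comment> \<open>As \<open>?e\<close> is the sum of \<open>?d\<close> and \<open>?f\<close>,
    Galerkin orthogonality against the trial space removes \<open>?f\<close>.\<close>
  have f: "?f \<in> X n" using function_subspace_diff[OF X_subspace uh w] .
  have "c * (snorm ?e)\<^sup>2 \<le> a ?e ?e" using elliptic V by blast
  also have "\<dots> = a ?e ?d + a ?e ?f"
    using bilinear_on_diff(2)[OF a_bilinear _ _ V(3)] V x(1) by simp
  also have "a ?e ?f = 0"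
    using bilinear_on_diff(1)[OF a_bilinear V(1) x(1) in_V[OF f]] orth[OF f] x(2)[OF f] by simp
  also have "a ?e ?d + 0 \<le> C * snorm ?e * snorm ?d" using bounded[OF V(3,4)] by simp
  finally show "c * (sdist (uh n) x)\<^sup>2 \<le> C * sdist (uh n) x * sdist w x" by (simp add: sdist_def)
qed (use sdist_nonneg x(1) in_V[OF uh] in_V[OF w] in auto)

text \<open>
  No completeness is needed: let \<open>S n\<close> be the set of elements of \<open>\<Union>n. X n\<close> that have the same Galerkin
  approximation in \<open>X n\<close> as \<open>u\<close>. Almost norm-minimal elements \<open>w n\<close> of the decreasing convex sets \<open>S n\<close>
  form a Cauchy sequence by the parallelogram identity, and \<open>uh l\<close>, being also the Galerkin approximation of
  \<open>w l\<close>, is quasi-optimally close to \<open>w l\<close> as soon as \<open>X l\<close> contains an earlier \<open>w n\<close>.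
\<close>

lemma uh_Cauchy: "\<exists>n0. \<forall>m\<ge>n0. \<forall>n\<ge>n0. sdist (uh m) (uh n) < e" if "0 < e" for e
proof -
  define S where "S = (\<lambda>n. {w \<in> \<Union>(range X). \<forall>v\<in>X n. a w v = a u v})"
  define d where "d = (\<lambda>n. Inf (snorm ` S n))"
  have S_V: "w \<in> V" if "w \<in> S n" for w n using that X_sub by (auto simp: S_def)
  \<comment> \<open>Nestedness makes later approximations members of earlier sets; in particular no
    \<open>S n\<close> is empty.\<close>
  have uh_S: "uh m \<in> S n" if "n \<le> m" for m n
    using orth uh X_mono[OF that] by (auto simp: S_def)
  have S_anti: "S m \<subseteq> S n" if "n \<le> m" for m n
    using X_mono[OF that] by (auto simp: S_def)
  have bdd: "bdd_below (snorm ` S n)" for n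
    using S_V snorm_nonneg by (intro bdd_belowI[of _ 0]) auto
  have d_le: "d n \<le> snorm w" if "w \<in> S n" for w n
    unfolding d_def using that bdd by (intro cInf_lower) auto
  have d_nonneg: "0 \<le> d n" for n
    unfolding d_def using uh_S[of n n] S_V snorm_nonneg by (intro cInf_greatest) auto
  \<comment> \<open>The sets shrink, so the infima of the norms rise; the norm of
    \<open>uh n\<close> caps them.\<close>
  have "mono d"
    unfolding d_def using S_anti uh_S[OF order_refl] bdd
    by (intro monoI cInf_superset_mono image_mono) blast+
  moreover have d_bound: "d n \<le> C / c * snorm u" for n
    using d_le[OF uh_S[of n n]] uh_bounded[of n] by simp
  ultimately obtain D where D: "d \<longlonglongrightarrow> D" "\<And>n. d n \<le> D"
    using incseq_convergent[of d "C / c * snorm u"] by blast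
  have "\<exists>w. w \<in> S n \<and> snorm w < d n + 1 / real (Suc n)" for n
  proof -
    have "\<exists>y\<in>snorm ` S n. y < d n + 1 / real (Suc n)"
      unfolding d_def by (rule cInf_lessD) (use uh_S in auto)
    then show ?thesis by auto
  qed
  then obtain w where w: "\<And>n. w n \<in> S n" "\<And>n. snorm (w n) < d n + 1 / real (Suc n)" by metis
  \<comment> \<open>From the midpoint identity: both norms are at most
    \<open>D + 1 / real (Suc n)\<close>, and the midpoint, again in \<open>S n\<close>, has norm at
    least \<open>d n\<close>. The difference vanishes in the limit because \<open>d\<close> tends to
    \<open>D\<close>.\<close>
  define \<delta> where "\<delta> = (\<lambda>n. (D + 1 / real (Suc n))\<^sup>2 - (d n)\<^sup>2)"
  have "\<delta> \<longlonglongrightarrow> (D + 0)\<^sup>2 - D\<^sup>2"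
    unfolding \<delta>_def using LIMSEQ_inverse_real_of_nat
    by (intro tendsto_intros D) (simp add: inverse_eq_divide)
  then have \<delta>: "\<delta> \<longlonglongrightarrow> 0" by simp
  have w_dist: "(sdist (w m) (w n))\<^sup>2 \<le> 4 * \<delta> n" if "n \<le> m" for m n
  proof -
    have wV: "w m \<in> V" "w n \<in> V" using w(1) S_V by auto
    have wS: "w m \<in> S n" "w n \<in> S n" using w(1) S_anti[OF that] by auto
    let ?x = "\<lambda>x. 1/2 * w m x + 1/2 * w n x"
    have "?x \<in> S n"
    proof -
      obtain i j where "w m \<in> X i" "w n \<in> X j" using wS by (auto simp: S_def)
      \<comment> \<open>Nestedness puts both elements into one space, so their midpoint stays in the
        union.\<close>
      then have "w m \<in> X (max i j)" "w n \<in> X (max i j)"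
        using X_mono[of i "max i j"] X_mono[of j "max i j"] by auto
      then have "?x \<in> X (max i j)" by (rule function_subspaceD[OF X_subspace])
      moreover have "a ?x v = a u v" if "v \<in> X n" for v
      proof -
        have "a ?x v = 1/2 * a (w m) v + 1/2 * a (w n) v"
          using a_bilinear wV in_V[OF that] unfolding bilinear_on_def by blast
        then show ?thesis using wS that by (simp add: S_def)
      qed
      ultimately show ?thesis by (auto simp: S_def)
    qed
    then have dn: "(d n)\<^sup>2 \<le> (snorm ?x)\<^sup>2" using d_le d_nonneg by (intro power_mono) auto
    have wk: "(snorm (w k))\<^sup>2 \<le> (D + 1 / real (Suc n))\<^sup>2" if "k \<ge> n" for k
    proof (rule power_mono)
      have "1 / real (Suc k) \<le> 1 / real (Suc n)" using that by (intro divide_left_mono) auto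
      then show "snorm (w k) \<le> D + 1 / real (Suc n)" using w(2)[of k] D(2)[of k] by linarith
      show "0 \<le> snorm (w k)" using w(1) S_V snorm_nonneg by blast
    qed
    show ?thesis
      using dn sdist_square_midpoint[OF wV] wk[OF that] wk[OF order_refl] by (simp add: \<delta>_def)
  qed
  \<comment> \<open>Twice the distance \<open>(C / c + 1) * \<epsilon>\<close> must stay strictly
    below \<open>e\<close>; the last summand 1 leaves the room.\<close>
  define \<epsilon> where "\<epsilon> = e / (2 * (C / c + 1) + 1)"
  have Cc: "0 \<le> C / c" using c_pos C_nonneg by simp
  have \<epsilon>: "0 < \<epsilon>" unfolding \<epsilon>_def using that Cc by (intro divide_pos_pos) auto
  have "eventually (\<lambda>n. \<delta> n < \<epsilon>\<^sup>2 / 4) sequentially"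
    using \<delta> \<epsilon> by (intro order_tendstoD) auto
  then obtain n where n: "\<delta> n < \<epsilon>\<^sup>2 / 4" by (auto simp: eventually_sequentially)
  obtain k where k: "w n \<in> X k" using w(1)[of n] by (auto simp: S_def)
  have close: "sdist (uh l) (w n) \<le> (C / c + 1) * \<epsilon>" if "max n k \<le> l" for l
  proof -
    have wl: "w l \<in> V" "w n \<in> V" "uh l \<in> V" using w S_V in_V uh by blast+
    have "(sdist (w l) (w n))\<^sup>2 \<le> \<epsilon>\<^sup>2" using w_dist[of n l] n that by simp
    then have 1: "sdist (w l) (w n) \<le> \<epsilon>" using \<epsilon> by (auto intro: power2_le_imp_le)
    \<comment> \<open>By now \<open>w n\<close> belongs to \<open>X l\<close>, so it competes in the
      quasi-optimality estimate relative to \<open>w l\<close>.\<close>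
    have "sdist (uh l) (w l) \<le> C / c * sdist (w n) (w l)"
      by (rule Cea) (use w(1)[of l] wl k X_mono[of k l] that in \<open>auto simp: S_def\<close>)
    also have "\<dots> \<le> C / c * \<epsilon>" using 1 sdist_commute[OF wl(1,2)] Cc by (intro mult_left_mono) auto
    finally show ?thesis using sdist_triangle[OF wl(3,1,2)] 1 by (simp add: algebra_simps)
  qed
  show ?thesis
  proof (intro exI[of _ "max n k"] allI impI)
    fix l m assume lm: "max n k \<le> l" "max n k \<le> m"
    have V: "w n \<in> V" "uh l \<in> V" "uh m \<in> V" using w S_V in_V uh by blast+
    have "sdist (uh l) (uh m) \<le> 2 * (C / c + 1) * \<epsilon>"
      using sdist_triangle[OF V(2,1,3)] close[OF lm(1)] close[OF lm(2)] sdist_commute[OF V(1,3)]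
        by linarith
    also have "\<dots> < (2 * (C / c + 1) + 1) * \<epsilon>" using \<epsilon> by simp
    also have "\<dots> = e" using Cc by (simp add: \<epsilon>_def)
    finally show "sdist (uh l) (uh m) < e" .
  qed
qed

end

section \<open>Sobolev functions on a bounded open set\<close>

locale bounded_open_set =
  fixes \<Omega> :: "(real^'d) set"
  assumes open_domain: "open \<Omega>" and bounded_domain: "bounded \<Omega>"
begin

lemma domain_sets [measurable]: "\<Omega> \<in> sets lebesgue"
  using open_domain by simp

text \<open>Finite measure places bounded measurable functions in \<open>L2_space \<Omega>\<close>,
  and that space inside the integrable functions.\<close>

sublocale finite_measure "lebesgue_on \<Omega>"
  by (intro finite_measure_lebesgue_on) (rule bounded_set_imp_lmeasurable[OF bounded_domain domain_sets])

lemma L2_measurable: "f \<in> L2_space \<Omega> \<Longrightarrow> f \<in> borel_measurable (lebesgue_on \<Omega>)"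
  by (simp add: L2_space_def)

lemma L2_square_integrable: "f \<in> L2_space \<Omega> \<Longrightarrow> integrable (lebesgue_on \<Omega>) (\<lambda>x. (norm (f x))\<^sup>2)"
  by (simp add: L2_space_def)

lemma prod_le_sum_squares: "0 \<le> a \<Longrightarrow> 0 \<le> b \<Longrightarrow> a * b \<le> a\<^sup>2 + b\<^sup>2" for a b :: real
  using sum_squares_bound[of a b] mult_nonneg_nonneg[of a b] by linarith

text \<open>Inner products and multiples by scalar functions share this argument; the pointwise
  bound \<open>prod_le_sum_squares\<close> does the work of Hoelder's inequality.\<close>

lemma L2_product_integrable:
  fixes f :: "real^'d \<Rightarrow> 'b::euclidean_space" and g :: "real^'d \<Rightarrow> 'c::euclidean_space"
  assumes "f \<in> L2_space \<Omega>" "g \<in> L2_space \<Omega>" "h \<in> borel_measurable (lebesgue_on \<Omega>)"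
    and "\<And>x. norm (h x) \<le> norm (f x) * norm (g x)"
  shows "integrable (lebesgue_on \<Omega>) (h :: _ \<Rightarrow> 'e::euclidean_space)"
proof (rule Bochner_Integration.integrable_bound)
  show "integrable (lebesgue_on \<Omega>) (\<lambda>x. (norm (f x))\<^sup>2 + (norm (g x))\<^sup>2)"
    using assms by (intro Bochner_Integration.integrable_add L2_square_integrable)
  show "AE x in lebesgue_on \<Omega>. norm (h x) \<le> norm ((norm (f x))\<^sup>2 + (norm (g x))\<^sup>2)"
    using order_trans[OF assms(4) prod_le_sum_squares[OF norm_ge_zero norm_ge_zero]]
      by (intro AE_I2) simp
qed (rule assms)

lemma L2_inner_integrable:
  assumes "f \<in> L2_space \<Omega>" "g \<in> L2_space \<Omega>"
  shows "integrable (lebesgue_on \<Omega>) (\<lambda>x. f x \<bullet> g x)"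
  using assms by (intro L2_product_integrable[OF assms])
    (auto intro!: borel_measurable_inner L2_measurable[OF assms(1)] L2_measurable[OF assms(2)] Cauchy_Schwarz_ineq2)

lemma L2_scaleR_integrable:
  assumes "f \<in> L2_space \<Omega>" "g \<in> L2_space \<Omega>"
  shows "integrable (lebesgue_on \<Omega>) (\<lambda>x. f x *\<^sub>R g x)"
  using assms by (intro L2_product_integrable[OF assms])
    (auto intro!: borel_measurable_scaleR L2_measurable[OF assms(1)] L2_measurable[OF assms(2)])

lemma bounded_L2:
  assumes "f \<in> borel_measurable (lebesgue_on \<Omega>)" "\<And>x. norm (f x) \<le> C"
  shows "f \<in> L2_space \<Omega>"
proof -
  have "(norm (f x))\<^sup>2 \<le> C\<^sup>2" for x using assms(2) by (intro power_mono) auto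
  then have "integrable (lebesgue_on \<Omega>) (\<lambda>x. (norm (f x))\<^sup>2)"
    using assms(1) by (intro integrable_const_bound[of _ "C\<^sup>2"])
      (auto intro!: borel_measurable_power borel_measurable_norm)
  with assms(1) show ?thesis by (simp add: L2_space_def)
qed

lemma L2_integrable: 
  assumes "f \<in> L2_space \<Omega>" shows "integrable (lebesgue_on \<Omega>) f"
proof -
  have "(\<lambda>x. 1::real) \<in> L2_space \<Omega>" by (rule bounded_L2[where C = 1]) auto
  from L2_scaleR_integrable[OF this assms] show ?thesis by simp
qed

lemma L2_dominated:
  assumes "f \<in> L2_space \<Omega>" "g \<in> borel_measurable (lebesgue_on \<Omega>)"
    and "AE x in lebesgue_on \<Omega>. norm (g x) \<le> C * norm (f x)"
  shows "g \<in> L2_space \<Omega>"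
proof -
  have "integrable (lebesgue_on \<Omega>) (\<lambda>x. (norm (g x))\<^sup>2)"
  proof (rule Bochner_Integration.integrable_bound)
    show "integrable (lebesgue_on \<Omega>) (\<lambda>x. C\<^sup>2 * (norm (f x))\<^sup>2)"
      using L2_square_integrable[OF assms(1)] by simp
    show "AE x in lebesgue_on \<Omega>. norm ((norm (g x))\<^sup>2) \<le> norm (C\<^sup>2 * (norm (f x))\<^sup>2)"
      using assms(3)
    proof eventually_elim
      case (elim x)
      then have "(norm (g x))\<^sup>2 \<le> (C * norm (f x))\<^sup>2" by (intro power_mono) auto
      then show ?case by (simp add: power_mult_distrib)
    qed
  qed (use assms(2) in \<open>auto intro!: borel_measurable_power borel_measurable_norm\<close>)
  with assms(2) show ?thesis by (simp add: L2_space_def)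
qed

lemma L2_comb:
  assumes "f \<in> L2_space \<Omega>" "g \<in> L2_space \<Omega>"
  shows "(\<lambda>x. s *\<^sub>R f x + t *\<^sub>R g x) \<in> L2_space \<Omega>"
proof -
  let ?h = "\<lambda>x. s *\<^sub>R f x + t *\<^sub>R g x"
  have m: "?h \<in> borel_measurable (lebesgue_on \<Omega>)"
    by (intro borel_measurable_add borel_measurable_scaleR borel_measurable_const L2_measurable assms)
  have "integrable (lebesgue_on \<Omega>) (\<lambda>x. s\<^sup>2 * (f x \<bullet> f x) + 2 * s * t * (f x \<bullet> g x) + t\<^sup>2 * (g x \<bullet> g x))"
    using assms by (intro Bochner_Integration.integrable_add integrable_mult_right L2_inner_integrable)
  also have "(\<lambda>x. s\<^sup>2 * (f x \<bullet> f x) + 2 * s * t * (f x \<bullet> g x) + t\<^sup>2 * (g x \<bullet> g x)) = (\<lambda>x. (norm (?h x))\<^sup>2)"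
    unfolding power2_norm_eq_inner
    by (simp add: inner_add_left inner_add_right power2_eq_square inner_commute algebra_simps)
  finally show ?thesis using m by (simp add: L2_space_def)
qed

lemma continuous_measurable: 
  fixes f :: "real^'d \<Rightarrow> 'b::euclidean_space"
  shows "continuous_on UNIV f \<Longrightarrow> f \<in> borel_measurable (lebesgue_on \<Omega>)"
  by (rule continuous_imp_measurable_on_sets_lebesgue[OF continuous_on_subset domain_sets]) auto

lemma test_function_L2:
  assumes "\<phi> \<in> test_functions \<Omega>"
  shows "\<phi> \<in> L2_space \<Omega>" "grad \<phi> \<in> L2_space \<Omega>"
proof -
  obtain S where S: "compact S" "\<And>x. x \<notin> S \<Longrightarrow> \<phi> x = 0" "\<And>x. x \<notin> S \<Longrightarrow> grad \<phi> x = 0"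
    using test_function_support[OF assms] by metis
  have Ck: "Ck (Suc 0) \<phi>" using assms by (rule test_function_Ck)
  have c: "continuous_on UNIV \<phi>" using Ck by (rule Ck_continuous_on)
  have ci: "continuous_on UNIV (\<lambda>x. grad \<phi> x $ i)" for i using Ck by simp
  then have cg: "continuous_on UNIV (grad \<phi>)"
    using continuous_on_vec_lambda[of UNIV "\<lambda>i x. grad \<phi> x $ i"] by simp
  obtain M where M: "\<And>x. \<bar>\<phi> x\<bar> \<le> M" using compactly_supported_bounded[OF c S(1,2)] by blast
  show "\<phi> \<in> L2_space \<Omega>" using M by (intro bounded_L2[of _ M] continuous_measurable[OF c]) simp
  have "\<exists>M. \<forall>x. \<bar>grad \<phi> x $ i\<bar> \<le> M" for i
  proof -
    have "grad \<phi> x $ i = 0" if "x \<notin> S" for x using S(3)[OF that] by simp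
    then obtain M where "\<And>x. \<bar>grad \<phi> x $ i\<bar> \<le> M"
      using compactly_supported_bounded[OF ci S(1)] by blast
    then show ?thesis by blast
  qed
  then obtain B where B: "\<And>i x. \<bar>grad \<phi> x $ i\<bar> \<le> B i" by metis
  have "norm (grad \<phi> x) \<le> (\<Sum>i\<in>UNIV. B i)" for x
    by (rule order_trans[OF norm_le_l1_cart sum_mono]) (rule B)
  then show "grad \<phi> \<in> L2_space \<Omega>" by (intro bounded_L2 continuous_measurable[OF cg])
qed

lemma integral_component:
  fixes F :: "real^'d \<Rightarrow> real^'d"
  assumes "integrable (lebesgue_on \<Omega>) F"
  shows "(LINT x|lebesgue_on \<Omega>. F x) $ i = (LINT x|lebesgue_on \<Omega>. F x $ i)"
  using integral_bounded_linear[OF bounded_linear_vec_nth assms, of i] by simp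

lemma integral_partial_derivative_0_domain:
  fixes f :: "real^'d \<Rightarrow> real"
  assumes "Ck (Suc 0) f" "compact S" "S \<subseteq> \<Omega>" "\<And>x. x \<notin> S \<Longrightarrow> f x = 0"
  shows "(LINT x|lebesgue_on \<Omega>. grad f x $ i) = 0"
proof -
  have "(\<lambda>x. grad f x $ i) \<in> borel_measurable borel"
    using assms(1) by (intro borel_measurable_continuous_onI) simp
  moreover have "grad f x $ i = 0" if "x \<notin> \<Omega>" for x
  proof -
    have "x \<notin> S" using that assms(3) by blast
    from grad_eq_0_outside[OF compact_imp_closed[OF assms(2)] assms(4) this] show ?thesis by simp
  qed
  ultimately have "(LINT x|lebesgue_on \<Omega>. grad f x $ i) = (LINT x|lborel. grad f x $ i)"
    by (rule integral_lebesgue_on_supported[OF domain_sets])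
  also have "\<dots> = 0" by (rule integral_partial_derivative_0[OF assms(1,2,4)])
  finally show ?thesis .
qed

text \<open>The product of two test functions has compact support in the domain, so its partial
  derivatives integrate to zero; the product rule turns this into the defining identity.\<close>

lemma test_function_weak_gradient:
  assumes \<phi>: "\<phi> \<in> test_functions \<Omega>"
  shows "weak_gradient \<Omega> \<phi> (grad \<phi>)"
  unfolding weak_gradient_def
proof
  fix \<psi> assume \<psi>: "\<psi> \<in> test_functions \<Omega>"
  note L2 = test_function_L2[OF \<phi>] test_function_L2[OF \<psi>]
  obtain S where S: "compact S" "S \<subseteq> \<Omega>" "\<And>x. x \<notin> S \<Longrightarrow> \<phi> x = 0"
    using test_function_support[OF \<phi>] by metis
  have Ck: "Ck (Suc 0) \<phi>" "Ck (Suc 0) \<psi>" using \<phi> \<psi> by (blast intro: test_function_Ck)+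
  have 1: "integrable (lebesgue_on \<Omega>) (\<lambda>x. \<phi> x *\<^sub>R grad \<psi> x)"
    "integrable (lebesgue_on \<Omega>) (\<lambda>x. \<psi> x *\<^sub>R grad \<phi> x)"
    using L2 by (intro L2_scaleR_integrable; simp)+
  have "(LINT x|lebesgue_on \<Omega>. grad (\<lambda>x. \<phi> x * \<psi> x) x $ i) = 0" for i
    by (rule integral_partial_derivative_0_domain[OF Ck_mult[OF Ck] S(1,2)]) (simp add: S(3))
  then have "(LINT x|lebesgue_on \<Omega>. \<phi> x *\<^sub>R grad \<psi> x + \<psi> x *\<^sub>R grad \<phi> x) = 0"
    using 1 by (simp add: vec_eq_iff integral_component grad_mult[OF Ck] del: Bochner_Integration.integral_add)
  then show "(LINT x|lebesgue_on \<Omega>. \<phi> x *\<^sub>R grad \<psi> x) = - (LINT x|lebesgue_on \<Omega>. \<psi> x *\<^sub>R grad \<phi> x)"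
    using 1 by (simp add: eq_neg_iff_add_eq_0)
qed

text \<open>The difference of two weak gradients integrates to zero against all test functions, so
  the fundamental lemma applies to each of its components.\<close>

lemma weak_gradient_unique:
  assumes g: "g1 \<in> L2_space \<Omega>" "g2 \<in> L2_space \<Omega>" "weak_gradient \<Omega> v g1" "weak_gradient \<Omega> v g2"
  shows "AE x in lebesgue_on \<Omega>. g1 x = g2 x"
proof -
  have "AE x in lebesgue_on \<Omega>. g1 x $ i - g2 x $ i = 0" for i
  proof (rule fundamental_lemma_of_calculus_of_variations[OF open_domain])
    have "integrable (lebesgue_on \<Omega>) (\<lambda>x. g1 x - g2 x)"
      by (rule Bochner_Integration.integrable_diff[OF L2_integrable[OF g(1)] L2_integrable[OF g(2)]])
    from integrable_bounded_linear[OF bounded_linear_vec_nth this, of i]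
    show "integrable (lebesgue_on \<Omega>) (\<lambda>x. g1 x $ i - g2 x $ i)" by simp
    fix \<phi> assume \<phi>: "\<phi> \<in> test_functions \<Omega>"
    have 1: "integrable (lebesgue_on \<Omega>) (\<lambda>x. \<phi> x *\<^sub>R g1 x)"
      "integrable (lebesgue_on \<Omega>) (\<lambda>x. \<phi> x *\<^sub>R g2 x)"
      by (intro L2_scaleR_integrable test_function_L2[OF \<phi>] g)+
    then have "(LINT x|lebesgue_on \<Omega>. \<phi> x *\<^sub>R g1 x - \<phi> x *\<^sub>R g2 x) = 0"
      using g(3,4) \<phi> by (simp add: weak_gradient_def)
    then have "(LINT x|lebesgue_on \<Omega>. (\<phi> x *\<^sub>R g1 x - \<phi> x *\<^sub>R g2 x) $ i) = 0"
      using 1 integral_component[of "\<lambda>x. \<phi> x *\<^sub>R g1 x - \<phi> x *\<^sub>R g2 x" i] by simp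
    then show "(LINT x|lebesgue_on \<Omega>. \<phi> x * (g1 x $ i - g2 x $ i)) = 0" by (simp add: algebra_simps)
  qed
  then have "AE x in lebesgue_on \<Omega>. \<forall>i. g1 x $ i - g2 x $ i = 0"
    by (simp add: AE_all_countable)
  then show ?thesis by eventually_elim (simp add: vec_eq_iff)
qed

lemma wgrad:
  assumes "v \<in> H1_space \<Omega>"
  shows "wgrad \<Omega> v \<in> L2_space \<Omega>" "weak_gradient \<Omega> v (wgrad \<Omega> v)"
proof -
  have "\<exists>g. g \<in> L2_space \<Omega> \<and> weak_gradient \<Omega> v g" using assms by (auto simp: H1_space_def)
  from someI_ex[OF this] show "wgrad \<Omega> v \<in> L2_space \<Omega>" "weak_gradient \<Omega> v (wgrad \<Omega> v)"
    by (auto simp: wgrad_def)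
qed

lemma H1_L2: "v \<in> H1_space \<Omega> \<Longrightarrow> v \<in> L2_space \<Omega>"
  by (simp add: H1_space_def)

lemma weak_gradient_comb:
  assumes v: "v \<in> H1_space \<Omega>" and w: "w \<in> H1_space \<Omega>"
  shows "weak_gradient \<Omega> (\<lambda>x. s * v x + t * w x) (\<lambda>x. s *\<^sub>R wgrad \<Omega> v x + t *\<^sub>R wgrad \<Omega> w x)"
  unfolding weak_gradient_def
proof
  fix \<phi> assume \<phi>: "\<phi> \<in> test_functions \<Omega>"
  note L2 = test_function_L2[OF \<phi>] H1_L2[OF v] H1_L2[OF w] wgrad(1)[OF v] wgrad(1)[OF w]
  have 1: "integrable (lebesgue_on \<Omega>) (\<lambda>x. v x *\<^sub>R grad \<phi> x)"
    "integrable (lebesgue_on \<Omega>) (\<lambda>x. w x *\<^sub>R grad \<phi> x)"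
    "integrable (lebesgue_on \<Omega>) (\<lambda>x. \<phi> x *\<^sub>R wgrad \<Omega> v x)"
      "integrable (lebesgue_on \<Omega>) (\<lambda>x. \<phi> x *\<^sub>R wgrad \<Omega> w x)"
    using L2 by (auto intro!: L2_scaleR_integrable)
  have "(LINT x|lebesgue_on \<Omega>. (s * v x + t * w x) *\<^sub>R grad \<phi> x) =
    (LINT x|lebesgue_on \<Omega>. s *\<^sub>R (v x *\<^sub>R grad \<phi> x) + t *\<^sub>R (w x *\<^sub>R grad \<phi> x))"
    by (simp add: scaleR_add_left)
  also have "\<dots> = s *\<^sub>R (LINT x|lebesgue_on \<Omega>. v x *\<^sub>R grad \<phi> x) + t *\<^sub>R (LINT x|lebesgue_on \<Omega>. w x *\<^sub>R grad \<phi> x)"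
    using 1 by (simp del: scaleR_scaleR)
  also have "\<dots> = - (s *\<^sub>R (LINT x|lebesgue_on \<Omega>. \<phi> x *\<^sub>R wgrad \<Omega> v x) + t *\<^sub>R (LINT x|lebesgue_on \<Omega>. \<phi> x *\<^sub>R wgrad \<Omega> w x))"
    using wgrad(2)[OF v] wgrad(2)[OF w] \<phi> by (simp add: weak_gradient_def)
  also have "s *\<^sub>R (LINT x|lebesgue_on \<Omega>. \<phi> x *\<^sub>R wgrad \<Omega> v x) + t *\<^sub>R (LINT x|lebesgue_on \<Omega>. \<phi> x *\<^sub>R wgrad \<Omega> w x)
    = (LINT x|lebesgue_on \<Omega>. s *\<^sub>R (\<phi> x *\<^sub>R wgrad \<Omega> v x) + t *\<^sub>R (\<phi> x *\<^sub>R wgrad \<Omega> w x))"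
    using 1 by (simp del: scaleR_scaleR)
  also have "\<dots> = (LINT x|lebesgue_on \<Omega>. \<phi> x *\<^sub>R (s *\<^sub>R wgrad \<Omega> v x + t *\<^sub>R wgrad \<Omega> w x))"
    by (simp add: scaleR_add_right mult.commute)
  finally show "(LINT x|lebesgue_on \<Omega>. (s * v x + t * w x) *\<^sub>R grad \<phi> x) =
    - (LINT x|lebesgue_on \<Omega>. \<phi> x *\<^sub>R (s *\<^sub>R wgrad \<Omega> v x + t *\<^sub>R wgrad \<Omega> w x))" .
qed

lemma H1_subspace: "function_subspace (H1_space \<Omega>)"
  unfolding function_subspace_def
proof (intro ballI allI)
  fix v w s t assume v: "v \<in> H1_space \<Omega>" and w: "w \<in> H1_space \<Omega>"
  have "(\<lambda>x. s * v x + t * w x) \<in> L2_space \<Omega>"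
    using L2_comb[OF H1_L2[OF v] H1_L2[OF w], of s t] by simp
  with L2_comb[OF wgrad(1)[OF v] wgrad(1)[OF w], of s t] weak_gradient_comb[OF v w, of s t]
  show "(\<lambda>x. s * v x + t * w x) \<in> H1_space \<Omega>"
    unfolding H1_space_def mem_Collect_eq by (intro conjI bexI)
qed

lemma wgrad_comb:
  assumes v: "v \<in> H1_space \<Omega>" and w: "w \<in> H1_space \<Omega>"
  shows "AE x in lebesgue_on \<Omega>. wgrad \<Omega> (\<lambda>x. s * v x + t * w x) x = s *\<^sub>R wgrad \<Omega> v x + t *\<^sub>R wgrad \<Omega> w x"
  by (rule weak_gradient_unique[OF wgrad(1)[OF function_subspaceD[OF H1_subspace v w]]
        L2_comb[OF wgrad(1)[OF v] wgrad(1)[OF w]] wgrad(2)[OF function_subspaceD[OF H1_subspace v w]]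
        weak_gradient_comb[OF v w]])

lemma test_function_H1:
  assumes "\<phi> \<in> test_functions \<Omega>" shows "\<phi> \<in> H1_space \<Omega>"
  unfolding H1_space_def mem_Collect_eq
  by (intro conjI bexI[of _ "grad \<phi>"] test_function_L2[OF assms] test_function_weak_gradient[OF assms])

lemma wgrad_test_function:
  assumes "\<phi> \<in> test_functions \<Omega>"
  shows "AE x in lebesgue_on \<Omega>. wgrad \<Omega> \<phi> x = grad \<phi> x"
  by (rule weak_gradient_unique[OF wgrad(1)[OF test_function_H1] test_function_L2(2)
        wgrad(2)[OF test_function_H1] test_function_weak_gradient]) (rule assms)+

end

text \<open>Here \<open>norm A\<close> is the Frobenius norm. Summing the row bounds gives a crude
  dimension factor, which affects only the size of constants.\<close>

lemma norm_matrix_vector_mult_le: "norm (A *v x) \<le> real CARD('m) * norm A * norm x"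
  for A :: "real^'n^'m"
proof -
  have "\<bar>(A *v x) $ i\<bar> \<le> norm A * norm x" for i
  proof -
    have "(A *v x) $ i = A $ i \<bullet> x" by (simp add: matrix_vector_mult_def inner_vec_def)
    then have "\<bar>(A *v x) $ i\<bar> \<le> norm (A $ i) * norm x" by (simp add: Cauchy_Schwarz_ineq2)
    also have "\<dots> \<le> norm A * norm x"
      by (intro mult_right_mono Finite_Cartesian_Product.norm_nth_le) auto
    finally show ?thesis .
  qed
  then have "(\<Sum>i\<in>UNIV. \<bar>(A *v x) $ i\<bar>) \<le> (\<Sum>i\<in>(UNIV::'m set). norm A * norm x)" by (intro sum_mono)
  then show ?thesis using norm_le_l1_cart[of "A *v x"] by simp
qed

lemma bounded_bilinear_matrix_vector_mult:
  "bounded_bilinear ((*v) :: real^'n^'m \<Rightarrow> real^'n \<Rightarrow> real^'m)"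
proof
  show "\<exists>K. \<forall>A x. norm ((A :: real^'n^'m) *v x) \<le> norm A * norm x * K"
    using norm_matrix_vector_mult_le by (metis mult.assoc mult.commute)
qed (simp_all add: matrix_vector_mult_add_rdistrib matrix_vector_right_distrib scaleR_matrix_vector_assoc
    matrix_vector_mult_scaleR)

lemma borel_measurable_matrix_vector_mult:
  fixes A :: "'a \<Rightarrow> real^'n^'m"
  assumes "A \<in> borel_measurable M" "v \<in> borel_measurable M"
  shows "(\<lambda>x. A x *v v x) \<in> borel_measurable M"
proof -
  have "continuous_on UNIV (\<lambda>p. (fst p :: real^'n^'m) *v snd p)"
    by (intro bounded_bilinear.continuous_on[OF bounded_bilinear_matrix_vector_mult] continuous_on_fst
        continuous_on_snd continuous_on_id)
  from borel_measurable_continuous_Pair[OF assms, of "\<lambda>A x. A *v x"] this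
  show ?thesis by (simp add: case_prod_beta)
qed

section \<open>Bilinear forms with bounded coefficients\<close>

context bounded_open_set
begin

lemma AE_domain_iff: "(AE x\<in>\<Omega> in lebesgue. P x) \<longleftrightarrow> (AE x in lebesgue_on \<Omega>. P x)"
  by (subst AE_restrict_space_iff) auto

lemma Linf_const: "(\<lambda>x. k) \<in> Linf_space \<Omega>"
  by (auto simp: Linf_space_def)

lemma Linf_matrix_L2:
  fixes A :: "real^'d \<Rightarrow> real^'d^'d"
  assumes "A \<in> Linf_space \<Omega>" "v \<in> L2_space \<Omega>"
  shows "(\<lambda>x. A x *v v x) \<in> L2_space \<Omega>"
proof -
  obtain C where C: "AE x in lebesgue_on \<Omega>. norm (A x) \<le> C"
    using assms(1) by (auto simp: Linf_space_def AE_domain_iff)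
  have A: "A \<in> borel_measurable (lebesgue_on \<Omega>)" using assms(1) by (simp add: Linf_space_def)
  show ?thesis
  proof (rule L2_dominated[OF assms(2)])
    show "(\<lambda>x. A x *v v x) \<in> borel_measurable (lebesgue_on \<Omega>)"
      by (rule borel_measurable_matrix_vector_mult[OF A L2_measurable[OF assms(2)]])
    show "AE x in lebesgue_on \<Omega>. norm (A x *v v x) \<le> real CARD('d) * C * norm (v x)"
      using C
    proof eventually_elim
      case (elim x)
      have "norm (A x *v v x) \<le> real CARD('d) * norm (A x) * norm (v x)"
        by (rule norm_matrix_vector_mult_le)
      also have "\<dots> \<le> real CARD('d) * C * norm (v x)"
        using elim by (intro mult_right_mono mult_left_mono) auto
      finally show ?case .
    qed
  qed
qed

lemma Linf_inner_L2:
  fixes b :: "real^'d \<Rightarrow> 'b::euclidean_space"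
  assumes "b \<in> Linf_space \<Omega>" "v \<in> L2_space \<Omega>"
  shows "(\<lambda>x. b x \<bullet> v x) \<in> L2_space \<Omega>"
proof -
  obtain C where C: "AE x in lebesgue_on \<Omega>. norm (b x) \<le> C"
    using assms(1) by (auto simp: Linf_space_def AE_domain_iff)
  have b: "b \<in> borel_measurable (lebesgue_on \<Omega>)" using assms(1) by (simp add: Linf_space_def)
  show ?thesis
  proof (rule L2_dominated[OF assms(2)])
    show "(\<lambda>x. b x \<bullet> v x) \<in> borel_measurable (lebesgue_on \<Omega>)"
      by (rule borel_measurable_inner[OF b L2_measurable[OF assms(2)]])
    show "AE x in lebesgue_on \<Omega>. norm (b x \<bullet> v x) \<le> C * norm (v x)"
      using C
    proof eventually_elim
      case (elim x)
      have "norm (b x \<bullet> v x) \<le> norm (b x) * norm (v x)"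
        by (simp add: Cauchy_Schwarz_ineq2)
      also have "\<dots> \<le> C * norm (v x)" using elim by (intro mult_right_mono) auto
      finally show ?case .
    qed
  qed
qed

lemma bilinear_form_integrable:
  assumes "A \<in> Linf_space \<Omega>" "b \<in> Linf_space \<Omega>" "c \<in> Linf_space \<Omega>"
    and v: "v \<in> H1_space \<Omega>" and w: "w \<in> H1_space \<Omega>"
  shows "integrable (lebesgue_on \<Omega>) (\<lambda>x. (A x *v wgrad \<Omega> v x) \<bullet> wgrad \<Omega> w x)"
    "integrable (lebesgue_on \<Omega>) (\<lambda>x. (b x \<bullet> wgrad \<Omega> v x) * w x)"
    "integrable (lebesgue_on \<Omega>) (\<lambda>x. c x * v x * w x)"
  using L2_inner_integrable[OF Linf_matrix_L2[OF assms(1) wgrad(1)[OF v]] wgrad(1)[OF w]]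
    L2_inner_integrable[OF Linf_inner_L2[OF assms(2) wgrad(1)[OF v]] H1_L2[OF w]]
    L2_inner_integrable[OF Linf_inner_L2[OF assms(3) H1_L2[OF v]] H1_L2[OF w]]
  by simp_all

text \<open>Tailored to weak gradients: the gradient chosen for a linear combination matches the
  combined gradients only almost everywhere, which still suffices for linearity of the
  integrals.\<close>

lemma integral_comb_AE:
  fixes f :: "real^'d \<Rightarrow> real"
  assumes f1: "integrable (lebesgue_on \<Omega>) f1" and f2: "integrable (lebesgue_on \<Omega>) f2"
    and f: "integrable (lebesgue_on \<Omega>) f"
    and AE: "AE x in lebesgue_on \<Omega>. f x = s * f1 x + t * f2 x"
  shows "(LINT x|lebesgue_on \<Omega>. f x) = s * (LINT x|lebesgue_on \<Omega>. f1 x) + t * (LINT x|lebesgue_on \<Omega>. f2 x)"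
proof -
  have "(LINT x|lebesgue_on \<Omega>. f x) = (LINT x|lebesgue_on \<Omega>. s * f1 x + t * f2 x)"
    using f f1 f2 by (intro integral_cong_AE[OF _ _ AE] borel_measurable_integrable) auto
  then show ?thesis using f1 f2 by simp
qed

lemma bilinear_form_bilinear:
  assumes coeff: "A \<in> Linf_space \<Omega>" "b \<in> Linf_space \<Omega>" "c \<in> Linf_space \<Omega>"
  shows "bilinear_on (H1_space \<Omega>) (bilinear_form \<Omega> A b c)"
  unfolding bilinear_on_def
proof (intro ballI allI conjI)
  fix u v w s t
  assume u: "u \<in> H1_space \<Omega>" and v: "v \<in> H1_space \<Omega>" and w: "w \<in> H1_space \<Omega>"
  let ?c = "\<lambda>x. s * u x + t * v x"
  have c: "?c \<in> H1_space \<Omega>" using function_subspaceD[OF H1_subspace u v] .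
  note i = bilinear_form_integrable[OF coeff]
  note AE = wgrad_comb[OF u v, of s t]
  have 1: "(LINT x|lebesgue_on \<Omega>. (A x *v wgrad \<Omega> ?c x) \<bullet> wgrad \<Omega> w x) =
    s * (LINT x|lebesgue_on \<Omega>. (A x *v wgrad \<Omega> u x) \<bullet> wgrad \<Omega> w x) +
    t * (LINT x|lebesgue_on \<Omega>. (A x *v wgrad \<Omega> v x) \<bullet> wgrad \<Omega> w x)"
    by (rule integral_comb_AE[OF i(1)[OF u w] i(1)[OF v w] i(1)[OF c w]], use AE in eventually_elim)
      (simp add: matrix_vector_right_distrib matrix_vector_mult_scaleR inner_add_left)
  have 2: "(LINT x|lebesgue_on \<Omega>. (b x \<bullet> wgrad \<Omega> ?c x) * w x) =
    s * (LINT x|lebesgue_on \<Omega>. (b x \<bullet> wgrad \<Omega> u x) * w x) +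
    t * (LINT x|lebesgue_on \<Omega>. (b x \<bullet> wgrad \<Omega> v x) * w x)"
    by (rule integral_comb_AE[OF i(2)[OF u w] i(2)[OF v w] i(2)[OF c w]], use AE in eventually_elim)
      (simp add: inner_add_right algebra_simps)
  have 3: "(LINT x|lebesgue_on \<Omega>. c x * ?c x * w x) =
    s * (LINT x|lebesgue_on \<Omega>. c x * u x * w x) + t * (LINT x|lebesgue_on \<Omega>. c x * v x * w x)"
    by (rule integral_comb_AE[OF i(3)[OF u w] i(3)[OF v w] i(3)[OF c w]]) (simp add: algebra_simps)
  show "bilinear_form \<Omega> A b c ?c w = s * bilinear_form \<Omega> A b c u w + t * bilinear_form \<Omega> A b c v w"
    unfolding bilinear_form_def 1 2 3 by (simp add: algebra_simps)
  have 1: "(LINT x|lebesgue_on \<Omega>. (A x *v wgrad \<Omega> w x) \<bullet> wgrad \<Omega> ?c x) =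
    s * (LINT x|lebesgue_on \<Omega>. (A x *v wgrad \<Omega> w x) \<bullet> wgrad \<Omega> u x) +
    t * (LINT x|lebesgue_on \<Omega>. (A x *v wgrad \<Omega> w x) \<bullet> wgrad \<Omega> v x)"
    by (rule integral_comb_AE[OF i(1)[OF w u] i(1)[OF w v] i(1)[OF w c]], use AE in eventually_elim)
      (simp add: inner_add_right)
  have 2: "(LINT x|lebesgue_on \<Omega>. (b x \<bullet> wgrad \<Omega> w x) * ?c x) =
    s * (LINT x|lebesgue_on \<Omega>. (b x \<bullet> wgrad \<Omega> w x) * u x) +
    t * (LINT x|lebesgue_on \<Omega>. (b x \<bullet> wgrad \<Omega> w x) * v x)"
    by (rule integral_comb_AE[OF i(2)[OF w u] i(2)[OF w v] i(2)[OF w c]]) (simp add: algebra_simps)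
  have 3: "(LINT x|lebesgue_on \<Omega>. c x * w x * ?c x) =
    s * (LINT x|lebesgue_on \<Omega>. c x * w x * u x) + t * (LINT x|lebesgue_on \<Omega>. c x * w x * v x)"
    by (rule integral_comb_AE[OF i(3)[OF w u] i(3)[OF w v] i(3)[OF w c]]) (simp add: algebra_simps)
  show "bilinear_form \<Omega> A b c w ?c = s * bilinear_form \<Omega> A b c w u + t * bilinear_form \<Omega> A b c w v"
    unfolding bilinear_form_def 1 2 3 by (simp add: algebra_simps)
qed

text \<open>Choices of \<open>A\<close> and \<open>c\<close> turn this into the L2, the Dirichlet,
  the full Sobolev and the energy product, so that one Cauchy-Schwarz and one triangle inequality
  serve all four.\<close>

lemma semi_inner_product_symmetric_form:
  assumes coeff: "A \<in> Linf_space \<Omega>" "c \<in> Linf_space \<Omega>"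
    and symm: "AE x in lebesgue_on \<Omega>. transpose (A x) = A x"
    and pos: "AE x in lebesgue_on \<Omega>. (\<forall>\<xi>. 0 \<le> (A x *v \<xi>) \<bullet> \<xi>) \<and> 0 \<le> c x"
  shows "semi_inner_product (H1_space \<Omega>) (bilinear_form \<Omega> A (\<lambda>x. 0) c)"
proof
  note i = bilinear_form_integrable[OF coeff(1) Linf_const coeff(2)]
  fix v w assume v: "v \<in> H1_space \<Omega>" and w: "w \<in> H1_space \<Omega>"
  have "(LINT x|lebesgue_on \<Omega>. (A x *v wgrad \<Omega> v x) \<bullet> wgrad \<Omega> w x) =
    (LINT x|lebesgue_on \<Omega>. (A x *v wgrad \<Omega> w x) \<bullet> wgrad \<Omega> v x)"
  proof (rule integral_cong_AE)
    show "AE x in lebesgue_on \<Omega>. (A x *v wgrad \<Omega> v x) \<bullet> wgrad \<Omega> w x = (A x *v wgrad \<Omega> w x) \<bullet> wgrad \<Omega> v x"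
      using symm by eventually_elim (metis dot_lmul_matrix inner_commute vector_transpose_matrix)
  qed (use i(1)[OF v w] i(1)[OF w v] in auto)
  then show "bilinear_form \<Omega> A (\<lambda>x. 0) c v w = bilinear_form \<Omega> A (\<lambda>x. 0) c w v"
    by (simp add: bilinear_form_def ac_simps)
next
  fix v assume v: "v \<in> H1_space \<Omega>"
  have "0 \<le> (LINT x|lebesgue_on \<Omega>. (A x *v wgrad \<Omega> v x) \<bullet> wgrad \<Omega> v x)"
    using pos by (intro integral_nonneg_AE) (auto elim: eventually_mono)
  moreover have "AE x in lebesgue_on \<Omega>. 0 \<le> c x * v x * v x"
    using pos by eventually_elim (simp add: mult.assoc)
  then have "0 \<le> (LINT x|lebesgue_on \<Omega>. c x * v x * v x)"
    by (rule integral_nonneg_AE)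
  ultimately show "0 \<le> bilinear_form \<Omega> A (\<lambda>x. 0) c v v" by (simp add: bilinear_form_def)
qed (auto intro: H1_subspace bilinear_form_bilinear coeff Linf_const)

sublocale L2: semi_inner_product "H1_space \<Omega>" "bilinear_form \<Omega> (\<lambda>x. 0) (\<lambda>x. 0) (\<lambda>x. 1)"
  by (rule semi_inner_product_symmetric_form) (auto simp: Linf_const transpose_def vec_eq_iff)

sublocale Dir: semi_inner_product "H1_space \<Omega>" "bilinear_form \<Omega> (\<lambda>x. mat 1) (\<lambda>x. 0) (\<lambda>x. 0)"
  by (rule semi_inner_product_symmetric_form) (auto simp: Linf_const)

sublocale H1: semi_inner_product "H1_space \<Omega>" "bilinear_form \<Omega> (\<lambda>x. mat 1) (\<lambda>x. 0) (\<lambda>x. 1)"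
  by (rule semi_inner_product_symmetric_form) (auto simp: Linf_const)

lemma L2_snorm: "L2.snorm v = sqrt (LINT x|lebesgue_on \<Omega>. (v x)\<^sup>2)"
  by (simp add: L2.snorm_def bilinear_form_def power2_eq_square)

lemma Dir_snorm: "Dir.snorm v = sqrt (LINT x|lebesgue_on \<Omega>. (norm (wgrad \<Omega> v x))\<^sup>2)"
  by (simp add: Dir.snorm_def bilinear_form_def power2_norm_eq_inner)

lemma H1_snorm: "H1.snorm v = H1_norm \<Omega> v"
  by (simp add: H1.snorm_def H1_norm_def bilinear_form_def power2_norm_eq_inner)
    (simp add: power2_eq_square add.commute)

lemma H1_norm_square:
  assumes "v \<in> H1_space \<Omega>"
  shows "(H1_norm \<Omega> v)\<^sup>2 = (L2.snorm v)\<^sup>2 + (Dir.snorm v)\<^sup>2"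
  unfolding H1_snorm[symmetric] L2.snorm_square[OF assms] Dir.snorm_square[OF assms] H1.snorm_square[OF assms]
  by (simp add: bilinear_form_def)

lemma H1_norm_ge:
  assumes "v \<in> H1_space \<Omega>"
  shows "L2.snorm v \<le> H1_norm \<Omega> v" "Dir.snorm v \<le> H1_norm \<Omega> v"
proof -
  have "0 \<le> H1_norm \<Omega> v" using H1.snorm_nonneg[OF assms] by (simp add: H1_snorm)
  then show "L2.snorm v \<le> H1_norm \<Omega> v" "Dir.snorm v \<le> H1_norm \<Omega> v"
    by (rule_tac power2_le_imp_le, simp_all add: H1_norm_square[OF assms])+
qed

lemma H10_H1: "v \<in> H10 \<Omega> \<Longrightarrow> v \<in> H1_space \<Omega>"
  by (simp add: H10_def)

lemma H10_subspace: "function_subspace (H10 \<Omega>)"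
  unfolding function_subspace_def
proof (intro ballI allI)
  fix v w s t assume v: "v \<in> H10 \<Omega>" and w: "w \<in> H10 \<Omega>"
  note v1 = H10_H1[OF v] and w1 = H10_H1[OF w]
  have "\<exists>\<phi>\<in>test_functions \<Omega>. H1_norm \<Omega> (\<lambda>x. (s * v x + t * w x) - \<phi> x) < \<epsilon>" if "0 < \<epsilon>" for \<epsilon>
  proof -
    \<comment> \<open>The summand 1 excludes a zero denominator and makes the final inequality
      strict.\<close>
    define \<delta> where "\<delta> = \<epsilon> / (\<bar>s\<bar> + \<bar>t\<bar> + 1)"
    have \<delta>: "0 < \<delta>" unfolding \<delta>_def using that by (intro divide_pos_pos) auto
    obtain \<phi> where \<phi>: "\<phi> \<in> test_functions \<Omega>" "H1_norm \<Omega> (\<lambda>x. v x - \<phi> x) < \<delta>"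
      using v \<delta> by (auto simp: H10_def)
    obtain \<psi> where \<psi>: "\<psi> \<in> test_functions \<Omega>" "H1_norm \<Omega> (\<lambda>x. w x - \<psi> x) < \<delta>"
      using w \<delta> by (auto simp: H10_def)
    have 1: "(\<lambda>x. v x - \<phi> x) \<in> H1_space \<Omega>" "(\<lambda>x. w x - \<psi> x) \<in> H1_space \<Omega>"
      using function_subspace_diff[OF H1_subspace v1 test_function_H1[OF \<phi>(1)]]
       function_subspace_diff[OF H1_subspace w1 test_function_H1[OF \<psi>(1)]] .
    have "H1_norm \<Omega> (\<lambda>x. s * (v x - \<phi> x) + t * (w x - \<psi> x)) \<le>
      \<bar>s\<bar> * H1_norm \<Omega> (\<lambda>x. v x - \<phi> x) + \<bar>t\<bar> * H1_norm \<Omega> (\<lambda>x. w x - \<psi> x)"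
      using H1.snorm_comb_le[OF 1] by (simp add: H1_snorm)
    also have "\<dots> \<le> \<bar>s\<bar> * \<delta> + \<bar>t\<bar> * \<delta>"
      using \<phi>(2) \<psi>(2) by (intro add_mono mult_left_mono) auto
    also have "\<dots> < (\<bar>s\<bar> + \<bar>t\<bar> + 1) * \<delta>" using \<delta> by (simp add: algebra_simps)
    also have "\<dots> = \<epsilon>" unfolding \<delta>_def by (simp add: add_nonneg_pos[THEN less_imp_neq, symmetric])
    also have "(\<lambda>x. s * (v x - \<phi> x) + t * (w x - \<psi> x)) =
       (\<lambda>x. (s * v x + t * w x) - (s * \<phi> x + t * \<psi> x))" by (simp add: algebra_simps)
    finally show ?thesis by (intro bexI[OF _ test_functions_comb[OF \<phi>(1) \<psi>(1)]])
  qed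
  then show "(\<lambda>x. s * v x + t * w x) \<in> H10 \<Omega>"
    using function_subspaceD[OF H1_subspace v1 w1] by (simp add: H10_def)
qed

end

lemma semi_inner_product_subset:
  assumes "semi_inner_product V B" "W \<subseteq> V" "function_subspace W"
  shows "semi_inner_product W B"
proof -
  interpret semi_inner_product V B by fact
  show ?thesis
  proof
    show "bilinear_on W B" using bilinear assms(2) unfolding bilinear_on_def by blast
  qed (use assms sym nonneg in blast)+
qed

section \<open>Friedrichs' inequality\<close>

context bounded_open_set
begin

text \<open>The integral of \<open>\<partial>\<^sub>i (x\<^sub>i \<phi>\<^sup>2) = \<phi>\<^sup>2 + 2 x\<^sub>i \<phi> \<partial>\<^sub>i \<phi>\<close> vanishes; now use Young's inequality.\<close>

lemma Friedrichs_test_function: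
  assumes \<phi>: "\<phi> \<in> test_functions \<Omega>" and R: "\<Omega> \<subseteq> cball 0 R"
  shows "(LINT x|lebesgue_on \<Omega>. (\<phi> x)\<^sup>2) \<le> 4 * R\<^sup>2 * (LINT x|lebesgue_on \<Omega>. (norm (grad \<phi> x))\<^sup>2)"
proof -
  fix i :: 'd
  obtain S where S: "compact S" "S \<subseteq> \<Omega>" "\<And>x. x \<notin> S \<Longrightarrow> \<phi> x = 0"
    using test_function_support[OF \<phi>] by metis
  have Ck: "Ck (Suc 0) \<phi>" using \<phi> by (rule test_function_Ck)
  note Ck2 = Ck_mult[OF Ck Ck] and Cki = Ck_component[of "Suc 0" i]
  let ?f = "\<lambda>x. x $ i * (\<phi> x * \<phi> x)"
  have "((\<lambda>x. x $ i) has_derivative (\<lambda>h. h $ i)) (at x)" for x :: "real^'d"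
    by (rule bounded_linear_imp_has_derivative) (rule bounded_linear_vec_nth)
  from grad_component[OF this, where i = i] have gi: "grad (\<lambda>x. x $ i) x $ i = 1" for x :: "real^'d"
    by simp
  have grad: "grad ?f x $ i = (\<phi> x)\<^sup>2 + 2 * x $ i * \<phi> x * grad \<phi> x $ i" for x
    using gi unfolding grad_mult[OF Cki Ck2] grad_mult[OF Ck Ck]
    by (simp add: power2_eq_square algebra_simps)
  have int\<phi>: "integrable (lebesgue_on \<Omega>) (\<lambda>x. (\<phi> x)\<^sup>2)"
    using L2_square_integrable[OF test_function_L2(1)[OF \<phi>]] by simp
  have intg: "integrable (lebesgue_on \<Omega>) (\<lambda>x. (norm (grad \<phi> x))\<^sup>2)"
    using L2_square_integrable[OF test_function_L2(2)[OF \<phi>]] .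
  have cf: "continuous_on UNIV (\<lambda>x. grad ?f x $ i)" using Ck_mult[OF Cki Ck2] by simp
  have "grad ?f x = 0" if "x \<notin> S" for x
    by (rule grad_eq_0_outside[OF compact_imp_closed[OF S(1)] _ that]) (simp add: S(3))
  then have g0: "grad ?f x $ i = 0" if "x \<notin> S" for x using that by simp
  obtain M where "\<And>x. \<bar>grad ?f x $ i\<bar> \<le> M"
    using compactly_supported_bounded[OF cf S(1) g0] by blast
  then have intf: "integrable (lebesgue_on \<Omega>) (\<lambda>x. grad ?f x $ i)"
    by (intro integrable_const_bound[where B = M] continuous_measurable[OF cf] AE_I2) simp
  have "(LINT x|lebesgue_on \<Omega>. grad ?f x $ i) = 0"
    by (rule integral_partial_derivative_0_domain[OF Ck_mult[OF Cki Ck2] S(1,2)]) (simp add: S(3))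
  then have "(LINT x|lebesgue_on \<Omega>. (\<phi> x)\<^sup>2) = (LINT x|lebesgue_on \<Omega>. (\<phi> x)\<^sup>2 - grad ?f x $ i)"
    using int\<phi> intf by simp
  also have "\<dots> \<le> (LINT x|lebesgue_on \<Omega>. (\<phi> x)\<^sup>2 / 2 + 2 * R\<^sup>2 * (norm (grad \<phi> x))\<^sup>2)"
  proof (rule integral_mono)
    show "integrable (lebesgue_on \<Omega>) (\<lambda>x. (\<phi> x)\<^sup>2 - grad ?f x $ i)" using int\<phi> intf by simp
    show "integrable (lebesgue_on \<Omega>) (\<lambda>x. (\<phi> x)\<^sup>2 / 2 + 2 * R\<^sup>2 * (norm (grad \<phi> x))\<^sup>2)"
      using int\<phi> intg by simp
    fix x assume "x \<in> space (lebesgue_on \<Omega>)"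
    then have "norm x \<le> R" using R by auto
    then have "\<bar>x $ i * grad \<phi> x $ i\<bar> \<le> R * norm (grad \<phi> x)"
      unfolding abs_mult
      using order_trans[OF component_le_norm_cart[of x i]] component_le_norm_cart[of "grad \<phi> x" i]
      by (intro mult_mono) (auto intro: order_trans[OF norm_ge_zero])
    then have "(x $ i * grad \<phi> x $ i)\<^sup>2 \<le> (R * norm (grad \<phi> x))\<^sup>2"
      by (metis abs_ge_zero power2_abs power_mono)
    \<comment> \<open>With these weights half of \<open>(\<phi> x)\<^sup>2\<close> is left to be
      absorbed on the other side; the doubling this causes turns \<open>2 * R\<^sup>2\<close> into
      \<open>4 * R\<^sup>2\<close>.\<close>
    moreover have "- (2 * x $ i * \<phi> x * grad \<phi> x $ i) \<le> (\<phi> x)\<^sup>2 / 2 + 2 * (x $ i * grad \<phi> x $ i)\<^sup>2"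
      using zero_le_power2[of "\<phi> x + 2 * (x $ i * grad \<phi> x $ i)"]
      by (simp add: power2_eq_square algebra_simps)
    ultimately show "(\<phi> x)\<^sup>2 - grad ?f x $ i \<le> (\<phi> x)\<^sup>2 / 2 + 2 * R\<^sup>2 * (norm (grad \<phi> x))\<^sup>2"
      by (simp add: grad power_mult_distrib)
  qed
  also have "\<dots> = (LINT x|lebesgue_on \<Omega>. (\<phi> x)\<^sup>2) / 2 + 2 * R\<^sup>2 * (LINT x|lebesgue_on \<Omega>. (norm (grad \<phi> x))\<^sup>2)"
    using int\<phi> intg by simp
  finally show ?thesis by simp
qed

text \<open>By density: a test function close in the Sobolev norm changes both sides by little, and
  on test functions weak and classical gradients agree almost everywhere.\<close>

lemma Friedrichs:
  assumes v: "v \<in> H10 \<Omega>" and R: "\<Omega> \<subseteq> cball 0 R" "0 \<le> R"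
  shows "L2.snorm v \<le> 2 * R * Dir.snorm v"
proof (rule field_le_epsilon)
  fix e :: real assume e: "0 < e"
  \<comment> \<open>Passing to the test function costs \<open>\<delta>\<close> on the left and
    \<open>2 * R * \<delta>\<close> on the right.\<close>
  define \<delta> where "\<delta> = e / (1 + 2 * R)"
  have \<delta>: "0 < \<delta>" "\<delta> * (1 + 2 * R) = e" using e R by (auto simp: \<delta>_def)
  obtain \<phi> where \<phi>: "\<phi> \<in> test_functions \<Omega>" "H1_norm \<Omega> (\<lambda>x. v x - \<phi> x) < \<delta>"
    using v \<delta>(1) by (auto simp: H10_def)
  note v1 = H10_H1[OF v] and \<phi>1 = test_function_H1[OF \<phi>(1)]
  let ?d = "\<lambda>x. v x - \<phi> x"
  have d1: "?d \<in> H1_space \<Omega>" using function_subspace_diff[OF H1_subspace v1 \<phi>1] .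
  have "(LINT x|lebesgue_on \<Omega>. (norm (wgrad \<Omega> \<phi> x))\<^sup>2)
    = (LINT x|lebesgue_on \<Omega>. (norm (grad \<phi> x))\<^sup>2)"
    using L2_square_integrable[OF wgrad(1)[OF \<phi>1]] L2_square_integrable[OF test_function_L2(2)[OF \<phi>(1)]]
      wgrad_test_function[OF \<phi>(1)]
    by (intro integral_cong_AE borel_measurable_integrable) (auto elim!: eventually_mono)
  then have "L2.snorm \<phi> \<le> sqrt (4 * R\<^sup>2 * (LINT x|lebesgue_on \<Omega>. (norm (wgrad \<Omega> \<phi> x))\<^sup>2))"
    using Friedrichs_test_function[OF \<phi>(1) R(1)] unfolding L2_snorm by simp
  also have "\<dots> = 2 * R * Dir.snorm \<phi>"
    using R(2) unfolding Dir_snorm by (simp add: real_sqrt_mult)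
  finally have "L2.snorm \<phi> \<le> 2 * R * Dir.snorm \<phi>" .
  moreover have "L2.snorm v \<le> L2.snorm ?d + L2.snorm \<phi>"
    using L2.snorm_comb_le[OF d1 \<phi>1, of 1 1] by simp
  moreover have "Dir.snorm \<phi> \<le> Dir.snorm v + Dir.snorm ?d"
    using Dir.snorm_comb_le[OF v1 d1, of 1 "-1"] by simp
  then have "2 * R * Dir.snorm \<phi> \<le> 2 * R * (Dir.snorm v + Dir.snorm ?d)"
    using R(2) by (intro mult_left_mono) auto
  moreover have "L2.snorm ?d \<le> \<delta>" "Dir.snorm ?d \<le> \<delta>" using H1_norm_ge[OF d1] \<phi>(2) by auto
  then have "L2.snorm ?d + 2 * R * Dir.snorm ?d \<le> \<delta> * (1 + 2 * R)"
    using mult_left_mono[of "Dir.snorm ?d" \<delta> "2 * R"] R(2) by (simp add: algebra_simps)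
  ultimately show "L2.snorm v \<le> 2 * R * Dir.snorm v + e" using \<delta>(2) by (simp add: distrib_left)
qed

lemma H1_norm_le_Dir:
  obtains C where "0 < C" "\<And>v. v \<in> H10 \<Omega> \<Longrightarrow> H1_norm \<Omega> v \<le> C * Dir.snorm v"
proof -
  obtain R where R: "0 < R" "\<Omega> \<subseteq> ball 0 R" using bounded_subset_ballD[OF bounded_domain] by blast
  then have R': "\<Omega> \<subseteq> cball 0 R" using ball_subset_cball by blast
  show ?thesis
  proof
    show "0 < 2 * R + 1" using R by simp
    fix v assume v: "v \<in> H10 \<Omega>"
    note v1 = H10_H1[OF v]
    have "H1_norm \<Omega> v = sqrt ((L2.snorm v)\<^sup>2 + (Dir.snorm v)\<^sup>2)"
      using H1_norm_square[OF v1] H1.snorm_nonneg[OF v1]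
        by (metis H1_snorm real_sqrt_abs abs_of_nonneg)
    also have "\<dots> \<le> L2.snorm v + Dir.snorm v"
      using sqrt_sum_squares_le_sum[OF L2.snorm_nonneg[OF v1] Dir.snorm_nonneg[OF v1]] .
    also have "\<dots> \<le> (2 * R + 1) * Dir.snorm v"
      using Friedrichs[OF v R'] R by (simp add: algebra_simps)
    finally show "H1_norm \<Omega> v \<le> (2 * R + 1) * Dir.snorm v" .
  qed
qed

end

section \<open>The elliptic problem\<close>

locale elliptic_problem = bounded_open_set \<Omega> for \<Omega> :: "(real^'d) set" +
  fixes A :: "real^'d \<Rightarrow> real^'d^'d" and b :: "real^'d \<Rightarrow> real^'d" and c :: "real^'d \<Rightarrow> real"
  assumes admissible: "admissible_coefficients \<Omega> A b c"
begin

lemma coefficients_Linf: "A \<in> Linf_space \<Omega>" "b \<in> Linf_space \<Omega>" "c \<in> Linf_space \<Omega>"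
  using admissible by (auto simp: admissible_coefficients_def)

sublocale energy: semi_inner_product "H1_space \<Omega>" "bilinear_form \<Omega> A (\<lambda>x. 0) (\<lambda>x. 0)"
proof (rule semi_inner_product_symmetric_form[OF coefficients_Linf(1) Linf_const])
  show "AE x in lebesgue_on \<Omega>. transpose (A x) = A x"
    using admissible by (simp add: admissible_coefficients_def AE_domain_iff)
  obtain \<alpha> where \<alpha>: "0 < \<alpha>" "AE x in lebesgue_on \<Omega>. \<forall>\<xi>. \<alpha> * (norm \<xi>)\<^sup>2 \<le> (A x *v \<xi>) \<bullet> \<xi>"
    using admissible by (auto simp: admissible_coefficients_def AE_domain_iff)
  show "AE x in lebesgue_on \<Omega>. (\<forall>\<xi>. 0 \<le> (A x *v \<xi>) \<bullet> \<xi>) \<and> (0::real) \<le> 0"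
    using \<alpha>(2)
  proof eventually_elim
    case (elim x)
    have "0 \<le> \<alpha> * (norm \<xi>)\<^sup>2" for \<xi> :: "real^'d" using \<alpha>(1) by simp
    with elim show ?case using order_trans by blast
  qed
qed

lemma energy_snorm: "energy.snorm v = energy_norm \<Omega> A v"
  by (simp add: energy.snorm_def energy_norm_def bilinear_form_def)

lemma Dir_le_energy:
  obtains C where "0 < C" "\<And>v. v \<in> H1_space \<Omega> \<Longrightarrow> Dir.snorm v \<le> C * energy_norm \<Omega> A v"
proof -
  obtain \<alpha> where \<alpha>: "0 < \<alpha>" "AE x in lebesgue_on \<Omega>. \<forall>\<xi>. \<alpha> * (norm \<xi>)\<^sup>2 \<le> (A x *v \<xi>) \<bullet> \<xi>"
    using admissible by (auto simp: admissible_coefficients_def AE_domain_iff)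
  show ?thesis
  proof
    show "0 < 1 / sqrt \<alpha>" using \<alpha> by simp
    fix v assume v: "v \<in> H1_space \<Omega>"
    have "\<alpha> * (LINT x|lebesgue_on \<Omega>. (norm (wgrad \<Omega> v x))\<^sup>2)
      = (LINT x|lebesgue_on \<Omega>. \<alpha> * (norm (wgrad \<Omega> v x))\<^sup>2)"
      by simp
    also have "\<dots> \<le> (LINT x|lebesgue_on \<Omega>. (A x *v wgrad \<Omega> v x) \<bullet> wgrad \<Omega> v x)"
    proof (rule integral_mono_AE)
      show "integrable (lebesgue_on \<Omega>) (\<lambda>x. \<alpha> * (norm (wgrad \<Omega> v x))\<^sup>2)"
        using L2_square_integrable[OF wgrad(1)[OF v]] by simp
      show "integrable (lebesgue_on \<Omega>) (\<lambda>x. (A x *v wgrad \<Omega> v x) \<bullet> wgrad \<Omega> v x)"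
        using bilinear_form_integrable(1)[OF coefficients_Linf v v] .
      show "AE x in lebesgue_on \<Omega>. \<alpha> * (norm (wgrad \<Omega> v x))\<^sup>2 \<le> (A x *v wgrad \<Omega> v x) \<bullet> wgrad \<Omega> v x"
        using \<alpha>(2) by eventually_elim blast
    qed
    finally have "sqrt (\<alpha> * (LINT x|lebesgue_on \<Omega>. (norm (wgrad \<Omega> v x))\<^sup>2)) \<le> energy_norm \<Omega> A v"
      unfolding energy_norm_def by (rule real_sqrt_le_mono)
    then have "sqrt \<alpha> * Dir.snorm v \<le> energy_norm \<Omega> A v"
      unfolding Dir_snorm by (simp add: real_sqrt_mult)
    then show "Dir.snorm v \<le> 1 / sqrt \<alpha> * energy_norm \<Omega> A v" using \<alpha>(1) by (simp add: field_simps)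
  qed
qed

lemma H1_norm_le_energy:
  obtains C where "0 < C" "\<And>v. v \<in> H10 \<Omega> \<Longrightarrow> H1_norm \<Omega> v \<le> C * energy_norm \<Omega> A v"
proof -
  obtain C1 where C1: "0 < C1" "\<And>v. v \<in> H10 \<Omega> \<Longrightarrow> H1_norm \<Omega> v \<le> C1 * Dir.snorm v"
    using H1_norm_le_Dir by blast
  obtain C2 where C2: "0 < C2" "\<And>v. v \<in> H1_space \<Omega> \<Longrightarrow> Dir.snorm v \<le> C2 * energy_norm \<Omega> A v"
    using Dir_le_energy by blast
  have "H1_norm \<Omega> v \<le> C1 * C2 * energy_norm \<Omega> A v" if "v \<in> H10 \<Omega>" for v
    using order_trans[OF C1(2)[OF that] mult_left_mono[OF C2(2)[OF H10_H1[OF that]] less_imp_le[OF C1(1)]]]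
    by (simp add: mult.assoc)
  with C1(1) C2(1) show ?thesis by (intro that[of "C1 * C2"]) simp_all
qed

lemma energy_le_H1_norm:
  obtains C where "0 < C" "\<And>v. v \<in> H1_space \<Omega> \<Longrightarrow> energy_norm \<Omega> A v \<le> C * H1_norm \<Omega> v"
proof -
  obtain C where C: "AE x in lebesgue_on \<Omega>. norm (A x) \<le> C"
    using coefficients_Linf(1) by (auto simp: Linf_space_def AE_domain_iff)
  define D where "D = real CARD('d) * \<bar>C\<bar>"
  have D: "0 \<le> D" by (simp add: D_def)
  show ?thesis
  proof
    \<comment> \<open>The essential bound \<open>C\<close> may be 0, and then so is
      \<open>D\<close>; hence the summand 1.\<close>
    show "0 < sqrt D + 1" using D by (simp add: add_nonneg_pos)
    fix v assume v: "v \<in> H1_space \<Omega>"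
    have "(LINT x|lebesgue_on \<Omega>. (A x *v wgrad \<Omega> v x) \<bullet> wgrad \<Omega> v x)
      \<le> (LINT x|lebesgue_on \<Omega>. D * (norm (wgrad \<Omega> v x))\<^sup>2)"
    proof (rule integral_mono_AE)
      show "integrable (lebesgue_on \<Omega>) (\<lambda>x. D * (norm (wgrad \<Omega> v x))\<^sup>2)"
        using L2_square_integrable[OF wgrad(1)[OF v]] by simp
      show "integrable (lebesgue_on \<Omega>) (\<lambda>x. (A x *v wgrad \<Omega> v x) \<bullet> wgrad \<Omega> v x)"
        using bilinear_form_integrable(1)[OF coefficients_Linf v v] .
      show "AE x in lebesgue_on \<Omega>. (A x *v wgrad \<Omega> v x) \<bullet> wgrad \<Omega> v x \<le> D * (norm (wgrad \<Omega> v x))\<^sup>2"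
        using C
      proof eventually_elim
        case (elim x)
        let ?g = "wgrad \<Omega> v x"
        have "(A x *v ?g) \<bullet> ?g \<le> norm (A x *v ?g) * norm ?g" by (rule norm_cauchy_schwarz)
        also have "\<dots> \<le> (real CARD('d) * norm (A x) * norm ?g) * norm ?g"
          by (intro mult_right_mono norm_matrix_vector_mult_le) simp
        also have "\<dots> \<le> (D * norm ?g) * norm ?g"
          unfolding D_def using elim by (intro mult_right_mono mult_left_mono) auto
        finally show ?case by (simp add: power2_eq_square mult.assoc)
      qed
    qed
    then have "energy_norm \<Omega> A v \<le> sqrt (D * (LINT x|lebesgue_on \<Omega>. (norm (wgrad \<Omega> v x))\<^sup>2))"
      unfolding energy_norm_def by simp
    also have "\<dots> = sqrt D * Dir.snorm v" unfolding Dir_snorm by (simp add: real_sqrt_mult)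
    also have "\<dots> \<le> (sqrt D + 1) * H1_norm \<Omega> v"
      using H1_norm_ge(2)[OF v] D Dir.snorm_nonneg[OF v] by (intro mult_mono) auto
    finally show "energy_norm \<Omega> A v \<le> (sqrt D + 1) * H1_norm \<Omega> v" .
  qed
qed

text \<open>Continuity and ellipticity of the form are available on \<open>H10 \<Omega>\<close>
  only, so the abstract Galerkin theory is instantiated with this restriction.\<close>

sublocale H10: semi_inner_product "H10 \<Omega>" "bilinear_form \<Omega> (\<lambda>x. mat 1) (\<lambda>x. 0) (\<lambda>x. 1)"
  by (rule semi_inner_product_subset[OF H1.semi_inner_product_axioms _ H10_subspace]) (use H10_H1 in blast)

lemma H10_snorm: "H10.snorm v = H1_norm \<Omega> v"
  using H1_snorm by (simp add: H10.snorm_def H1.snorm_def)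

lemma form_bilinear: "bilinear_on (H10 \<Omega>) (bilinear_form \<Omega> A b c)"
  using bilinear_form_bilinear[OF coefficients_Linf] H10_H1 unfolding bilinear_on_def by blast

end

section \<open>Error estimators and the goal functional\<close>

text \<open>Once the perturbations are small, the recursion contracts towards a small fixed point
  and forgets its starting value geometrically.\<close>

lemma perturbed_contraction_tendsto_0:
  fixes s e :: "nat \<Rightarrow> real"
  assumes step: "\<And>n. s (Suc n) \<le> k * s n + e n" and k: "0 \<le> k" "k < 1"
    and s: "\<And>n. 0 \<le> s n" and e: "e \<longlonglongrightarrow> 0"
  shows "s \<longlonglongrightarrow> 0"
proof (rule LIMSEQ_I)
  fix r :: real assume r: "0 < r"
  \<comment> \<open>With this \<open>\<delta>\<close> the map
    \<open>x \<mapsto> k * x + \<delta>\<close> has the fixed point \<open>r / 2\<close>.\<close>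
  define \<delta> where "\<delta> = r / 2 * (1 - k)"
  have "0 < \<delta>" using r k by (simp add: \<delta>_def)
  then have "eventually (\<lambda>n. e n < \<delta>) sequentially" using e by (rule order_tendstoD(2)[rotated])
  then obtain N where N: "\<And>n. n \<ge> N \<Longrightarrow> e n < \<delta>" by (auto simp: eventually_sequentially)
  have bound: "s (N + m) \<le> k ^ m * s N + r / 2" for m
  proof (induction m)
    case (Suc m)
    have "s (N + Suc m) \<le> k * s (N + m) + e (N + m)" using step[of "N + m"] by simp
    also have "\<dots> \<le> k * (k ^ m * s N + r / 2) + \<delta>"
      using Suc k N[of "N + m"] by (intro add_mono mult_left_mono) auto
    also have "\<dots> = k ^ Suc m * s N + r / 2" by (simp add: \<delta>_def field_simps)
    finally show ?case .
  qed (use r in simp)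
  have "(\<lambda>m. k ^ m * s N) \<longlonglongrightarrow> 0 * s N"
    using k by (intro tendsto_mult LIMSEQ_realpow_zero tendsto_const) auto
  then have "eventually (\<lambda>m. k ^ m * s N < r / 2) sequentially"
    using r by (intro order_tendstoD(2)) auto
  then obtain M where M: "\<And>m. m \<ge> M \<Longrightarrow> k ^ m * s N < r / 2" by (auto simp: eventually_sequentially)
  show "\<exists>no. \<forall>n\<ge>no. norm (s n - 0) < r"
  proof (intro exI allI impI)
    fix n assume "n \<ge> N + M"
    then have "n = N + (n - N)" "M \<le> n - N" by auto
    then show "norm (s n - 0) < r" using bound[of "n - N"] M[of "n - N"] s[of n] by simp
  qed
qed

lemma polynomial_of_degree_le_comb:
  assumes "polynomial_of_degree_le p q" "polynomial_of_degree_le p r"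
  shows "polynomial_of_degree_le p (\<lambda>x. s * q x + t * r x)"
proof -
  obtain a b where a: "q = (\<lambda>x. \<Sum>\<alpha> | (\<Sum>i\<in>UNIV. \<alpha> i) \<le> p. a \<alpha> * (\<Prod>i\<in>UNIV. x $ i ^ \<alpha> i))"
    and b: "r = (\<lambda>x. \<Sum>\<alpha> | (\<Sum>i\<in>UNIV. \<alpha> i) \<le> p. b \<alpha> * (\<Prod>i\<in>UNIV. x $ i ^ \<alpha> i))"
    using assms unfolding polynomial_of_degree_le_def by blast
  show ?thesis unfolding polynomial_of_degree_le_def
    by (rule exI[of _ "\<lambda>\<alpha>. s * a \<alpha> + t * b \<alpha>"])
      (simp add: a b sum.distrib distrib_right sum_distrib_left mult.assoc)
qed

lemma refinements_trans:
  "\<R> \<in> refinements refine \<S> \<Longrightarrow> \<S> \<in> refinements refine \<T> \<Longrightarrow> \<R> \<in> refinements refine \<T>"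
  by (induction rule: refinements.induct) (auto intro: refinements.intros)

lemma refinement_strategy_finite:
  assumes "refinement_strategy \<Omega> refine \<T>0" "\<T> \<in> refinements refine \<T>0"
  shows "finite \<T>"
  using assms(2,1)
  by (cases rule: refinements.cases) (auto simp: refinement_strategy_def triangulation_of_def triangulation_def)

lemma estimator_on_square: "(estimator_on \<eta> \<T> \<U> v)\<^sup>2 = (\<Sum>T\<in>\<U>. (\<eta> \<T> T v)\<^sup>2)"
  by (simp add: estimator_on_def sum_nonneg)

lemma estimator_on_nonneg: "0 \<le> estimator_on \<eta> \<T> \<U> v"
  by (simp add: estimator_on_def sum_nonneg)

lemma estimator_on_split:
  assumes "finite \<T>"
  shows "(estimator \<eta> \<T> v)\<^sup>2 = (estimator_on \<eta> \<T> (\<T> - \<S>) v)\<^sup>2 + (estimator_on \<eta> \<T> (\<S> \<inter> \<T>) v)\<^sup>2"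
  unfolding estimator_on_square
  using sum.subset_diff[of "\<S> \<inter> \<T>" \<T> "\<lambda>T. (\<eta> \<T> T v)\<^sup>2"] assms by (simp add: Diff_Int2 Diff_Int)

lemma estimator_on_mono:
  "finite \<U> \<Longrightarrow> \<M> \<subseteq> \<U> \<Longrightarrow> (estimator_on \<eta> \<T> \<M> v)\<^sup>2 \<le> (estimator_on \<eta> \<T> \<U> v)\<^sup>2"
  unfolding estimator_on_square by (rule sum_mono2) auto

text \<open>Common elements contribute equally on both meshes, and the new elements at most
  \<open>q\<^sup>2\<close> times what the removed ones did. So the share
  \<open>1 - q\<^sup>2\<close> of the removed part, which contains the marked part, is
  gained.\<close>

lemma estimator_reduction_step:
  assumes "finite \<S>" "finite \<T>" "\<M> \<subseteq> \<T> - \<S>" "0 \<le> q" "q \<le> 1"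
    and stab: "estimator_on \<eta> \<S> (\<S> \<inter> \<T>) v = estimator_on \<eta> \<T> (\<S> \<inter> \<T>) v"
    and red: "estimator_on \<eta> \<S> (\<S> - \<T>) v \<le> q * estimator_on \<eta> \<T> (\<T> - \<S>) v"
  shows "(estimator \<eta> \<S> v)\<^sup>2 \<le> (estimator \<eta> \<T> v)\<^sup>2 - (1 - q\<^sup>2) * (estimator_on \<eta> \<T> \<M> v)\<^sup>2"
proof -
  have "(estimator_on \<eta> \<S> (\<S> - \<T>) v)\<^sup>2 \<le> q\<^sup>2 * (estimator_on \<eta> \<T> (\<T> - \<S>) v)\<^sup>2"
    using power_mono[OF red estimator_on_nonneg, of 2] by (simp add: power_mult_distrib)
  moreover have "(1 - q\<^sup>2) * (estimator_on \<eta> \<T> \<M> v)\<^sup>2 \<le> (1 - q\<^sup>2) * (estimator_on \<eta> \<T> (\<T> - \<S>) v)\<^sup>2"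
    using assms(2-5) by (intro mult_left_mono estimator_on_mono) (auto simp: power_le_one)
  ultimately show ?thesis
    using estimator_on_split[OF assms(1), of \<eta> v \<T>] estimator_on_split[OF assms(2), of \<eta> v \<S>] stab
    by (simp add: Int_commute algebra_simps)
qed

section \<open>Bounds for the operator, the goal error and the dual solutions\<close>

context elliptic_problem
begin

lemma fe_space_H10: "v \<in> fe_space \<Omega> p \<T> \<Longrightarrow> v \<in> H10 \<Omega>"
  by (simp add: fe_space_def)

lemma fe_space_subspace: "function_subspace (fe_space \<Omega> p \<T>)"
  unfolding function_subspace_def
proof (intro ballI allI)
  fix v w s t assume v: "v \<in> fe_space \<Omega> p \<T>" and w: "w \<in> fe_space \<Omega> p \<T>"
  have "\<exists>q. polynomial_of_degree_le p q \<and> (AE x\<in>T in lebesgue. s * v x + t * w x = q x)" if T: "T \<in> \<T>" for T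
  proof -
    obtain q where q: "polynomial_of_degree_le p q" "AE x\<in>T in lebesgue. v x = q x"
      using v T unfolding fe_space_def by blast
    obtain r where r: "polynomial_of_degree_le p r" "AE x\<in>T in lebesgue. w x = r x"
      using w T unfolding fe_space_def by blast
    have "AE x\<in>T in lebesgue. s * v x + t * w x = s * q x + t * r x"
      using q(2) r(2) by eventually_elim simp
    then show ?thesis using polynomial_of_degree_le_comb[OF q(1) r(1)] by blast
  qed
  then show "(\<lambda>x. s * v x + t * w x) \<in> fe_space \<Omega> p \<T>"
    using function_subspaceD[OF H10_subspace fe_space_H10[OF v] fe_space_H10[OF w]]
      by (simp add: fe_space_def)
qed

lemma H1_norm_nonneg: "v \<in> H10 \<Omega> \<Longrightarrow> 0 \<le> H1_norm \<Omega> v"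
  using H10.snorm_nonneg by (simp add: H10_snorm)

text \<open>Scaling to norm 1 makes \<open>w\<close> a competitor in the supremum. A real supremum
  is informative only for sets bounded above, which membership in \<open>Hminus1 \<Omega>\<close>
  ensures; for norm zero the same bound forces the value 0.\<close>

lemma Hminus1_norm_bound:
  assumes \<Phi>: "\<Phi> \<in> Hminus1 \<Omega>" and w: "w \<in> H10 \<Omega>"
  shows "\<bar>\<Phi> w\<bar> \<le> Hminus1_norm \<Omega> \<Phi> * H1_norm \<Omega> w"
proof -
  obtain C where C: "\<And>v. v \<in> H10 \<Omega> \<Longrightarrow> \<bar>\<Phi> v\<bar> \<le> C * H1_norm \<Omega> v"
    using \<Phi> unfolding Hminus1_def by blast
  show ?thesis
  proof (cases "H1_norm \<Omega> w = 0")
    case True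
    then show ?thesis using C[OF w] by simp
  next
    case False
    define r where "r = H1_norm \<Omega> w"
    have r: "0 < r" using False H1_norm_nonneg[OF w] by (simp add: r_def)
    let ?w = "\<lambda>x. 1 / r * w x"
    have w': "?w \<in> H10 \<Omega>" using function_subspaceD[OF H10_subspace w w, of "1 / r" 0] by simp
    have "H1_norm \<Omega> ?w = 1" using H10.snorm_scale[OF w, of "1 / r"] r by (simp add: H10_snorm r_def)
    have bdd: "bdd_above ((\<lambda>v. \<bar>\<Phi> v\<bar>) ` {v \<in> H10 \<Omega>. H1_norm \<Omega> v \<le> 1})"
    proof (rule bdd_aboveI2)
      fix v assume v: "v \<in> {v \<in> H10 \<Omega>. H1_norm \<Omega> v \<le> 1}"
      have "C * H1_norm \<Omega> v \<le> \<bar>C\<bar> * 1"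
        using v H1_norm_nonneg by (intro mult_mono) auto
      then show "\<bar>\<Phi> v\<bar> \<le> \<bar>C\<bar>" using C[of v] v by simp
    qed
    have "\<bar>\<Phi> ?w\<bar> \<le> Hminus1_norm \<Omega> \<Phi>"
      unfolding Hminus1_norm_def using w' \<open>H1_norm \<Omega> ?w = 1\<close> by (intro cSUP_upper[OF _ bdd]) auto
    moreover have "\<Phi> (\<lambda>x. 1 / r * w x + 0 * w x) = 1 / r * \<Phi> w + 0 * \<Phi> w"
      using \<Phi> w unfolding Hminus1_def by blast
    ultimately have "\<bar>\<Phi> w\<bar> / r \<le> Hminus1_norm \<Omega> \<Phi>" using r by (simp add: abs_mult)
    then show ?thesis using r by (simp add: r_def[symmetric] divide_le_eq)
  qed
qed

lemma operator_bilinear: "bounded_linear_operator \<Omega> K \<Longrightarrow> bilinear_on (H10 \<Omega>) K"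
  unfolding bounded_linear_operator_def bilinear_on_def Hminus1_def by blast

text \<open>The scaling of \<open>Hminus1_norm_bound\<close> once more, now in the first argument.
  The absolute value lets \<open>CK\<close> be an arbitrary real that is fixed before
  \<open>K\<close>.\<close>

lemma operator_bound:
  assumes K: "bounded_linear_operator \<Omega> K" "operator_norm \<Omega> K \<le> CK"
    and v: "v \<in> H10 \<Omega>" and w: "w \<in> H10 \<Omega>"
  shows "\<bar>K v w\<bar> \<le> \<bar>CK\<bar> * H1_norm \<Omega> v * H1_norm \<Omega> w"
proof -
  obtain C where C: "\<And>v. v \<in> H10 \<Omega> \<Longrightarrow> Hminus1_norm \<Omega> (K v) \<le> C * H1_norm \<Omega> v"
    using K(1) unfolding bounded_linear_operator_def by blast
  have Km: "K v \<in> Hminus1 \<Omega>" if "v \<in> H10 \<Omega>" for v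
    using K(1) that unfolding bounded_linear_operator_def by blast
  note w0 = H1_norm_nonneg[OF w]
  show ?thesis
  proof (cases "H1_norm \<Omega> v = 0")
    case True
    then have "Hminus1_norm \<Omega> (K v) * H1_norm \<Omega> w \<le> 0 * H1_norm \<Omega> w"
      using C[OF v] w0 by (intro mult_right_mono) auto
    then show ?thesis using Hminus1_norm_bound[OF Km[OF v] w] True by simp
  next
    case False
    define r where "r = H1_norm \<Omega> v"
    have r: "0 < r" using False H1_norm_nonneg[OF v] by (simp add: r_def)
    let ?v = "\<lambda>x. 1 / r * v x"
    have v': "?v \<in> H10 \<Omega>" using function_subspaceD[OF H10_subspace v v, of "1 / r" 0] by simp
    have v1: "H1_norm \<Omega> ?v = 1" using H10.snorm_scale[OF v, of "1 / r"] r by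
      (simp add: H10_snorm r_def)
    have bdd: "bdd_above ((\<lambda>v. Hminus1_norm \<Omega> (K v)) ` {v \<in> H10 \<Omega>. H1_norm \<Omega> v \<le> 1})"
    proof (rule bdd_aboveI2)
      fix v assume v: "v \<in> {v \<in> H10 \<Omega>. H1_norm \<Omega> v \<le> 1}"
      have "C * H1_norm \<Omega> v \<le> \<bar>C\<bar> * 1"
        using v H1_norm_nonneg by (intro mult_mono) auto
      then show "Hminus1_norm \<Omega> (K v) \<le> \<bar>C\<bar>" using C[of v] v by simp
    qed
    have "Hminus1_norm \<Omega> (K ?v) \<le> operator_norm \<Omega> K"
      unfolding operator_norm_def using v' v1 by (intro cSUP_upper[OF _ bdd]) auto
    then have "Hminus1_norm \<Omega> (K ?v) \<le> \<bar>CK\<bar>" using K(2) by linarith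
    then have "\<bar>K ?v w\<bar> \<le> \<bar>CK\<bar> * H1_norm \<Omega> w"
      using Hminus1_norm_bound[OF Km[OF v'] w] mult_right_mono[OF _ w0] order_trans by blast
    moreover have "K (\<lambda>x. 1 / r * v x + 0 * v x) w = 1 / r * K v w + 0 * K v w"
      using K(1) v w unfolding bounded_linear_operator_def by blast
    ultimately have "\<bar>K v w\<bar> / r \<le> \<bar>CK\<bar> * H1_norm \<Omega> w" using r by (simp add: abs_mult)
    then show ?thesis using r by (simp add: r_def[symmetric] divide_le_eq ac_simps)
  qed
qed

text \<open>The right-hand side of the dual problem is the linearisation of the goal functional at
  \<open>uh\<close>, and the remainder \<open>K ?e ?e\<close> is of second order. Subtracting
  \<open>zh\<close> from \<open>z\<close> is free by Galerkin orthogonality and makes the linear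
  part a product of two errors as well.\<close>

lemma goal_error_bound:
  assumes K: "bounded_linear_operator \<Omega> K" "operator_norm \<Omega> K \<le> CK"
    and a: "\<And>v w. v \<in> H10 \<Omega> \<Longrightarrow> w \<in> H10 \<Omega> \<Longrightarrow> \<bar>bilinear_form \<Omega> A b c v w\<bar> \<le> Ca * H1_norm \<Omega> v * H1_norm \<Omega> w"
    and X: "X \<subseteq> H10 \<Omega>"
    and u: "primal_solution \<Omega> A b c f g (H10 \<Omega>) u" and uh: "primal_solution \<Omega> A b c f g X uh"
    and z: "dual_solution \<Omega> A b c K (H10 \<Omega>) uh z" and zh: "dual_solution \<Omega> A b c K X uh zh"
  shows "\<bar>goal_functional K u - goal_functional K uh\<bar> \<le>
    Ca * H1_norm \<Omega> (\<lambda>x. u x - uh x) * H1_norm \<Omega> (\<lambda>x. z x - zh x) + \<bar>CK\<bar> * (H1_norm \<Omega> (\<lambda>x. u x - uh x))\<^sup>2"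
proof -
  let ?a = "bilinear_form \<Omega> A b c" and ?e = "\<lambda>x. u x - uh x" and ?d = "\<lambda>x. z x - zh x"
  have V: "u \<in> H10 \<Omega>" "uh \<in> H10 \<Omega>" "z \<in> H10 \<Omega>" "zh \<in> H10 \<Omega>" "zh \<in> X"
    using u uh z zh X unfolding primal_solution_def dual_solution_def by blast+
  have e: "?e \<in> H10 \<Omega>" and d: "?d \<in> H10 \<Omega>"
    using V by (auto intro: function_subspace_diff[OF H10_subspace])
  note aD = bilinear_on_diff[OF form_bilinear] and KD = bilinear_on_diff[OF operator_bilinear[OF K(1)]]
  \<comment> \<open>Both primal equations may be tested with \<open>zh\<close>, which lies in
    \<open>X\<close>.\<close>
  have "?a ?e zh = 0"
    using aD(1)[OF V(1,2,4)] u uh V(4,5) unfolding primal_solution_def by simp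
  moreover have "?a ?e z = K ?e uh + K uh ?e" using z e unfolding dual_solution_def by blast
  ultimately have "?a ?e ?d = K ?e uh + K uh ?e" using aD(2)[OF V(3,4) e] by simp
  moreover have "K ?e ?e = K u u - K u uh - K uh u + K uh uh"
    using KD(2)[OF V(1,2) e] KD(1)[OF V(1,2) V(1)] KD(1)[OF V(1,2) V(2)] by simp
  moreover have "K ?e uh = K u uh - K uh uh" "K uh ?e = K uh u - K uh uh"
    using KD(1)[OF V(1,2) V(2)] KD(2)[OF V(1,2) V(2)] by simp_all
  ultimately have "goal_functional K u - goal_functional K uh = ?a ?e ?d + K ?e ?e"
    by (simp add: goal_functional_def)
  then show ?thesis
    using a[OF e d] operator_bound[OF K e e] by (simp add: power2_eq_square mult.assoc)
qed

text \<open>Test the difference of the two dual equations with the difference of the solutions; the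
  two summands on the right give the factor 2. The constant is free of \<open>X\<close>, hence
  uniform over all levels.\<close>

lemma dual_solution_stable:
  assumes K: "bounded_linear_operator \<Omega> K" "operator_norm \<Omega> K \<le> CK"
    and ell: "\<And>v. v \<in> H10 \<Omega> \<Longrightarrow> ce * (H1_norm \<Omega> v)\<^sup>2 \<le> bilinear_form \<Omega> A b c v v" "0 < ce"
    and X: "X \<subseteq> H10 \<Omega>" "function_subspace X" and w: "w1 \<in> H10 \<Omega>" "w2 \<in> H10 \<Omega>"
    and z: "dual_solution \<Omega> A b c K X w1 z1" "dual_solution \<Omega> A b c K X w2 z2"
  shows "H1_norm \<Omega> (\<lambda>x. z1 x - z2 x) \<le> 2 * \<bar>CK\<bar> / ce * H1_norm \<Omega> (\<lambda>x. w1 x - w2 x)"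
proof -
  let ?a = "bilinear_form \<Omega> A b c" and ?d = "\<lambda>x. z1 x - z2 x" and ?e = "\<lambda>x. w1 x - w2 x"
  have zX: "z1 \<in> X" "z2 \<in> X" using z by (auto simp: dual_solution_def)
  then have dX: "?d \<in> X" by (rule function_subspace_diff[OF X(2)])
  have H: "z1 \<in> H10 \<Omega>" "z2 \<in> H10 \<Omega>" "?d \<in> H10 \<Omega>" using zX dX X(1) by blast+
  have e: "?e \<in> H10 \<Omega>" using w by (rule function_subspace_diff[OF H10_subspace])
  note KD = bilinear_on_diff[OF operator_bilinear[OF K(1)]]
  have "ce * (H1_norm \<Omega> ?d)\<^sup>2 \<le> ?a ?d ?d" using ell(1)[OF H(3)] .
  also have "\<dots> = K ?d ?e + K ?e ?d"
    using z dX bilinear_on_diff(2)[OF form_bilinear H(1,2,3)] KD(1)[OF w H(3)] KD(2)[OF w H(3)]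
    unfolding dual_solution_def by simp
  also have "\<dots> \<le> 2 * \<bar>CK\<bar> * H1_norm \<Omega> ?d * H1_norm \<Omega> ?e"
    using operator_bound[OF K H(3) e] operator_bound[OF K e H(3)] by (simp add: ac_simps abs_le_iff)
  finally have *: "ce * (H1_norm \<Omega> ?d)\<^sup>2 \<le> 2 * \<bar>CK\<bar> * H1_norm \<Omega> ?d * H1_norm \<Omega> ?e" .
  show ?thesis
  proof (cases "H1_norm \<Omega> ?d = 0")
    case True
    then show ?thesis using H1_norm_nonneg[OF e] ell(2) by simp
  next
    case False
    then have "0 < H1_norm \<Omega> ?d" using H1_norm_nonneg[OF H(3)] by simp
    moreover have "H1_norm \<Omega> ?d * (ce * H1_norm \<Omega> ?d) \<le> H1_norm \<Omega> ?d * (2 * \<bar>CK\<bar> * H1_norm \<Omega> ?e)"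
      using * by (simp add: power2_eq_square ac_simps)
    ultimately have "ce * H1_norm \<Omega> ?d \<le> 2 * \<bar>CK\<bar> * H1_norm \<Omega> ?e"
      by (rule mult_left_le_imp_le[rotated])
    then show ?thesis using ell(2) by (simp add: field_simps)
  qed
qed

end

lemma algorithm_B_refinements:
  assumes "algorithm_B refine \<T>0 \<eta> \<zeta> uh zh \<theta> Cmark \<T> \<M>"
  shows "\<T> l \<in> refinements refine \<T>0"
  using assms unfolding algorithm_B_def by (induction l) (simp_all add: refinements.intros)

section \<open>Vanishing increments of the discrete solutions\<close>

context elliptic_problem
begin

lemma continuity_ellipticity:
  obtains Ca ce where "0 \<le> Ca" "0 < ce"
    "\<And>v w. v \<in> H10 \<Omega> \<Longrightarrow> w \<in> H10 \<Omega> \<Longrightarrow> \<bar>bilinear_form \<Omega> A b c v w\<bar> \<le> Ca * H1_norm \<Omega> v * H1_norm \<Omega> w"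
    "\<And>v. v \<in> H10 \<Omega> \<Longrightarrow> ce * (H1_norm \<Omega> v)\<^sup>2 \<le> bilinear_form \<Omega> A b c v v"
proof -
  obtain C where C: "\<And>v w. v \<in> H10 \<Omega> \<Longrightarrow> w \<in> H10 \<Omega> \<Longrightarrow>
      \<bar>bilinear_form \<Omega> A b c v w\<bar> \<le> C * H1_norm \<Omega> v * H1_norm \<Omega> w"
    using admissible unfolding admissible_coefficients_def by blast
  obtain ce where ce: "0 < ce" "\<And>v. v \<in> H10 \<Omega> \<Longrightarrow> ce * (H1_norm \<Omega> v)\<^sup>2 \<le> bilinear_form \<Omega> A b c v v"
    using admissible unfolding admissible_coefficients_def by blast
  have "\<bar>bilinear_form \<Omega> A b c v w\<bar> \<le> \<bar>C\<bar> * H1_norm \<Omega> v * H1_norm \<Omega> w"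
    if v: "v \<in> H10 \<Omega>" and w: "w \<in> H10 \<Omega>" for v w
  proof -
    have "C * H1_norm \<Omega> v * H1_norm \<Omega> w \<le> \<bar>C\<bar> * H1_norm \<Omega> v * H1_norm \<Omega> w"
      by (intro mult_right_mono H1_norm_nonneg v w) simp
    then show ?thesis using C[OF v w] by linarith
  qed
  then show ?thesis using that[of "\<bar>C\<bar>" ce] ce by simp
qed

lemma Galerkin_Cauchy:
  assumes "bilinear_on (H10 \<Omega>) a"
    and "\<And>v w. v \<in> H10 \<Omega> \<Longrightarrow> w \<in> H10 \<Omega> \<Longrightarrow> \<bar>a v w\<bar> \<le> Ca * H1_norm \<Omega> v * H1_norm \<Omega> w" "0 \<le> Ca"
    and "\<And>v. v \<in> H10 \<Omega> \<Longrightarrow> ce * (H1_norm \<Omega> v)\<^sup>2 \<le> a v v" "0 < ce"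
    and "\<And>n. X n \<subseteq> H10 \<Omega>" "\<And>n. function_subspace (X n)" "\<And>n. X n \<subseteq> X (Suc n)"
    and "u \<in> H10 \<Omega>" "\<And>n. uh n \<in> X n" "\<And>n v. v \<in> X n \<Longrightarrow> a (uh n) v = a u v" and "0 < e"
  shows "\<exists>n0. \<forall>m\<ge>n0. \<forall>n\<ge>n0. H1_norm \<Omega> (\<lambda>x. uh m x - uh n x) < e"
proof -
  interpret G: galerkin "H10 \<Omega>" "bilinear_form \<Omega> (\<lambda>x. mat 1) (\<lambda>x. 0) (\<lambda>x. 1)" a Ca ce X u uh
    by unfold_locales (use assms H10_snorm in auto)
  show ?thesis using G.uh_Cauchy[OF assms(12)] by (simp add: H10.sdist_def H10_snorm)
qed

lemma H1_norm_diff_triangle: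
  assumes "u \<in> H10 \<Omega>" "v \<in> H10 \<Omega>" "w \<in> H10 \<Omega>"
  shows "H1_norm \<Omega> (\<lambda>x. u x - w x) \<le> H1_norm \<Omega> (\<lambda>x. u x - v x) + H1_norm \<Omega> (\<lambda>x. v x - w x)"
  using H10.sdist_triangle[OF assms] by (simp add: H10.sdist_def H10_snorm)

lemma primal_Cauchy:
  assumes X: "\<And>n. X n \<subseteq> H10 \<Omega>" "\<And>n. function_subspace (X n)" "\<And>n. X n \<subseteq> X (Suc n)"
    and u: "primal_solution \<Omega> A b c f g (H10 \<Omega>) u" and uh: "\<And>n. primal_solution \<Omega> A b c f g (X n) (uh n)"
    and "0 < e"
  shows "\<exists>n0. \<forall>m\<ge>n0. \<forall>n\<ge>n0. H1_norm \<Omega> (\<lambda>x. uh m x - uh n x) < e"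
proof -
  obtain Ca ce where c: "0 \<le> Ca" "0 < ce"
    "\<And>v w. v \<in> H10 \<Omega> \<Longrightarrow> w \<in> H10 \<Omega> \<Longrightarrow> \<bar>bilinear_form \<Omega> A b c v w\<bar> \<le> Ca * H1_norm \<Omega> v * H1_norm \<Omega> w"
    "\<And>v. v \<in> H10 \<Omega> \<Longrightarrow> ce * (H1_norm \<Omega> v)\<^sup>2 \<le> bilinear_form \<Omega> A b c v v"
    using continuity_ellipticity by blast
  show ?thesis
  proof (rule Galerkin_Cauchy[where X = X and u = u and uh = uh, OF form_bilinear c(3) c(1) c(4) c(2) X _ _ _ \<open>0 < e\<close>])
    show "u \<in> H10 \<Omega>" "uh n \<in> X n" for n using u uh[of n] by (auto simp: primal_solution_def)
    show "bilinear_form \<Omega> A b c (uh n) v = bilinear_form \<Omega> A b c u v" if "v \<in> X n" for n v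
      using u uh[of n] that X(1)[of n] unfolding primal_solution_def by (metis subsetD)
  qed
qed

lemma dual_Cauchy:
  assumes X: "\<And>n. X n \<subseteq> H10 \<Omega>" "\<And>n. function_subspace (X n)" "\<And>n. X n \<subseteq> X (Suc n)"
    and z: "dual_solution \<Omega> A b c K (H10 \<Omega>) w z" and zh: "\<And>n. dual_solution \<Omega> A b c K (X n) w (zh n)"
    and "0 < e"
  shows "\<exists>n0. \<forall>m\<ge>n0. \<forall>n\<ge>n0. H1_norm \<Omega> (\<lambda>x. zh m x - zh n x) < e"
proof -
  obtain Ca ce where c: "0 \<le> Ca" "0 < ce"
    "\<And>v w. v \<in> H10 \<Omega> \<Longrightarrow> w \<in> H10 \<Omega> \<Longrightarrow> \<bar>bilinear_form \<Omega> A b c v w\<bar> \<le> Ca * H1_norm \<Omega> v * H1_norm \<Omega> w"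
    "\<And>v. v \<in> H10 \<Omega> \<Longrightarrow> ce * (H1_norm \<Omega> v)\<^sup>2 \<le> bilinear_form \<Omega> A b c v v"
    using continuity_ellipticity by blast
  \<comment> \<open>The dual problem is a primal problem for the transposed form.\<close>
  have bil: "bilinear_on (H10 \<Omega>) (\<lambda>v w. bilinear_form \<Omega> A b c w v)"
    using form_bilinear unfolding bilinear_on_def by blast
  have bdd: "\<bar>bilinear_form \<Omega> A b c w v\<bar> \<le> Ca * H1_norm \<Omega> v * H1_norm \<Omega> w"
    if "v \<in> H10 \<Omega>" "w \<in> H10 \<Omega>" for v w using c(3)[OF that(2,1)] by (simp add: ac_simps)
  show ?thesis
  proof (rule Galerkin_Cauchy[where X = X and u = z and uh = zh, OF bil bdd c(1) c(4) c(2) X _ _ _ \<open>0 < e\<close>])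
    show "z \<in> H10 \<Omega>" "zh n \<in> X n" for n using z zh[of n] by (auto simp: dual_solution_def)
    show "bilinear_form \<Omega> A b c v (zh n) = bilinear_form \<Omega> A b c v z" if "v \<in> X n" for n v
      using z zh[of n] that X(1)[of n] unfolding dual_solution_def by (metis subsetD)
  qed
qed

text \<open>Level and datum vary together, so no single Galerkin sequence is at hand. A detour
  through the datum \<open>uh N\<close> of one late level separates them: stability pays for the
  change of datum, the Cauchy property for the change of level.\<close>

lemma dual_increments_tendsto_0:
  assumes K: "bounded_linear_operator \<Omega> K"
    and X: "\<And>n. X n \<subseteq> H10 \<Omega>" "\<And>n. function_subspace (X n)" "\<And>n. X n \<subseteq> X (Suc n)"
    and z: "\<And>w. w \<in> H10 \<Omega> \<Longrightarrow> dual_solution \<Omega> A b c K (H10 \<Omega>) w (z w)"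
    and zh: "\<And>n w. w \<in> H10 \<Omega> \<Longrightarrow> dual_solution \<Omega> A b c K (X n) w (zh n w)"
    and uh: "\<And>n. uh n \<in> H10 \<Omega>"
    and uh_Cauchy: "\<And>e. 0 < e \<Longrightarrow> \<exists>n0. \<forall>m\<ge>n0. \<forall>n\<ge>n0. H1_norm \<Omega> (\<lambda>x. uh m x - uh n x) < e"
  shows "(\<lambda>n. H1_norm \<Omega> (\<lambda>x. zh (Suc n) (uh (Suc n)) x - zh n (uh n) x)) \<longlonglongrightarrow> 0"
proof (rule LIMSEQ_I)
  fix e :: real assume e: "0 < e"
  obtain Ca ce where c: "0 \<le> Ca" "0 < ce"
    "\<And>v w. v \<in> H10 \<Omega> \<Longrightarrow> w \<in> H10 \<Omega> \<Longrightarrow> \<bar>bilinear_form \<Omega> A b c v w\<bar> \<le> Ca * H1_norm \<Omega> v * H1_norm \<Omega> w"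
    "\<And>v. v \<in> H10 \<Omega> \<Longrightarrow> ce * (H1_norm \<Omega> v)\<^sup>2 \<le> bilinear_form \<Omega> A b c v v"
    using continuity_ellipticity by blast
  define L where "L = 2 * \<bar>operator_norm \<Omega> K\<bar> / ce"
  have L: "0 \<le> L" using c(2) by (simp add: L_def)
  \<comment> \<open>Each change of datum may cost less than a third of \<open>e\<close>; adding 1 to
    \<open>L\<close> avoids a zero denominator and makes \<open>L * \<delta>\<close> strictly
    smaller than that third.\<close>
  define \<delta> where "\<delta> = e / 3 / (L + 1)"
  have \<delta>: "0 < \<delta>" unfolding \<delta>_def using e L by simp
  have "(L + 1) * \<delta> = e / 3" unfolding \<delta>_def using L by (intro nonzero_mult_div_cancel_left[THEN trans[OF times_divide_eq_right]]) simp
  then have L\<delta>: "L * \<delta> < e / 3" using \<delta> by (simp add: algebra_simps)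
  have stable: "H1_norm \<Omega> (\<lambda>x. zh n v x - zh n w x) \<le> L * H1_norm \<Omega> (\<lambda>x. v x - w x)"
    if "v \<in> H10 \<Omega>" "w \<in> H10 \<Omega>" for n v w
    unfolding L_def
    by (rule dual_solution_stable[OF K order_refl c(4) c(2) X(1,2) that zh[OF that(1)] zh[OF that(2)]])
  obtain N where N: "\<And>m n. m \<ge> N \<Longrightarrow> n \<ge> N \<Longrightarrow> H1_norm \<Omega> (\<lambda>x. uh m x - uh n x) < \<delta>"
    using uh_Cauchy[OF \<delta>] by blast
  obtain N' where N': "\<And>m n. m \<ge> N' \<Longrightarrow> n \<ge> N' \<Longrightarrow> H1_norm \<Omega> (\<lambda>x. zh m (uh N) x - zh n (uh N) x) < e / 3"
    using dual_Cauchy[where X = X and zh = "\<lambda>n. zh n (uh N)" and e = "e / 3", OF X z[OF uh] zh[OF uh]] e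
    by (auto simp: zero_less_divide_iff)
  have zV: "zh n (uh m) \<in> H10 \<Omega>" for n m
    using zh[OF uh[of m], of n] X(1)[of n] unfolding dual_solution_def by blast
  show "\<exists>no. \<forall>n\<ge>no. norm (H1_norm \<Omega> (\<lambda>x. zh (Suc n) (uh (Suc n)) x - zh n (uh n) x) - 0) < e"
  proof (intro exI allI impI)
    fix n assume n: "n \<ge> max N N'"
    \<comment> \<open>The detour visits the pairs of level and datum (n+1, n+1), (n+1, N), (n, N),
      (n, n).\<close>
    let ?d = "\<lambda>m k m' k'. H1_norm \<Omega> (\<lambda>x. zh m (uh k) x - zh m' (uh k') x)"
    have "?d (Suc n) (Suc n) (Suc n) N \<le> L * \<delta>" "?d n N n n \<le> L * \<delta>"
      using order_trans[OF stable[OF uh uh] mult_left_mono[OF less_imp_le[OF N] L]] n by auto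
    moreover have "?d (Suc n) N n N < e / 3" using N'[of "Suc n" n] n by simp
    moreover have "?d (Suc n) (Suc n) n n \<le> ?d (Suc n) (Suc n) (Suc n) N + ?d (Suc n) N n n"
      "?d (Suc n) N n n \<le> ?d (Suc n) N n N + ?d n N n n"
      by (rule H1_norm_diff_triangle; rule zV)+
    ultimately have "?d (Suc n) (Suc n) n n < e" using L\<delta> by linarith
    moreover have "0 \<le> ?d (Suc n) (Suc n) n n"
      by (intro H1_norm_nonneg function_subspace_diff[OF H10_subspace] zV)
    ultimately show "norm (?d (Suc n) (Suc n) n n - 0) < e" by simp
  qed
qed

text \<open>The functions \<open>v\<close> and \<open>w\<close> are first carried unchanged to
  \<open>\<S>\<close>, where reduction and marking act, and are then replaced there by
  \<open>v'\<close> and \<open>w'\<close> through stability.\<close>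

lemma estimator_contraction:
  assumes T: "\<T> \<in> refinements refine \<T>0" "finite \<T>" and S: "\<S> \<in> refinements refine \<T>" "finite \<S>"
    and nested: "fe_space \<Omega> p \<T> \<subseteq> fe_space \<Omega> p \<S>" and M: "\<M> \<subseteq> \<T> - \<S>"
    and stab: "stability \<Omega> A p refine \<T>0 \<eta> \<zeta> Cstab" and red: "reduction \<Omega> p refine \<T>0 \<eta> \<zeta> q"
    and q: "0 < q" "q < 1"
    and T_fun: "v \<in> fe_space \<Omega> p \<T>" "w \<in> fe_space \<Omega> p \<T>"
    and S_fun: "v' \<in> fe_space \<Omega> p \<S>" "w' \<in> fe_space \<Omega> p \<S>"
    and mark: "marking_criterion \<eta> \<zeta> \<theta> \<T> v w \<M>"
  shows "sqrt ((estimator \<eta> \<S> v')\<^sup>2 + (estimator \<zeta> \<S> w')\<^sup>2) \<le>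
    sqrt (1 - (1 - q\<^sup>2) * \<theta>) * sqrt ((estimator \<eta> \<T> v)\<^sup>2 + (estimator \<zeta> \<T> w)\<^sup>2) +
    Cstab * (energy_norm \<Omega> A (\<lambda>x. v' x - v x) + energy_norm \<Omega> A (\<lambda>x. w' x - w x))"
proof -
  have S0: "\<S> \<in> refinements refine \<T>0" using refinements_trans[OF S(1) T(1)] .
  have H1: "y \<in> H1_space \<Omega>" if "y \<in> fe_space \<Omega> p \<T>'" for y \<T>' using H10_H1[OF fe_space_H10[OF that]] .
  \<comment> \<open>Stability on a single mesh, regarded as a refinement of itself, with all its
    elements.\<close>
  have stabS: "\<bar>estimator \<eta> \<S> x - estimator \<eta> \<S> y\<bar> + \<bar>estimator \<zeta> \<S> x - estimator \<zeta> \<S> y\<bar>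
      \<le> Cstab * energy_norm \<Omega> A (\<lambda>r. x r - y r)" if "x \<in> fe_space \<Omega> p \<S>"
        "y \<in> fe_space \<Omega> p \<S>" for x y
    using stab S0 refinements.refl that unfolding stability_def by blast
  have stab0: "estimator_on \<eta> \<S> (\<S> \<inter> \<T>) y = estimator_on \<eta> \<T> (\<S> \<inter> \<T>) y \<and>
    estimator_on \<zeta> \<S> (\<S> \<inter> \<T>) y = estimator_on \<zeta> \<T> (\<S> \<inter> \<T>) y" if y: "y \<in> fe_space \<Omega> p \<T>" for y
  proof -
    have "\<bar>estimator_on \<eta> \<S> (\<S> \<inter> \<T>) y - estimator_on \<eta> \<T> (\<S> \<inter> \<T>) y\<bar> +
      \<bar>estimator_on \<zeta> \<S> (\<S> \<inter> \<T>) y - estimator_on \<zeta> \<T> (\<S> \<inter> \<T>) y\<bar>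
      \<le> Cstab * energy_norm \<Omega> A (\<lambda>r. y r - y r)"
      using stab T(1) S(1) y nested unfolding stability_def by blast
    \<comment> \<open>A function compared with itself across two meshes has distance zero, which
      turns the stability estimate into equality on the common elements.\<close>
    moreover have "energy_norm \<Omega> A (\<lambda>r. y r - y r) = 0"
      using energy.snorm_scale[OF H1[OF y], of 0] by (simp add: energy_snorm)
    ultimately have "\<bar>estimator_on \<eta> \<S> (\<S> \<inter> \<T>) y - estimator_on \<eta> \<T> (\<S> \<inter> \<T>) y\<bar> +
      \<bar>estimator_on \<zeta> \<S> (\<S> \<inter> \<T>) y - estimator_on \<zeta> \<T> (\<S> \<inter> \<T>) y\<bar> \<le> 0" by simp
    then show ?thesis by (intro conjI; linarith)
  qed
  have redT: "estimator_on \<eta> \<S> (\<S> - \<T>) y \<le> q * estimator_on \<eta> \<T> (\<T> - \<S>) y \<and>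
    estimator_on \<zeta> \<S> (\<S> - \<T>) y \<le> q * estimator_on \<zeta> \<T> (\<T> - \<S>) y" if "y \<in> fe_space \<Omega> p \<T>" for y
    using red T(1) S(1) that unfolding reduction_def by blast
  define a1 a2 b1 b2 where "a1 = estimator \<eta> \<S> v" and "a2 = estimator \<zeta> \<S> w"
    and "b1 = Cstab * energy_norm \<Omega> A (\<lambda>x. v' x - v x)" and "b2 = Cstab * energy_norm \<Omega> A (\<lambda>x. w' x - w x)"
  have "estimator \<eta> \<S> v' \<le> a1 + b1" "estimator \<zeta> \<S> w' \<le> a2 + b2" "0 \<le> b1" "0 \<le> b2"
    using stabS[of v' v] stabS[of w' w] nested T_fun S_fun unfolding a1_def a2_def b1_def b2_def by force+
  then have "sqrt ((estimator \<eta> \<S> v')\<^sup>2 + (estimator \<zeta> \<S> w')\<^sup>2) \<le> sqrt ((a1 + b1)\<^sup>2 + (a2 + b2)\<^sup>2)"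
    by (intro real_sqrt_le_mono add_mono power_mono estimator_on_nonneg)
  \<comment> \<open>The triangle inequality of the plane separates the change of mesh from the
    change of functions.\<close>
  also have "\<dots> \<le> sqrt (a1\<^sup>2 + a2\<^sup>2) + sqrt (b1\<^sup>2 + b2\<^sup>2)"
    by (rule real_sqrt_sum_squares_triangle_ineq)
  also have "\<dots> \<le> sqrt ((1 - (1 - q\<^sup>2) * \<theta>) * ((estimator \<eta> \<T> v)\<^sup>2 + (estimator \<zeta> \<T> w)\<^sup>2)) + (b1 + b2)"
  proof (intro add_mono real_sqrt_le_mono)
    show "sqrt (b1\<^sup>2 + b2\<^sup>2) \<le> b1 + b2" using \<open>0 \<le> b1\<close> \<open>0 \<le> b2\<close> by (rule sqrt_sum_squares_le_sum)
    have "a1\<^sup>2 \<le> (estimator \<eta> \<T> v)\<^sup>2 - (1 - q\<^sup>2) * (estimator_on \<eta> \<T> \<M> v)\<^sup>2"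
      unfolding a1_def using stab0[OF T_fun(1)] redT[OF T_fun(1)] q
      by (intro estimator_reduction_step[OF S(2) T(2) M]) auto
    moreover have "a2\<^sup>2 \<le> (estimator \<zeta> \<T> w)\<^sup>2 - (1 - q\<^sup>2) * (estimator_on \<zeta> \<T> \<M> w)\<^sup>2"
      unfolding a2_def using stab0[OF T_fun(2)] redT[OF T_fun(2)] q
      by (intro estimator_reduction_step[OF S(2) T(2) M]) auto
    moreover have "(1 - q\<^sup>2) * (\<theta> * ((estimator \<eta> \<T> v)\<^sup>2 + (estimator \<zeta> \<T> w)\<^sup>2))
       \<le> (1 - q\<^sup>2) * ((estimator_on \<eta> \<T> \<M> v)\<^sup>2 + (estimator_on \<zeta> \<T> \<M> w)\<^sup>2)"
      using mark q unfolding marking_criterion_def by (intro mult_left_mono)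
        (auto simp: power_le_one)
    ultimately show "a1\<^sup>2 + a2\<^sup>2 \<le> (1 - (1 - q\<^sup>2) * \<theta>) * ((estimator \<eta> \<T> v)\<^sup>2 + (estimator \<zeta> \<T> w)\<^sup>2)"
      by (simp add: algebra_simps)
  qed
  finally show ?thesis unfolding real_sqrt_mult b1_def b2_def distrib_left[of Cstab] .
qed

text \<open>All data are quantified inside the \<open>obtains\<close> clause, so that the constant
  rests on the form, on \<open>CK\<close> and on \<open>Crel\<close> alone.\<close>

lemma goal_error_estimate:
  fixes CK Crel :: real
  assumes "0 < Crel"
  obtains C where "0 < C" "\<And>K f g p refine \<T>0 u z uh zh \<eta> \<zeta> \<T>.
    bounded_linear_operator \<Omega> K \<Longrightarrow> operator_norm \<Omega> K \<le> CK \<Longrightarrow>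
    primal_solution \<Omega> A b c f g (H10 \<Omega>) u \<Longrightarrow>
    (\<And>w. w \<in> H10 \<Omega> \<Longrightarrow> dual_solution \<Omega> A b c K (H10 \<Omega>) w (z w)) \<Longrightarrow>
    primal_solution \<Omega> A b c f g (fe_space \<Omega> p \<T>) (uh \<T>) \<Longrightarrow>
    (\<And>w. w \<in> H10 \<Omega> \<Longrightarrow> dual_solution \<Omega> A b c K (fe_space \<Omega> p \<T>) w (zh \<T> w)) \<Longrightarrow>
    reliability \<Omega> A refine \<T>0 \<eta> \<zeta> u uh z zh Crel \<Longrightarrow> \<T> \<in> refinements refine \<T>0 \<Longrightarrow>
    \<bar>goal_functional K u - goal_functional K (uh \<T>)\<bar>
      \<le> C * ((estimator \<eta> \<T> (uh \<T>))\<^sup>2 + (estimator \<zeta> \<T> (zh \<T> (uh \<T>)))\<^sup>2)"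
proof -
  obtain Ca ce where c: "0 \<le> Ca" "0 < ce"
    "\<And>v w. v \<in> H10 \<Omega> \<Longrightarrow> w \<in> H10 \<Omega> \<Longrightarrow> \<bar>bilinear_form \<Omega> A b c v w\<bar> \<le> Ca * H1_norm \<Omega> v * H1_norm \<Omega> w"
    "\<And>v. v \<in> H10 \<Omega> \<Longrightarrow> ce * (H1_norm \<Omega> v)\<^sup>2 \<le> bilinear_form \<Omega> A b c v v"
    using continuity_ellipticity by blast
  obtain CE where CE: "0 < CE" "\<And>v. v \<in> H10 \<Omega> \<Longrightarrow> H1_norm \<Omega> v \<le> CE * energy_norm \<Omega> A v"
    using H1_norm_le_energy by blast
  define L where "L = CE * Crel"
  have L: "0 < L" using CE assms by (simp add: L_def)
  show ?thesis
  proof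
    \<comment> \<open>Both \<open>Ca\<close> and \<open>CK\<close> may be 0; the summand 1 keeps the
      constant positive.\<close>
    show "0 < L\<^sup>2 * (Ca + \<bar>CK\<bar>) + 1" using c(1) by (intro add_nonneg_pos mult_nonneg_nonneg) auto
    fix K f g p refine \<T>0 u z uh zh \<eta> \<zeta> \<T>
    assume K: "bounded_linear_operator \<Omega> K" "operator_norm \<Omega> K \<le> CK"
      and u: "primal_solution \<Omega> A b c f g (H10 \<Omega>) u"
      and z: "\<And>w. w \<in> H10 \<Omega> \<Longrightarrow> dual_solution \<Omega> A b c K (H10 \<Omega>) w (z w)"
      and uh: "primal_solution \<Omega> A b c f g (fe_space \<Omega> p \<T>) (uh \<T>)"
      and zh: "\<And>w. w \<in> H10 \<Omega> \<Longrightarrow> dual_solution \<Omega> A b c K (fe_space \<Omega> p \<T>) w (zh \<T> w)"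
      and rel: "reliability \<Omega> A refine \<T>0 \<eta> \<zeta> u uh z zh Crel" and T: "\<T> \<in> refinements refine \<T>0"
    have uhV: "uh \<T> \<in> H10 \<Omega>" using uh fe_space_H10 by (auto simp: primal_solution_def)
    let ?e = "\<lambda>x. u x - uh \<T> x" and ?d = "\<lambda>x. z (uh \<T>) x - zh \<T> (uh \<T>) x"
    define E Z where "E = estimator \<eta> \<T> (uh \<T>)" and "Z = estimator \<zeta> \<T> (zh \<T> (uh \<T>))"
    have EZ: "0 \<le> E" "0 \<le> Z" by (simp_all add: E_def Z_def estimator_on_nonneg)
    have V: "?e \<in> H10 \<Omega>" "?d \<in> H10 \<Omega>"
      using u z[OF uhV] zh[OF uhV] uhV fe_space_H10 unfolding primal_solution_def dual_solution_def
      by (auto intro!: function_subspace_diff[OF H10_subspace])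
    have en: "energy_norm \<Omega> A ?e \<le> Crel * E" "energy_norm \<Omega> A ?d \<le> Crel * Z"
      using rel T uhV unfolding reliability_def E_def Z_def by blast+
    have e: "H1_norm \<Omega> ?e \<le> L * E" and d: "H1_norm \<Omega> ?d \<le> L * Z"
      using order_trans[OF CE(2)[OF V(1)] mult_left_mono[OF en(1) less_imp_le[OF CE(1)]]]
        order_trans[OF CE(2)[OF V(2)] mult_left_mono[OF en(2) less_imp_le[OF CE(1)]]]
      by (simp_all add: L_def mult.assoc)
    have "\<bar>goal_functional K u - goal_functional K (uh \<T>)\<bar> \<le>
      Ca * H1_norm \<Omega> ?e * H1_norm \<Omega> ?d + \<bar>CK\<bar> * (H1_norm \<Omega> ?e)\<^sup>2"
      by (rule goal_error_bound[OF K c(3) _ u uh z[OF uhV] zh[OF uhV]]) (auto intro: fe_space_H10)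
    also have "\<dots> \<le> Ca * (L * E) * (L * Z) + \<bar>CK\<bar> * (L * E)\<^sup>2"
      using e d c(1) EZ L H1_norm_nonneg[OF V(1)] H1_norm_nonneg[OF V(2)]
      by (intro add_mono mult_mono power_mono mult_left_mono mult_nonneg_nonneg) auto
    also have "\<dots> = L\<^sup>2 * (Ca * (E * Z) + \<bar>CK\<bar> * E\<^sup>2)"
      by (simp add: power2_eq_square algebra_simps)
    also have "\<dots> \<le> L\<^sup>2 * (Ca * (E\<^sup>2 + Z\<^sup>2) + \<bar>CK\<bar> * (E\<^sup>2 + Z\<^sup>2))"
      using c(1) prod_le_sum_squares[OF EZ] by (intro mult_left_mono add_mono) auto
    also have "\<dots> \<le> (L\<^sup>2 * (Ca + \<bar>CK\<bar>) + 1) * (E\<^sup>2 + Z\<^sup>2)" by (simp add: algebra_simps)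
    finally show "\<bar>goal_functional K u - goal_functional K (uh \<T>)\<bar>
      \<le> (L\<^sup>2 * (Ca + \<bar>CK\<bar>) + 1) * ((estimator \<eta> \<T> (uh \<T>))\<^sup>2 + (estimator \<zeta> \<T> (zh \<T> (uh \<T>)))\<^sup>2)"
      by (simp add: E_def Z_def)
  qed
qed

text \<open>The contraction is linear in the square root of the estimator sum, so that root is shown
  to vanish. Stability measures increments in the energy norm, while their decay is known in the
  Sobolev norm; \<open>energy_le_H1_norm\<close> links the two.\<close>

lemma algorithm_B_estimator_tendsto_0:
  assumes K: "bounded_linear_operator \<Omega> K"
    and u: "primal_solution \<Omega> A b c f g (H10 \<Omega>) u"
    and z: "\<And>w. w \<in> H10 \<Omega> \<Longrightarrow> dual_solution \<Omega> A b c K (H10 \<Omega>) w (z w)"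
    and strategy: "refinement_strategy \<Omega> refine \<T>0"
    and uh: "\<And>\<T>. \<T> \<in> refinements refine \<T>0 \<Longrightarrow> primal_solution \<Omega> A b c f g (fe_space \<Omega> p \<T>) (uh \<T>)"
    and zh: "\<And>\<T> w. \<T> \<in> refinements refine \<T>0 \<Longrightarrow> w \<in> H10 \<Omega> \<Longrightarrow>
      dual_solution \<Omega> A b c K (fe_space \<Omega> p \<T>) w (zh \<T> w)"
    and stab: "stability \<Omega> A p refine \<T>0 \<eta> \<zeta> Cstab" and red: "reduction \<Omega> p refine \<T>0 \<eta> \<zeta> q"
    and q: "0 < q" "q < 1" and \<theta>: "0 < \<theta>" "\<theta> \<le> 1" and Cstab: "0 < Cstab"
    and alg: "algorithm_B refine \<T>0 \<eta> \<zeta> uh zh \<theta> Cmark \<T> \<M>"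
  shows "(\<lambda>l. (estimator \<eta> (\<T> l) (uh (\<T> l)))\<^sup>2 + (estimator \<zeta> (\<T> l) (zh (\<T> l) (uh (\<T> l))))\<^sup>2) \<longlonglongrightarrow> 0"
proof -
  have algM: "\<And>l. \<M> l \<subseteq> \<T> l"
    "\<And>l. marking_criterion \<eta> \<zeta> \<theta> (\<T> l) (uh (\<T> l)) (zh (\<T> l) (uh (\<T> l))) (\<M> l)"
    and algS: "\<And>l. \<T> (Suc l) = refine (\<T> l) (\<M> l)"
    using alg unfolding algorithm_B_def by blast+
  note T = algorithm_B_refinements[OF alg]
  have T_Suc: "\<T> (Suc l) \<in> refinements refine (\<T> l)" for l
    unfolding algS by (intro refinements.intros algM)
  have step: "finer (\<T> (Suc l)) (\<T> l)" "\<M> l \<subseteq> \<T> l - \<T> (Suc l)" for l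
    using strategy T[of l] algM(1)[of l] unfolding refinement_strategy_def algS by blast+
  define X where "X = (\<lambda>l. fe_space \<Omega> p (\<T> l))"
  define U where "U = (\<lambda>l. uh (\<T> l))"
  define Z where "Z = (\<lambda>l. zh (\<T> l) (U l))"
  have X: "X l \<subseteq> H10 \<Omega>" "function_subspace (X l)" "X l \<subseteq> X (Suc l)" for l
    using fe_space_H10 fe_space_subspace fe_space_nested[OF step(1)] by (auto simp: X_def)
  have U: "primal_solution \<Omega> A b c f g (X l) (U l)" for l unfolding X_def U_def by (rule uh[OF T])
  then have UX: "U l \<in> X l" for l by (simp add: primal_solution_def)
  then have UV: "U l \<in> H10 \<Omega>" for l using X(1) by blast
  have Zw: "dual_solution \<Omega> A b c K (X l) w (zh (\<T> l) w)" if "w \<in> H10 \<Omega>" for l w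
    unfolding X_def by (rule zh[OF T that])
  have ZX: "Z l \<in> X l" for l using Zw[OF UV, of l l] by (simp add: dual_solution_def Z_def)
  then have ZV: "Z l \<in> H10 \<Omega>" for l using X(1) by blast
  have Cauchy: "\<exists>n0. \<forall>m\<ge>n0. \<forall>n\<ge>n0. H1_norm \<Omega> (\<lambda>x. U m x - U n x) < e" if "0 < e" for e
    by (rule primal_Cauchy[where X = X and uh = U, OF X u U that])
  have dU: "(\<lambda>l. H1_norm \<Omega> (\<lambda>x. U (Suc l) x - U l x)) \<longlonglongrightarrow> 0"
  proof (rule LIMSEQ_I)
    fix e :: real assume "0 < e"
    then obtain n0 where n0: "\<And>m n. m \<ge> n0 \<Longrightarrow> n \<ge> n0 \<Longrightarrow> H1_norm \<Omega> (\<lambda>x. U m x - U n x) < e"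
      using Cauchy by blast
    have "0 \<le> H1_norm \<Omega> (\<lambda>x. U (Suc l) x - U l x)" for l
      by (intro H1_norm_nonneg function_subspace_diff[OF H10_subspace] UV)
    then show "\<exists>no. \<forall>n\<ge>no. norm (H1_norm \<Omega> (\<lambda>x. U (Suc n) x - U n x) - 0) < e"
      using n0 by (intro exI[of _ n0]) auto
  qed
  have dZ: "(\<lambda>l. H1_norm \<Omega> (\<lambda>x. Z (Suc l) x - Z l x)) \<longlonglongrightarrow> 0"
    unfolding Z_def by (rule dual_increments_tendsto_0[where X = X and uh = U and zh = "\<lambda>l. zh (\<T> l)", OF K X z Zw UV Cauchy])
  obtain CU where CU: "0 < CU" "\<And>v. v \<in> H1_space \<Omega> \<Longrightarrow> energy_norm \<Omega> A v \<le> CU * H1_norm \<Omega> v"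
    using energy_le_H1_norm by blast
  define e where "e = (\<lambda>l. Cstab * (CU * H1_norm \<Omega> (\<lambda>x. U (Suc l) x - U l x) + CU * H1_norm \<Omega> (\<lambda>x. Z (Suc l) x - Z l x)))"
  have e: "e \<longlonglongrightarrow> 0"
    unfolding e_def using tendsto_mult_right_zero[OF tendsto_add_zero[OF tendsto_mult_right_zero[OF dU] tendsto_mult_right_zero[OF dZ]]] .
  define s where "s = (\<lambda>l. sqrt ((estimator \<eta> (\<T> l) (U l))\<^sup>2 + (estimator \<zeta> (\<T> l) (Z l))\<^sup>2))"
  define k where "k = sqrt (1 - (1 - q\<^sup>2) * \<theta>)"
  have q2: "0 < 1 - q\<^sup>2" "1 - q\<^sup>2 \<le> 1" using q by (auto simp: power_less_one_iff)
  \<comment> \<open>The first bound keeps the radicand of \<open>k\<close> nonnegative, the second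
    keeps it below 1.\<close>
  have "(1 - q\<^sup>2) * \<theta> \<le> 1" "0 < (1 - q\<^sup>2) * \<theta>" using q2 \<theta> by (auto intro: mult_le_one)
  then have k: "0 \<le> k" "k < 1" by (simp_all add: k_def)
  have "s \<longlonglongrightarrow> 0"
  proof (rule perturbed_contraction_tendsto_0[OF _ k _ e])
    fix l
    have "energy_norm \<Omega> A (\<lambda>x. U (Suc l) x - U l x) \<le> CU * H1_norm \<Omega> (\<lambda>x. U (Suc l) x - U l x)"
      "energy_norm \<Omega> A (\<lambda>x. Z (Suc l) x - Z l x) \<le> CU * H1_norm \<Omega> (\<lambda>x. Z (Suc l) x - Z l x)"
      by (intro CU H10_H1 function_subspace_diff[OF H10_subspace] UV ZV)+
    then have "Cstab * (energy_norm \<Omega> A (\<lambda>x. U (Suc l) x - U l x) + energy_norm \<Omega> A (\<lambda>x. Z (Suc l) x - Z l x)) \<le> e l"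
      unfolding e_def using Cstab by (intro mult_left_mono add_mono) auto
    moreover have "s (Suc l) \<le> k * s l +
      Cstab * (energy_norm \<Omega> A (\<lambda>x. U (Suc l) x - U l x) + energy_norm \<Omega> A (\<lambda>x. Z (Suc l) x - Z l x))"
      unfolding s_def k_def
    proof (rule estimator_contraction[OF T _ T_Suc _ _ step(2) stab red q])
      show "finite (\<T> l)" "finite (\<T> (Suc l))" by (rule refinement_strategy_finite[OF strategy T])+
      show "fe_space \<Omega> p (\<T> l) \<subseteq> fe_space \<Omega> p (\<T> (Suc l))" using X(3)[of l] by (simp add: X_def)
      show "U l \<in> fe_space \<Omega> p (\<T> l)" "Z l \<in> fe_space \<Omega> p (\<T> l)"
        "U (Suc l) \<in> fe_space \<Omega> p (\<T> (Suc l))" "Z (Suc l) \<in> fe_space \<Omega> p (\<T> (Suc l))"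
        using UX[of l] UX[of "Suc l"] ZX[of l] ZX[of "Suc l"] by (simp_all add: X_def)
      show "marking_criterion \<eta> \<zeta> \<theta> (\<T> l) (U l) (Z l) (\<M> l)"
        using algM(2) by (simp add: U_def Z_def)
    qed
    ultimately show "s (Suc l) \<le> k * s l + e l" by linarith
    show "0 \<le> s l" by (simp add: s_def)
  qed
  from tendsto_power[OF this, of 2] show ?thesis by (simp add: s_def U_def Z_def)
qed

end

text \<open>The bound \<open>CK\<close> is fixed before \<open>K\<close>: this expresses that the
  constant sees the operator only through its boundedness.\<close>

theorem proposition4:
  fixes \<Omega> :: "(real^'d) set"
    and A :: "real^'d \<Rightarrow> real^'d^'d" and b :: "real^'d \<Rightarrow> real^'d" and c :: "real^'d \<Rightarrow> real"
    and Cstab qred Crel CK :: real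
  assumes "2 \<le> CARD('d)"
    and "bounded_lipschitz_domain \<Omega>"
    and "admissible_coefficients \<Omega> A b c"
    and "0 < Cstab" and "0 < qred" and "qred < 1" and "0 < Crel"
  shows "\<exists>Crel'>0.
    \<forall>(K :: (real^'d \<Rightarrow> real) \<Rightarrow> (real^'d \<Rightarrow> real) \<Rightarrow> real)
     (f :: real^'d \<Rightarrow> real) (g :: real^'d \<Rightarrow> real^'d) (p :: nat)
     (refine :: 'd mesh \<Rightarrow> 'd mesh \<Rightarrow> 'd mesh) (\<T>0 :: 'd mesh)
     (u :: real^'d \<Rightarrow> real) (z :: (real^'d \<Rightarrow> real) \<Rightarrow> real^'d \<Rightarrow> real)
     (uh :: 'd mesh \<Rightarrow> real^'d \<Rightarrow> real)
     (zh :: 'd mesh \<Rightarrow> (real^'d \<Rightarrow> real) \<Rightarrow> real^'d \<Rightarrow> real)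
     (\<eta> :: 'd indicator) (\<zeta> :: 'd indicator) (Cdrel :: real).
      bounded_linear_operator \<Omega> K \<and> operator_norm \<Omega> K \<le> CK \<and>
      f \<in> L2_space \<Omega> \<and> g \<in> L2_space \<Omega> \<and> 1 \<le> p \<and>
      primal_solution \<Omega> A b c f g (H10 \<Omega>) u \<and>
      (\<forall>w\<in>H10 \<Omega>. dual_solution \<Omega> A b c K (H10 \<Omega>) w (z w)) \<and>
      refinement_strategy \<Omega> refine \<T>0 \<and> mesh_assumptions refine \<T>0 \<and>
      (\<forall>\<T>\<in>refinements refine \<T>0.
         primal_solution \<Omega> A b c f g (fe_space \<Omega> p \<T>) (uh \<T>) \<and>
         (\<forall>w\<in>H10 \<Omega>. dual_solution \<Omega> A b c K (fe_space \<Omega> p \<T>) w (zh \<T> w))) \<and>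
      nonneg_indicator \<Omega> p refine \<T>0 \<eta> \<and> nonneg_indicator \<Omega> p refine \<T>0 \<zeta> \<and>
      stability \<Omega> A p refine \<T>0 \<eta> \<zeta> Cstab \<and>
      reduction \<Omega> p refine \<T>0 \<eta> \<zeta> qred \<and>
      reliability \<Omega> A refine \<T>0 \<eta> \<zeta> u uh z zh Crel \<and>
      0 < Cdrel \<and> discrete_reliability \<Omega> A refine \<T>0 \<eta> \<zeta> uh zh Cdrel
      \<longrightarrow>
      (\<forall>\<T>\<in>refinements refine \<T>0.
         \<bar>goal_functional K u - goal_functional K (uh \<T>)\<bar>
           \<le> Crel' * ((estimator \<eta> \<T> (uh \<T>))\<^sup>2 + (estimator \<zeta> \<T> (zh \<T> (uh \<T>)))\<^sup>2)) \<and>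
      (\<forall>(\<theta> :: real) (Cmark :: ereal) (\<T> :: nat \<Rightarrow> 'd mesh) (\<M> :: nat \<Rightarrow> 'd mesh).
         0 < \<theta> \<and> \<theta> \<le> 1 \<and> 1 < Cmark \<and> algorithm_B refine \<T>0 \<eta> \<zeta> uh zh \<theta> Cmark \<T> \<M> \<longrightarrow>
         (\<forall>l. \<bar>goal_functional K u - goal_functional K (uh (\<T> l))\<bar>
                \<le> Crel' * ((estimator \<eta> (\<T> l) (uh (\<T> l)))\<^sup>2
                           + (estimator \<zeta> (\<T> l) (zh (\<T> l) (uh (\<T> l))))\<^sup>2)) \<and>
         (\<lambda>l. Crel' * ((estimator \<eta> (\<T> l) (uh (\<T> l)))\<^sup>2
                       + (estimator \<zeta> (\<T> l) (zh (\<T> l) (uh (\<T> l))))\<^sup>2)) \<longlonglongrightarrow> 0)"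
proof -
  interpret elliptic_problem \<Omega> A b c
    using assms(2,3) by unfold_locales (auto simp: bounded_lipschitz_domain_def)
  obtain C where C: "0 < C" "\<And>K f g p refine \<T>0 u z uh zh \<eta> \<zeta> \<T>.
    bounded_linear_operator \<Omega> K \<Longrightarrow> operator_norm \<Omega> K \<le> CK \<Longrightarrow>
    primal_solution \<Omega> A b c f g (H10 \<Omega>) u \<Longrightarrow>
    (\<And>w. w \<in> H10 \<Omega> \<Longrightarrow> dual_solution \<Omega> A b c K (H10 \<Omega>) w (z w)) \<Longrightarrow>
    primal_solution \<Omega> A b c f g (fe_space \<Omega> p \<T>) (uh \<T>) \<Longrightarrow>
    (\<And>w. w \<in> H10 \<Omega> \<Longrightarrow> dual_solution \<Omega> A b c K (fe_space \<Omega> p \<T>) w (zh \<T> w)) \<Longrightarrow>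
    reliability \<Omega> A refine \<T>0 \<eta> \<zeta> u uh z zh Crel \<Longrightarrow> \<T> \<in> refinements refine \<T>0 \<Longrightarrow>
    \<bar>goal_functional K u - goal_functional K (uh \<T>)\<bar>
      \<le> C * ((estimator \<eta> \<T> (uh \<T>))\<^sup>2 + (estimator \<zeta> \<T> (zh \<T> (uh \<T>)))\<^sup>2)"
    using goal_error_estimate[OF assms(7), of CK] by metis
  show ?thesis
  proof (intro exI[of _ C] conjI[OF C(1)] allI impI, elim conjE, goal_cases)
    case (1 K f g p refine \<T>0 u z uh zh \<eta> \<zeta> Cdrel)
    have est: "\<bar>goal_functional K u - goal_functional K (uh \<T>)\<bar>
        \<le> C * ((estimator \<eta> \<T> (uh \<T>))\<^sup>2 + (estimator \<zeta> \<T> (zh \<T> (uh \<T>)))\<^sup>2)"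
      if "\<T> \<in> refinements refine \<T>0" for \<T>
      by (rule C(2)[of K f g u z p \<T> uh zh refine \<T>0 \<eta> \<zeta>]) (use 1 that in blast)+
    show ?case
    proof (intro conjI ballI allI impI)
      fix \<T> assume "\<T> \<in> refinements refine \<T>0"
      then show "\<bar>goal_functional K u - goal_functional K (uh \<T>)\<bar>
        \<le> C * ((estimator \<eta> \<T> (uh \<T>))\<^sup>2 + (estimator \<zeta> \<T> (zh \<T> (uh \<T>)))\<^sup>2)" by (rule est)
    next
      fix \<theta> Cmark \<T> \<M> l
      assume "0 < \<theta> \<and> \<theta> \<le> 1 \<and> 1 < Cmark \<and> algorithm_B refine \<T>0 \<eta> \<zeta> uh zh \<theta> Cmark \<T> \<M>"
      then have "\<T> l \<in> refinements refine \<T>0" using algorithm_B_refinements by blast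
      then show "\<bar>goal_functional K u - goal_functional K (uh (\<T> l))\<bar>
        \<le> C * ((estimator \<eta> (\<T> l) (uh (\<T> l)))\<^sup>2 + (estimator \<zeta> (\<T> l) (zh (\<T> l) (uh (\<T> l))))\<^sup>2)"
        by (rule est)
    next
      fix \<theta> Cmark \<T> \<M>
      assume alg: "0 < \<theta> \<and> \<theta> \<le> 1 \<and> 1 < Cmark \<and> algorithm_B refine \<T>0 \<eta> \<zeta> uh zh \<theta> Cmark \<T> \<M>"
      have "(\<lambda>l. (estimator \<eta> (\<T> l) (uh (\<T> l)))\<^sup>2 + (estimator \<zeta> (\<T> l) (zh (\<T> l) (uh (\<T> l))))\<^sup>2) \<longlonglongrightarrow> 0"
        by (rule algorithm_B_estimator_tendsto_0[of K f g u z refine \<T>0 p uh zh \<eta> \<zeta> Cstab qred \<theta> Cmark \<T> \<M>])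
          (use 1 alg assms(4-6) in blast)+
      then show "(\<lambda>l. C * ((estimator \<eta> (\<T> l) (uh (\<T> l)))\<^sup>2
          + (estimator \<zeta> (\<T> l) (zh (\<T> l) (uh (\<T> l))))\<^sup>2)) \<longlonglongrightarrow> 0"
        by (rule tendsto_mult_right_zero)
    qed
  qed
qed

end
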